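(* Let $\nabla$ be a symplectic self-duality on a locally compact abelian group $L$. If $G$ is a compact open maximal isotropic subgroup of $L$ isomorphic to $\mathbf Z_p^l$ for some odd prime $p$ and some positive integer $l$, then $(L,\nabla,G)$ is a standard triple.
   Context: $\mathbf Z_p$ denotes the $p$-adic integers; $\mathbf T=\mathbf R/\mathbf Z$; $\hat L$ is the Pontryagin dual of a locally compact abelian (LCA) group $L$. A symplectic self-duality of $L$ is an isomorphism of topological groups $\nabla:L\to\hat L$ with $\nabla(x)(x)=0$ for all $x$. A subgroup $N$ is isotropic if $\nabla(x)(y)=0$ for $x,y\in N$; maximal isotropic means maximal among isotropic subgroups. For an LCA group $A$ and closed $B\subset A$, $B^\perp=\{\chi\in\hat A:\chi|_B=0\}$ and $\nabla^0(x,\chi)(y,\lambda)=\chi(y)-\lambda(x)$ on $A\times\hat A$. A triple $(L,\nabla,M)$, $M$ maximal isotropic, is standard if there exist an LCA group $A$, a closed subgroup $B\subset A$ and an isomorphism $\phi:A\times\hat A\to L$ with $\nabla(\phi(u))(\phi(v))=\nabla^0(u)(v)$ for all $u,v$ and $\phi(B\times B^\perp)=M$. *)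

theory Defs
  imports "HOL-Analysis.Analysis" "HOL-Computational_Algebra.Primes"
begin

record 'a tgroup =
  tg_carrier :: "'a set"
  tg_add :: "'a \<Rightarrow> 'a \<Rightarrow> 'a"
  tg_zero :: "'a"
  tg_neg :: "'a \<Rightarrow> 'a"
  tg_top :: "'a topology"

definition abelian_tgroup :: "'a tgroup \<Rightarrow> bool" where
  "abelian_tgroup G \<longleftrightarrow>
     (let C = tg_carrier G; p = tg_add G; z = tg_zero G; n = tg_neg G in
       z \<in> C \<and> (\<forall>x\<in>C. \<forall>y\<in>C. p x y \<in> C) \<and> (\<forall>x\<in>C. n x \<in> C) \<and>
       (\<forall>x\<in>C. \<forall>y\<in>C. \<forall>w\<in>C. p (p x y) w = p x (p y w)) \<and>
       (\<forall>x\<in>C. \<forall>y\<in>C. p x y = p y x) \<and>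
       (\<forall>x\<in>C. p z x = x) \<and> (\<forall>x\<in>C. p (n x) x = z) \<and>
       topspace (tg_top G) = C \<and>
       continuous_map (prod_topology (tg_top G) (tg_top G)) (tg_top G) (\<lambda>(x,y). p x y) \<and>
       continuous_map (tg_top G) (tg_top G) n)"

definition LCA :: "'a tgroup \<Rightarrow> bool" where
  "LCA G \<longleftrightarrow> abelian_tgroup G \<and> Hausdorff_space (tg_top G) \<and> locally_compact_space (tg_top G)"

definition is_subgroup :: "'a set \<Rightarrow> 'a tgroup \<Rightarrow> bool" where
  "is_subgroup H G \<longleftrightarrow> H \<subseteq> tg_carrier G \<and> tg_zero G \<in> H \<and>
     (\<forall>x\<in>H. \<forall>y\<in>H. tg_add G x y \<in> H) \<and> (\<forall>x\<in>H. tg_neg G x \<in> H)"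

definition sub_tgroup :: "'a tgroup \<Rightarrow> 'a set \<Rightarrow> 'a tgroup" where
  "sub_tgroup G H = \<lparr>tg_carrier = H, tg_add = tg_add G, tg_zero = tg_zero G,
                      tg_neg = tg_neg G, tg_top = subtopology (tg_top G) H\<rparr>"

definition tg_hom :: "'a tgroup \<Rightarrow> 'b tgroup \<Rightarrow> ('a \<Rightarrow> 'b) \<Rightarrow> bool" where
  "tg_hom G H f \<longleftrightarrow> f ` tg_carrier G \<subseteq> tg_carrier H \<and>
     (\<forall>x\<in>tg_carrier G. \<forall>y\<in>tg_carrier G. f (tg_add G x y) = tg_add H (f x) (f y))"

definition tg_iso :: "'a tgroup \<Rightarrow> 'b tgroup \<Rightarrow> ('a \<Rightarrow> 'b) \<Rightarrow> bool" where
  "tg_iso G H f \<longleftrightarrow> tg_hom G H f \<and> bij_betw f (tg_carrier G) (tg_carrier H) \<and>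
     homeomorphic_map (tg_top G) (tg_top H) f"

definition tg_isomorphic :: "'a tgroup \<Rightarrow> 'b tgroup \<Rightarrow> bool" where
  "tg_isomorphic G H \<longleftrightarrow> (\<exists>f. tg_iso G H f)"

definition prod_tgroup :: "'a tgroup \<Rightarrow> 'b tgroup \<Rightarrow> ('a \<times> 'b) tgroup" where
  "prod_tgroup G H = \<lparr>tg_carrier = tg_carrier G \<times> tg_carrier H,
     tg_add = (\<lambda>(x,y) (x',y'). (tg_add G x x', tg_add H y y')),
     tg_zero = (tg_zero G, tg_zero H),
     tg_neg = (\<lambda>(x,y). (tg_neg G x, tg_neg H y)),
     tg_top = prod_topology (tg_top G) (tg_top H)\<rparr>"

text \<open>The circle group T = R/Z is realised multiplicatively as the unit circle in C
  (via t \<mapsto> exp(2 pi i t)); thus 0 in T corresponds to 1, addition to multiplication.\<close>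

definition circle_top :: "complex topology" where
  "circle_top = subtopology euclidean (sphere 0 1)"

text \<open>Continuous characters; extended by 1 outside the carrier so that they are unique.\<close>
definition characters :: "'a tgroup \<Rightarrow> ('a \<Rightarrow> complex) set" where
  "characters G = {c. continuous_map (tg_top G) circle_top c \<and>
      (\<forall>x\<in>tg_carrier G. \<forall>y\<in>tg_carrier G. c (tg_add G x y) = c x * c y) \<and>
      (\<forall>x. x \<notin> tg_carrier G \<longrightarrow> c x = 1)}"

definition dual :: "'a tgroup \<Rightarrow> ('a \<Rightarrow> complex) tgroup" where
  "dual G = \<lparr>tg_carrier = characters G,
     tg_add = (\<lambda>c d x. c x * d x),
     tg_zero = (\<lambda>x. 1),
     tg_neg = (\<lambda>c x. cnj (c x)),
     tg_top = topology_generated_by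
        {{c \<in> characters G. c ` K \<subseteq> U} | K U. compactin (tg_top G) K \<and> open U}\<rparr>"

definition annihilator :: "'a tgroup \<Rightarrow> 'a set \<Rightarrow> ('a \<Rightarrow> complex) set" where
  "annihilator A B = {c \<in> characters A. \<forall>b\<in>B. c b = 1}"

definition symplectic_self_duality :: "'a tgroup \<Rightarrow> ('a \<Rightarrow> 'a \<Rightarrow> complex) \<Rightarrow> bool" where
  "symplectic_self_duality L nabla \<longleftrightarrow> tg_iso L (dual L) nabla \<and>
     (\<forall>x\<in>tg_carrier L. nabla x x = 1)"

definition isotropic :: "'a tgroup \<Rightarrow> ('a \<Rightarrow> 'a \<Rightarrow> complex) \<Rightarrow> 'a set \<Rightarrow> bool" where
  "isotropic L nabla N \<longleftrightarrow> is_subgroup N L \<and> (\<forall>x\<in>N. \<forall>y\<in>N. nabla x y = 1)"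

definition maximal_isotropic :: "'a tgroup \<Rightarrow> ('a \<Rightarrow> 'a \<Rightarrow> complex) \<Rightarrow> 'a set \<Rightarrow> bool" where
  "maximal_isotropic L nabla M \<longleftrightarrow> isotropic L nabla M \<and>
     (\<forall>N. isotropic L nabla N \<and> M \<subseteq> N \<longrightarrow> N = M)"

text \<open>The standard form nabla0 (x,chi)(y,lambda) = chi(y) - lambda(x), written multiplicatively.\<close>
definition nabla0 :: "('b \<times> ('b \<Rightarrow> complex)) \<Rightarrow> ('b \<times> ('b \<Rightarrow> complex)) \<Rightarrow> complex" where
  "nabla0 u v = snd u (fst v) * cnj (snd v (fst u))"

text \<open>Standard triple. The group A is taken with carrier inside the type of L; this loses
  no generality since A embeds into L via x \<mapsto> phi (x, 0).\<close>
definition standard_triple :: "'a tgroup \<Rightarrow> ('a \<Rightarrow> 'a \<Rightarrow> complex) \<Rightarrow> 'a set \<Rightarrow> bool" where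
  "standard_triple L nabla M \<longleftrightarrow>
     (\<exists>(A :: 'a tgroup) B phi. LCA A \<and> is_subgroup B A \<and> closedin (tg_top A) B \<and>
        tg_iso (prod_tgroup A (dual A)) L phi \<and>
        (\<forall>u\<in>tg_carrier (prod_tgroup A (dual A)). \<forall>v\<in>tg_carrier (prod_tgroup A (dual A)).
            nabla (phi u) (phi v) = nabla0 u v) \<and>
        phi ` (B \<times> annihilator A B) = M)"

text \<open>Z_p as the inverse limit of Z/p^n Z: compatible sequences of residues.\<close>
definition Zp :: "nat \<Rightarrow> (nat \<Rightarrow> int) tgroup" where
  "Zp p = (let C = {x. \<forall>n. 0 \<le> x n \<and> x n < int p ^ n \<and> x n = x (Suc n) mod int p ^ n} in
     \<lparr>tg_carrier = C,
      tg_add = (\<lambda>x y n. (x n + y n) mod int p ^ n),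
      tg_zero = (\<lambda>n. 0),
      tg_neg = (\<lambda>x n. (- x n) mod int p ^ n),
      tg_top = subtopology (product_topology (\<lambda>_. discrete_topology (UNIV :: int set)) UNIV) C\<rparr>)"

definition Zp_pow :: "nat \<Rightarrow> nat \<Rightarrow> (nat \<Rightarrow> nat \<Rightarrow> int) tgroup" where
  "Zp_pow p l = \<lparr>tg_carrier = PiE {..<l} (\<lambda>_. tg_carrier (Zp p)),
      tg_add = (\<lambda>x y. restrict (\<lambda>i. tg_add (Zp p) (x i) (y i)) {..<l}),
      tg_zero = restrict (\<lambda>i. tg_zero (Zp p)) {..<l},
      tg_neg = (\<lambda>x. restrict (\<lambda>i. tg_neg (Zp p) (x i)) {..<l}),
      tg_top = product_topology (\<lambda>_. tg_top (Zp p)) {..<l}\<rparr>"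

end

theory Submission
  imports Defs "HOL-Library.Function_Algebras" "HOL-Number_Theory.Cong"
begin

text \<open>It suffices to write \<open>L\<close> as a sum of two isotropic subgroups \<open>A\<close>, \<open>A'\<close> with
  \<open>G = (G \<inter> A) + (G \<inter> A')\<close>: then both are closed, the projection onto \<open>A\<close> along \<open>A'\<close> is continuous
  because \<open>G\<close> is compact and open, and \<open>nabla\<close> identifies \<open>A'\<close> with the dual of \<open>A\<close>.

  Maximality gives \<open>G = G\<^sup>\<bottom>\<close>, so \<open>L / G\<close> is the dual of \<open>G\<close>, hence \<open>p\<close>-divisible and \<open>p\<close>-torsion. Let
  \<open>tate\<close> be the group of sequences \<open>x\<close> in \<open>L\<close> with \<open>p x(n+1) = x(n)\<close> and \<open>x(0) \<in> G\<close>; it is a free module over the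
  \<open>p\<close>-adic integers, and its entries together with \<open>G\<close> exhaust \<open>L\<close>. The values \<open>nabla (x n) (y 0)\<close> define
  an alternating form on \<open>tate\<close> with values in the Tate module of the circle. Splitting off pairs of
  minimal valuation decomposes \<open>tate\<close> into two isotropic summands; \<open>A\<close> and \<open>A'\<close> are generated by their
  entries and by suitable parts of \<open>G\<close>.\<close>

section \<open>Additive circle group and multiples\<close>

text \<open>The carrier of \<open>L\<close> is only a set with operations from a record, so the
  algebra takes place elsewhere: \<open>emb\<close> sends \<open>x\<close> to the function
  \<open>nabla x\<close> with values in the type \<open>circ\<close>, and the locale
  \<open>self_perp_pairing\<close> works with subgroups of an additive type. Topology enters that
  locale only through its consequences: a character trivial on the open subgroup \<open>G\<close> is
  continuous and hence represented in \<open>L\<close>, and compactness of \<open>G\<close> makes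
  \<open>L / G\<close> torsion. Splitting \<open>G\<close> as a module would not split
  \<open>L\<close>, since the extension of \<open>L / G\<close> by \<open>G\<close> can be
  non-trivial. The alternating form on \<open>tate\<close> records that extension; it may be
  degenerate, and its elementary divisors need not be units. This is why the pair to be split off
  must have minimal valuation, and why a radical may be left over, which joins one of the two sides.
  The p-adic integers never appear as scalars: integer multiples modulo \<open>p ^ n\<close>
  approximate them, and division by a value of the form is done in finite cyclic subgroups of the
  circle.\<close>

typedef circ = "sphere 0 1 :: complex set"
  by (rule exI[of _ 1]) simp

setup_lifting type_definition_circ

instantiation circ :: ab_group_add
begin

lift_definition zero_circ :: circ is 1 by simp
lift_definition plus_circ :: "circ \<Rightarrow> circ \<Rightarrow> circ" is "(*)" by (simp add: norm_mult)
lift_definition uminus_circ :: "circ \<Rightarrow> circ" is cnj by simp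
definition minus_circ :: "circ \<Rightarrow> circ \<Rightarrow> circ" where "minus_circ a b = a + (- b)"

instance
proof
  show "a + b + c = a + (b + c)" for a b c :: circ by transfer (simp add: mult.assoc)
  show "a + b = b + a" for a b :: circ by transfer (simp add: mult.commute)
  show "0 + a = a" for a :: circ by transfer simp
  show "- a + a = 0" for a :: circ
    by transfer (metis complex_norm_square mem_sphere_0 mult.commute of_real_1 one_power2)
  show "a - b = a + - b" for a b :: circ by (rule minus_circ_def)
qed

end

lemma Rep_circ_0: "Rep_circ 0 = 1" by (rule zero_circ.rep_eq)
lemma Rep_circ_add: "Rep_circ (a + b) = Rep_circ a * Rep_circ b" by (rule plus_circ.rep_eq)
lemma Rep_circ_uminus: "Rep_circ (- a) = cnj (Rep_circ a)" by (rule uminus_circ.rep_eq)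

text \<open>Natural multiples suffice: a negative coefficient is replaced by a subtraction, or by a
  natural number in the same residue class modulo a power of \<open>p\<close>.\<close>

primrec nmul :: "nat \<Rightarrow> 'a \<Rightarrow> 'a :: ab_group_add" where
  "nmul 0 x = 0"
| "nmul (Suc n) x = x + nmul n x"

lemma nmul_add: "nmul (m + n) x = nmul m x + nmul n x"
  by (induction m) (auto simp: algebra_simps)

lemma nmul_plus: "nmul m (x + y) = nmul m x + nmul m y"
  by (induction m) (auto simp: algebra_simps)

lemma nmul_zero [simp]: "nmul m 0 = 0"
  by (induction m) auto

lemma nmul_one [simp]: "nmul 1 x = x" "nmul (Suc 0) x = x"
  by auto

lemma nmul_uminus: "nmul m (- x) = - nmul m x"
  by (induction m) (auto simp: algebra_simps)

lemma nmul_minus: "nmul m (x - y) = nmul m x - nmul m y"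
  using nmul_plus[of m x "- y"] by (simp add: nmul_uminus)

lemma nmul_mult: "nmul (m * n) x = nmul m (nmul n x)"
  by (induction m) (auto simp: nmul_add)

lemma nmul_commute: "nmul m (nmul n x) = nmul n (nmul m x)"
  by (metis nmul_mult mult.commute)

lemma nmul_power_add: "nmul (p ^ (i + j)) x = nmul (p ^ i) (nmul (p ^ j) x)"
  by (simp add: power_add nmul_mult)

lemma nmul_power_Suc: "nmul (p ^ Suc n) x = nmul (p ^ n) (nmul p x)"
  using nmul_power_add[of p n 1 x] by simp

lemma nmul_power_zero_mono:
  assumes "nmul (p ^ i) x = 0" "i \<le> j"
  shows "nmul (p ^ j) x = 0"
  using assms nmul_power_add[of p "j - i" i x] by simp

lemma nmul_fun: "nmul k f = (\<lambda>n. nmul k (f n))"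
  by (induction k) (auto simp: fun_eq_iff)

lemma nmul_apply: "nmul k f n = nmul k (f n)"
  by (simp add: nmul_fun)

lemma Rep_circ_nmul: "Rep_circ (nmul k a) = Rep_circ a ^ k"
  by (induction k) (auto simp: Rep_circ_0 Rep_circ_add)

text \<open>The two middle hypotheses say that \<open>z\<close> has exact order
  \<open>p ^ Suc n\<close>. By Bezout the gcd of \<open>d\<close> and \<open>p ^ Suc n\<close>, a
  power of \<open>p\<close>, also kills \<open>z\<close>; no power below the order does.\<close>

lemma order_dvd:
  fixes z :: "'a :: ab_group_add"
  assumes "prime p" "nmul (p ^ Suc n) z = 0" "nmul (p ^ n) z \<noteq> 0" "nmul d z = 0"
  shows "p ^ Suc n dvd d"
proof (cases "d = 0")
  case False
  obtain i where i: "i \<le> Suc n" "gcd d (p ^ Suc n) = p ^ i"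
    using divides_primepow_nat[OF assms(1)] by (metis gcd_dvd2)
  obtain x y where "d * x = p ^ Suc n * y + gcd d (p ^ Suc n)"
    using bezout_nat[OF False] by blast
  then have "nmul (d * x) z = nmul (p ^ Suc n * y) z + nmul (p ^ i) z"
    using i by (simp add: nmul_add)
  moreover have "nmul (d * x) z = 0" "nmul (p ^ Suc n * y) z = 0"
    using assms(2,4) by (metis mult.commute nmul_mult nmul_zero)+
  ultimately have "nmul (p ^ i) z = 0" by simp
  then have "\<not> i \<le> n" using nmul_power_zero_mono assms(3) by blast
  then show ?thesis using i by (metis gcd_dvd1 le_SucE)
qed simp

lemma order_cong:
  fixes z :: "'a :: ab_group_add"
  assumes "prime p" "nmul (p ^ Suc n) z = 0" "nmul (p ^ n) z \<noteq> 0" "nmul a z = nmul b z" "b \<le> a"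
  shows "p ^ Suc n dvd a - b"
proof (rule order_dvd[OF assms(1-3)])
  have "nmul (a - b) z + nmul b z = nmul a z"
    by (metis assms(5) le_add_diff_inverse2 nmul_add)
  then show "nmul (a - b) z = 0" using assms(4) by simp
qed

text \<open>Since \<open>k\<close> is invertible modulo \<open>p\<close>, a subgroup that contains
  the \<open>p\<close>-th multiple of \<open>y\<close> and the \<open>k\<close>-th one contains
  \<open>y\<close>.\<close>

lemma nmul_bezout:
  fixes y :: "'a :: ab_group_add"
  assumes "prime p" "\<not> p dvd k"
  obtains a b where "y = nmul a (nmul k y) - nmul b (nmul p y)"
proof -
  have "gcd k p = 1" using assms by (metis coprime_iff_gcd_eq_1 gcd.commute prime_imp_coprime)
  moreover have "k \<noteq> 0" using assms(2) by (metis dvd_0_right)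
  ultimately obtain a b where "k * a = p * b + 1" using bezout_nat[of k p] by auto
  then have "nmul a (nmul k y) = nmul b (nmul p y) + y"
    by (metis mult.commute nmul_mult nmul_add nmul_one(1))
  then have "y = nmul a (nmul k y) - nmul b (nmul p y)" by simp
  then show ?thesis by (rule that)
qed

text \<open>A counting argument: the multiples of \<open>z\<close> below its order are that many
  distinct roots of unity, and the polynomial has no further roots.\<close>

lemma circ_cyclic:
  fixes z t :: circ
  assumes "prime p" "nmul (p ^ Suc n) z = 0" "nmul (p ^ n) z \<noteq> 0" "nmul (p ^ Suc n) t = 0"
  shows "\<exists>k. t = nmul k z"
proof -
  let ?N = "p ^ Suc n" and ?f = "\<lambda>k. Rep_circ (nmul k z)"
  have N: "?N \<ge> 1" using assms(1) prime_gt_0_nat by (simp add: Suc_leI)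
  have root: "Rep_circ s ^ ?N = 1" if "nmul ?N s = 0" for s
    using that by (metis Rep_circ_nmul Rep_circ_0)
  have inj: "inj_on ?f {..<?N}"
  proof (rule linorder_inj_onI)
    fix a b assume ab: "a < b" "a \<in> {..<?N}" "b \<in> {..<?N}"
    show "?f a \<noteq> ?f b"
    proof
      assume "?f a = ?f b"
      then have "nmul b z = nmul a z" by (simp add: Rep_circ_inject)
      from order_cong[OF assms(1-3) this] ab have "?N dvd b - a" by simp
      with ab show False by (auto dest: dvd_imp_le)
    qed
  qed auto
  have sub: "?f ` {..<?N} \<subseteq> {w. w ^ ?N = 1}"
    using root assms(2) by (auto simp: Rep_circ_nmul) (metis power_commutes power_mult power_one mult.commute power_Suc)
  have "card (?f ` {..<?N}) = ?N" using card_image[OF inj] by simp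
  moreover have "card {w::complex. w ^ ?N = 1} = ?N"
    using N by (intro card_roots_unity_eq) simp
  moreover have "finite {w::complex. w ^ ?N = 1}" using N by (intro finite_roots_unity) simp
  ultimately have "?f ` {..<?N} = {w. w ^ ?N = 1}" using sub by (metis card_subset_eq)
  moreover have "Rep_circ t \<in> {w. w ^ ?N = 1}" using root[OF assms(4)] by simp
  ultimately obtain k where "Rep_circ t = ?f k" by blast
  then show ?thesis by (auto simp: Rep_circ_inject)
qed

section \<open>Subgroups and their sums\<close>

definition subgrp :: "'a :: ab_group_add set \<Rightarrow> bool" where
  "subgrp H \<longleftrightarrow> 0 \<in> H \<and> (\<forall>x\<in>H. \<forall>y\<in>H. x - y \<in> H)"

lemma subgrpI: "0 \<in> H \<Longrightarrow> (\<And>x y. x \<in> H \<Longrightarrow> y \<in> H \<Longrightarrow> x - y \<in> H) \<Longrightarrow> subgrp H"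
  by (simp add: subgrp_def)

lemma subgrp_0: "subgrp H \<Longrightarrow> 0 \<in> H"
  and subgrp_diff: "subgrp H \<Longrightarrow> x \<in> H \<Longrightarrow> y \<in> H \<Longrightarrow> x - y \<in> H"
  by (auto simp: subgrp_def)

lemma subgrp_uminus: "subgrp H \<Longrightarrow> x \<in> H \<Longrightarrow> - x \<in> H"
  using subgrp_diff[of H 0 x] subgrp_0[of H] by simp

lemma subgrp_add: "subgrp H \<Longrightarrow> x \<in> H \<Longrightarrow> y \<in> H \<Longrightarrow> x + y \<in> H"
  using subgrp_diff[of H x "- y"] subgrp_uminus[of H y] by simp

lemma subgrp_nmul: "subgrp H \<Longrightarrow> x \<in> H \<Longrightarrow> nmul k x \<in> H"
  by (induction k) (auto simp: subgrp_0 subgrp_add)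

lemmas subgrp_rules = subgrp_0 subgrp_diff subgrp_uminus subgrp_add subgrp_nmul

definition ssum :: "'a :: ab_group_add set \<Rightarrow> 'a set \<Rightarrow> 'a set" where
  "ssum H K = {x + y | x y. x \<in> H \<and> y \<in> K}"

lemma ssumI: "x \<in> H \<Longrightarrow> y \<in> K \<Longrightarrow> x + y \<in> ssum H K"
  by (auto simp: ssum_def)

lemma ssumE: "z \<in> ssum H K \<Longrightarrow> (\<And>x y. x \<in> H \<Longrightarrow> y \<in> K \<Longrightarrow> z = x + y \<Longrightarrow> thesis) \<Longrightarrow> thesis"
  by (auto simp: ssum_def)

lemma subgrp_ssum:
  assumes "subgrp H" "subgrp K" shows "subgrp (ssum H K)"
proof (rule subgrpI)
  show "0 \<in> ssum H K" using ssumI[of 0 H 0 K] assms by (simp add: subgrp_0)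
  fix a b assume "a \<in> ssum H K" "b \<in> ssum H K"
  then obtain x y x' y' where "x \<in> H" "y \<in> K" "a = x + y" "x' \<in> H" "y' \<in> K" "b = x' + y'"
    by (auto elim!: ssumE)
  then show "a - b \<in> ssum H K"
    using ssumI[of "x - x'" H "y - y'" K] assms by (simp add: subgrp_diff algebra_simps)
qed

lemma ssum_left: "subgrp K \<Longrightarrow> x \<in> H \<Longrightarrow> x \<in> ssum H K"
  using ssumI[of x H 0 K] by (simp add: subgrp_0)

lemma ssum_right: "subgrp H \<Longrightarrow> x \<in> K \<Longrightarrow> x \<in> ssum H K"
  using ssumI[of 0 H x K] by (simp add: subgrp_0)

section \<open>The Tate module of a self-perpendicular subgroup\<close>

text \<open>\<open>characters_represented\<close> is the surjectivity of the duality on characters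
  of \<open>L / G\<close>. In \<open>power_series\<close>, \<open>S h\<close> stands for the
  convergent sum of all \<open>p ^ k * h k\<close>, of which only the recursion matters. In
  \<open>finite_test\<close>, \<open>F\<close> is to represent \<open>G / pG\<close>; it bounds the
  number of pairs that can be split off.\<close>

locale self_perp_pairing =
  fixes L G :: "'g :: ab_group_add set" and e :: "'g \<Rightarrow> 'g \<Rightarrow> circ" and p :: nat
  assumes prime_p: "prime p"
    and sgL: "subgrp L" and sgG: "subgrp G" and GL: "G \<subseteq> L"
    and e_add_left: "\<lbrakk>x \<in> L; y \<in> L; z \<in> L\<rbrakk> \<Longrightarrow> e (x + y) z = e x z + e y z"
    and e_add_right: "\<lbrakk>x \<in> L; y \<in> L; z \<in> L\<rbrakk> \<Longrightarrow> e x (y + z) = e x y + e x z"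
    and e_alt: "x \<in> L \<Longrightarrow> e x x = 0"
    and e_nondeg: "\<lbrakk>x \<in> L; \<forall>y\<in>L. e x y = 0\<rbrakk> \<Longrightarrow> x = 0"
    and G_perp: "x \<in> L \<Longrightarrow> x \<in> G \<longleftrightarrow> (\<forall>g\<in>G. e x g = 0)"
    and characters_represented:
      "\<lbrakk>\<And>x y. x \<in> L \<Longrightarrow> y \<in> L \<Longrightarrow> \<psi> (x + y) = \<psi> x + \<psi> y; \<And>g. g \<in> G \<Longrightarrow> \<psi> g = 0\<rbrakk>
        \<Longrightarrow> \<exists>z\<in>L. \<forall>y\<in>L. e z y = \<psi> y"
    and torsion: "x \<in> L \<Longrightarrow> \<exists>n. nmul (p ^ n) x \<in> G"
    and torsion_free: "\<lbrakk>g \<in> G; nmul p g = 0\<rbrakk> \<Longrightarrow> g = 0"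
    and separated: "(\<And>n. \<exists>h\<in>G. g = nmul (p ^ n) h) \<Longrightarrow> g = 0"
    and power_series: "\<exists>S. \<forall>h. (\<forall>n. h n \<in> G) \<longrightarrow> S h \<in> G \<and> S h = h 0 + nmul p (S (\<lambda>n. h (Suc n)))"
    and finite_test: "\<exists>F. finite F \<and> F \<subseteq> G \<and>
        (\<forall>x\<in>L. nmul p x \<in> G \<longrightarrow> (\<forall>f\<in>F. e x f = 0) \<longrightarrow> x \<in> G)"
begin

lemma GLD: "x \<in> G \<Longrightarrow> x \<in> L"
  using GL by blast

lemmas L_rules = subgrp_rules[OF sgL]
lemmas G_rules = subgrp_rules[OF sgG]

lemma e_0_left [simp]: "z \<in> L \<Longrightarrow> e 0 z = 0"
  using e_add_left[of 0 0 z] by (simp add: L_rules)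

lemma e_0_right [simp]: "z \<in> L \<Longrightarrow> e z 0 = 0"
  using e_add_right[of z 0 0] by (simp add: L_rules)

lemma e_uminus_left: "x \<in> L \<Longrightarrow> z \<in> L \<Longrightarrow> e (- x) z = - e x z"
  using e_add_left[of x "- x" z] by (simp add: L_rules eq_neg_iff_add_eq_0 add.commute)

lemma e_uminus_right: "x \<in> L \<Longrightarrow> z \<in> L \<Longrightarrow> e z (- x) = - e z x"
  using e_add_right[of z x "- x"] by (simp add: L_rules eq_neg_iff_add_eq_0 add.commute)

lemma e_diff_left: "x \<in> L \<Longrightarrow> y \<in> L \<Longrightarrow> z \<in> L \<Longrightarrow> e (x - y) z = e x z - e y z"
  using e_add_left[of x "- y" z] by (simp add: L_rules e_uminus_left)

lemma e_diff_right: "x \<in> L \<Longrightarrow> y \<in> L \<Longrightarrow> z \<in> L \<Longrightarrow> e z (x - y) = e z x - e z y"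
  using e_add_right[of z x "- y"] by (simp add: L_rules e_uminus_right)

lemma e_nmul_left: "x \<in> L \<Longrightarrow> z \<in> L \<Longrightarrow> e (nmul k x) z = nmul k (e x z)"
  by (induction k) (auto simp: L_rules e_add_left)

lemma e_nmul_right: "x \<in> L \<Longrightarrow> z \<in> L \<Longrightarrow> e z (nmul k x) = nmul k (e z x)"
  by (induction k) (auto simp: L_rules e_add_right)

lemma e_anti: "x \<in> L \<Longrightarrow> y \<in> L \<Longrightarrow> e y x = - e x y"
  using e_alt[of "x + y"] e_alt[of x] e_alt[of y]
  by (simp add: L_rules e_add_left e_add_right eq_neg_iff_add_eq_0 add.commute)

lemma e_GG: "x \<in> G \<Longrightarrow> y \<in> G \<Longrightarrow> e x y = 0"
  using G_perp GLD by blast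

lemma p_gt_0: "0 < p" using prime_p prime_gt_0_nat by blast

text \<open>If \<open>x\<close> were not in \<open>pL + G\<close>, a subgroup containing \<open>pL + G\<close> and maximal without \<open>x\<close> would be
  the kernel of a character represented by a \<open>p\<close>-torsion element of \<open>G\<close>.\<close>

lemma divisible:
  assumes x: "x \<in> L"
  shows "\<exists>y\<in>L. nmul p y - x \<in> G"
proof (rule ccontr)
  assume neg: "\<not> ?thesis"
  define H where "H = ssum (nmul p ` L) G"
  have sg_pL: "subgrp (nmul p ` L)"
    by (rule subgrpI) (auto simp: image_iff intro: bexI[of _ 0] L_rules simp flip: nmul_minus)
  have sgH: "subgrp H" unfolding H_def using sg_pL sgG by (rule subgrp_ssum)
  have HL: "H \<subseteq> L" unfolding H_def by (auto elim!: ssumE intro!: L_rules intro: GLD)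
  have xH: "x \<notin> H"
  proof
    assume "x \<in> H"
    then obtain y g where "y \<in> L" "g \<in> G" "x = nmul p y + g" unfolding H_def by (auto elim!: ssumE)
    then have "nmul p y - x \<in> G" using G_rules(3) by simp
    with \<open>y \<in> L\<close> neg show False by blast
  qed
  define \<A> where "\<A> = {M. subgrp M \<and> H \<subseteq> M \<and> M \<subseteq> L \<and> x \<notin> M}"
  have "\<exists>M\<in>\<A>. \<forall>X\<in>\<A>. M \<subseteq> X \<longrightarrow> X = M"
  proof (rule subset_Zorn_nonempty)
    show "\<A> \<noteq> {}" using sgH HL xH by (auto simp: \<A>_def)
    fix C assume C: "C \<noteq> {}" "subset.chain \<A> C"
    then have CA: "C \<subseteq> \<A>" and lin: "\<And>X Y. X \<in> C \<Longrightarrow> Y \<in> C \<Longrightarrow> X \<subseteq> Y \<or> Y \<subseteq> X"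
      by (auto simp: subset_chain_def)
    have "subgrp (\<Union>C)"
    proof (rule subgrpI)
      show "0 \<in> \<Union>C" using C(1) CA subgrp_0 unfolding \<A>_def by blast
      fix a b assume "a \<in> \<Union>C" "b \<in> \<Union>C"
      then obtain X where "X \<in> C" "a \<in> X" "b \<in> X" using lin by blast
      then show "a - b \<in> \<Union>C" using CA subgrp_diff unfolding \<A>_def by blast
    qed
    then show "\<Union>C \<in> \<A>" using C(1) CA by (auto simp: \<A>_def)
  qed
  then obtain M where M: "subgrp M" "H \<subseteq> M" "M \<subseteq> L" "x \<notin> M"
    and max: "\<And>X. X \<in> \<A> \<Longrightarrow> M \<subseteq> X \<Longrightarrow> X = M" by (auto simp: \<A>_def)
  have GM: "g \<in> M" if "g \<in> G" for g
    using M(2) ssum_right[OF sg_pL that] by (auto simp: H_def)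
  have pM: "nmul p y \<in> M" if "y \<in> L" for y
    using M(2) ssum_left[OF sgG, of "nmul p y" "nmul p ` L"] that by (auto simp: H_def)
  \<comment> \<open>\<open>M\<close> contains \<open>pL\<close>, so every nonzero class modulo
    \<open>M\<close> has order exactly \<open>p\<close>.\<close>
  have p_multiple: "p dvd k" if "y \<in> L" "nmul k y \<in> M" "y \<notin> M" for k y
  proof (rule ccontr)
    assume "\<not> p dvd k"
    then obtain a b where "y = nmul a (nmul k y) - nmul b (nmul p y)"
      using nmul_bezout[OF prime_p] by blast
    also have "\<dots> \<in> M" using that pM M(1) by (simp add: subgrp_diff subgrp_nmul)
    finally show False using that by blast
  qed
  \<comment> \<open>Modulo \<open>M\<close> the coefficients \<open>- k\<close> and
    \<open>k * (p - 1)\<close> agree. This makes the set \<open>X\<close> below a subgroup although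
    only natural multiples occur in it.\<close>
  have neg_nmul: "\<exists>m'\<in>M. - nmul k y = m' + nmul (k * (p - 1)) y" if "y \<in> L" for k y
  proof
    have "p = Suc (p - 1)" using p_gt_0 by simp
    then have "nmul k (nmul p y) = nmul (k * (p - 1)) y + nmul k y"
      by (metis mult_Suc_right nmul_mult add.commute nmul_add)
    then show "- nmul k y = - nmul k (nmul p y) + nmul (k * (p - 1)) y" by simp
    show "- nmul k (nmul p y) \<in> M" using M(1) pM that by (simp add: subgrp_uminus subgrp_nmul)
  qed
  \<comment> \<open>Maximality makes \<open>L / M\<close> cyclic with generator \<open>x\<close>:
    enlarging \<open>M\<close> by \<open>y\<close> must capture \<open>x\<close>, with a coefficient
    prime to \<open>p\<close>, and that coefficient can be inverted.\<close>
  have ex: "\<exists>k. y - nmul k x \<in> M" if y: "y \<in> L" for y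
  proof (cases "y \<in> M")
    case True
    then show ?thesis by (intro exI[of _ 0]) simp
  next
    case False
    define X where "X = {m + nmul k y | m k. m \<in> M}"
    have "subgrp X"
    proof (rule subgrpI)
      show "0 \<in> X" using M(1) by (auto simp: X_def subgrp_0 intro!: exI[of _ 0])
      fix a b assume "a \<in> X" "b \<in> X"
      then obtain m k n j where mk: "m \<in> M" "n \<in> M" "a = m + nmul k y" "b = n + nmul j y"
        by (auto simp: X_def)
      obtain m' where "m' \<in> M" "- nmul j y = m' + nmul (j * (p - 1)) y" using neg_nmul y by blast
      moreover have "a - b = (m - n + nmul k y) + (- nmul j y)" using mk by simp
      ultimately have "a - b = (m - n + m') + nmul (k + j * (p - 1)) y"
        by (simp only: nmul_add ac_simps)
      moreover have "m - n + m' \<in> M" using mk \<open>m' \<in> M\<close> M(1) by (simp add: subgrp_diff subgrp_add)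
      ultimately show "a - b \<in> X" by (auto simp: X_def)
    qed
    moreover have "X \<subseteq> L" using M(3) y by (auto simp: X_def intro!: L_rules)
    moreover have XI: "m + nmul k y \<in> X" if "m \<in> M" for m k
      using that by (auto simp: X_def)
    have MX: "M \<subseteq> X" using XI[of _ 0] by auto
    moreover have "y \<in> X" using XI[of 0 1] M(1) by (simp add: subgrp_0)
    ultimately have "x \<in> X" using max[of X] M(2) MX False unfolding \<A>_def by blast
    then obtain m k where mk: "m \<in> M" "x = m + nmul k y" by (auto simp: X_def)
    have "\<not> p dvd k"
    proof
      assume "p dvd k"
      then obtain j where "k = j * p" by (metis dvd_def mult.commute)
      then have "nmul k y \<in> M" using pM[OF y] M(1) by (simp add: nmul_mult subgrp_nmul)
      then show False using mk M(1,4) subgrp_add by blast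
    qed
    then obtain a b where "y = nmul a (nmul k y) - nmul b (nmul p y)"
      using nmul_bezout[OF prime_p] by blast
    then have "y - nmul a x = - nmul a m - nmul b (nmul p y)"
      using mk by (simp add: nmul_plus algebra_simps)
    also have "\<dots> \<in> M" using M(1) mk pM[OF y] by (simp add: subgrp_diff subgrp_uminus subgrp_nmul)
    finally show ?thesis by blast
  qed
  obtain \<omega> :: circ where \<omega>: "nmul p \<omega> = 0" "\<omega> \<noteq> 0"
  proof -
    have "card {w::complex. w ^ p = 1} = p" using p_gt_0 by (rule card_roots_unity_eq)
    moreover have "1 < p" using prime_p prime_gt_1_nat by blast
    ultimately have "\<not> {w::complex. w ^ p = 1} \<subseteq> {1}"
      by (metis card.empty card_1_singleton_iff less_irrefl not_one_less_zero subset_singletonD One_nat_def)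
    then obtain w :: complex where w: "w ^ p = 1" "w \<noteq> 1" by blast
    have "norm w = 1"
      using w p_gt_0 power_eq_1_iff[of w p] by simp
    then have "Rep_circ (Abs_circ w) = w" by (simp add: Abs_circ_inverse)
    then have "nmul p (Abs_circ w) = 0" "Abs_circ w \<noteq> 0"
      using w by (metis Rep_circ_nmul Rep_circ_0 Rep_circ_inject)+
    then show ?thesis by (rule that)
  qed
  \<comment> \<open>This is the character of the group \<open>L / M\<close> of order
    \<open>p\<close> that sends \<open>x\<close> to \<open>\<omega>\<close>. The chosen coefficient
    is determined only modulo \<open>p\<close>, which is enough because \<open>\<omega>\<close> is
    killed by \<open>p\<close>.\<close>
  define \<psi> where "\<psi> y = nmul (SOME k. y - nmul k x \<in> M) \<omega>" for y
  have \<psi>I: "\<psi> y = nmul k \<omega>" if "y \<in> L" "y - nmul k x \<in> M" for y k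
  proof -
    have *: "nmul i \<omega> = nmul j \<omega>" if "y - nmul i x \<in> M" "y - nmul j x \<in> M" "i \<le> j" for i j
    proof -
      have "nmul (j - i) x = nmul j x - nmul i x"
        using nmul_add[of "j - i" i x] that by simp
      also have "\<dots> = (y - nmul i x) - (y - nmul j x)" by simp
      finally have "nmul (j - i) x \<in> M" using that M(1) subgrp_diff by metis
      then have "p dvd j - i" using p_multiple x M(4) by blast
      then obtain d where "j - i = d * p" by (metis dvd_def mult.commute)
      then have "nmul (j - i) \<omega> = 0" using \<omega> by (simp add: nmul_mult)
      then show ?thesis using nmul_add[of "j - i" i \<omega>] that by simp
    qed
    have "y - nmul (SOME k. y - nmul k x \<in> M) x \<in> M" using that by (rule_tac someI)
    then show ?thesis unfolding \<psi>_def using * that by (metis nat_le_linear)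
  qed
  have "\<psi> (a + b) = \<psi> a + \<psi> b" if ab: "a \<in> L" "b \<in> L" for a b
  proof -
    obtain i j where ij: "a - nmul i x \<in> M" "b - nmul j x \<in> M" using ex ab by blast
    have "(a + b) - nmul (i + j) x = (a - nmul i x) + (b - nmul j x)"
      by (simp add: nmul_add)
    also have "\<dots> \<in> M" using ij M(1) by (simp add: subgrp_add)
    finally have "\<psi> (a + b) = nmul (i + j) \<omega>" using ab L_rules by (intro \<psi>I)
    then show ?thesis using ij ab by (simp add: \<psi>I nmul_add)
  qed
  moreover have \<psi>M: "\<psi> y = 0" if "y \<in> M" for y
    using \<psi>I[of y 0] that M(3) by auto
  ultimately obtain z where z: "z \<in> L" "\<And>y. y \<in> L \<Longrightarrow> e z y = \<psi> y"
    using characters_represented[of \<psi>] GM by blast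
  \<comment> \<open>As \<open>\<psi>\<close> kills \<open>G\<close>, \<open>z\<close> is orthogonal
    to \<open>G\<close>; as it kills \<open>pL\<close>, the multiple \<open>nmul p z\<close> is
    orthogonal to \<open>L\<close>. So \<open>z\<close> is \<open>p\<close>-torsion in
    \<open>G\<close>, hence zero, against \<open>\<psi> x = \<omega>\<close>.\<close>
  have zG: "z \<in> G" using G_perp z GM \<psi>M GLD by simp
  have "e (nmul p z) y = 0" if "y \<in> L" for y
  proof -
    have "e (nmul p z) y = e z (nmul p y)" using z that by (simp only: e_nmul_left e_nmul_right)
    also have "\<dots> = 0" using z(2) L_rules(5)[OF that] \<psi>M pM that by simp
    finally show ?thesis .
  qed
  then have "nmul p z = 0" using e_nondeg L_rules(5)[OF z(1)] by blast
  then have "z = 0" using torsion_free zG by blast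
  then have "\<psi> x = 0" using z x by (metis e_0_left)
  moreover have "\<psi> x = \<omega>" using \<psi>I[of x 1] x M(1) by (simp add: subgrp_0)
  ultimately show False using \<omega> by simp
qed

text \<open>Reducing the entries modulo \<open>G\<close> identifies this group with the Tate module
  of \<open>L / G\<close>: a compatible sequence of classes lifts by
  \<open>correct_sequence\<close>, and uniquely, because a sequence with all entries in
  \<open>G\<close> is infinitely divisible there.\<close>

definition tate :: "(nat \<Rightarrow> 'g) set" where
  "tate = {x. (\<forall>n. x n \<in> L) \<and> (\<forall>n. nmul p (x (Suc n)) = x n) \<and> x 0 \<in> G}"

lemma tate_L: "x \<in> tate \<Longrightarrow> x n \<in> L"
  and tate_Suc: "x \<in> tate \<Longrightarrow> nmul p (x (Suc n)) = x n"
  and tate_0: "x \<in> tate \<Longrightarrow> x 0 \<in> G"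
  by (auto simp: tate_def)

lemma tate_shift: "x \<in> tate \<Longrightarrow> nmul (p ^ i) (x (i + j)) = x j"
proof (induction i)
  case (Suc i)
  have "nmul (p ^ Suc i) (x (Suc i + j)) = nmul (p ^ i) (nmul p (x (Suc (i + j))))"
    using nmul_power_Suc by (metis add_Suc)
  then show ?case using Suc by (simp add: tate_Suc)
qed simp

lemma tate_power_G: "x \<in> tate \<Longrightarrow> nmul (p ^ n) (x n) \<in> G"
  using tate_shift[of x n 0] by (simp add: tate_0)

lemma sg_tate: "subgrp tate"
proof (rule subgrpI)
  show "0 \<in> tate" by (simp add: tate_def L_rules G_rules)
  show "x - y \<in> tate" if "x \<in> tate" "y \<in> tate" for x y
    using that by (simp add: tate_def L_rules G_rules nmul_minus)
qed

lemmas tate_rules = subgrp_rules[OF sg_tate]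

text \<open>Dropping the first \<open>n\<close> entries inverts multiplication by
  \<open>p ^ n\<close>; the hypothesis on \<open>x n\<close> keeps the new initial entry in
  \<open>G\<close>.\<close>

lemma tate_divide:
  assumes "x \<in> tate" "x n \<in> G"
  shows "\<exists>y\<in>tate. x = nmul (p ^ n) y"
proof
  show "(\<lambda>k. x (n + k)) \<in> tate" using assms by (auto simp: tate_def)
  show "x = nmul (p ^ n) (\<lambda>k. x (n + k))" using tate_shift[OF assms(1)] by (auto simp: nmul_fun)
qed

lemma tate_nmul_at: "y \<in> tate \<Longrightarrow> nmul (p ^ n) y (n + k) = y k"
  using tate_shift[of y n k] by (simp add: nmul_fun)

lemma tate_nmul_G: "y \<in> tate \<Longrightarrow> nmul (p ^ n) y n \<in> G"
  using tate_nmul_at[of y n 0] tate_0 by simp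

lemma tate_separated:
  assumes "x \<in> tate" "\<And>n. \<exists>y\<in>tate. x = nmul (p ^ n) y"
  shows "x = 0"
proof
  fix m
  have "\<exists>h\<in>G. x m = nmul (p ^ n) h" for n
  proof -
    \<comment> \<open>The extra exponent \<open>m\<close> is spent on moving the entry
      \<open>y m\<close> into \<open>G\<close>; \<open>p ^ n\<close> remains as the divisor.\<close>
    obtain y where y: "y \<in> tate" "x = nmul (p ^ (m + n)) y" using assms(2) by blast
    have "x m = nmul (p ^ n) (nmul (p ^ m) (y m))"
      using y by (simp add: nmul_fun nmul_power_add nmul_commute)
    then show ?thesis using tate_power_G[OF y(1)] by blast
  qed
  then show "x m = 0 m" using separated by simp
qed

text \<open>The defects \<open>nmul p (y (Suc n)) - y n\<close> lie in \<open>G\<close>. The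
  correction at index \<open>m\<close> is the p-adic sum of the defects from \<open>m\<close> on, so
  consecutive corrections differ by exactly the defect.\<close>

lemma correct_sequence:
  assumes "\<And>n. y n \<in> L" "\<And>n. nmul p (y (Suc n)) - y n \<in> G" "y 0 \<in> G"
  shows "\<exists>u\<in>tate. \<forall>n. u n - y n \<in> G"
proof -
  obtain S where S: "\<And>h. (\<forall>n. h n \<in> G) \<Longrightarrow> S h \<in> G \<and> S h = h 0 + nmul p (S (\<lambda>n. h (Suc n)))"
    using power_series by blast
  define c where "c m = S (\<lambda>n. nmul p (y (Suc (m + n))) - y (m + n))" for m :: nat
  have c: "c m \<in> G" "c m = (nmul p (y (Suc m)) - y m) + nmul p (c (Suc m))" for m
    using S[of "\<lambda>n. nmul p (y (Suc (m + n))) - y (m + n)"] assms(2) by (auto simp: c_def)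
  have "(\<lambda>m. y m + c m) \<in> tate"
    unfolding tate_def
  proof (intro CollectI conjI allI)
    show "y n + c n \<in> L" for n using assms(1) c(1) GLD L_rules(4) by blast
    show "y 0 + c 0 \<in> G" using assms(3) c(1) G_rules(4) by blast
    show "nmul p (y (Suc n) + c (Suc n)) = y n + c n" for n
      using c(2)[of n] by (simp add: nmul_plus)
  qed
  then show ?thesis using c(1) by (intro bexI[of _ "\<lambda>m. y m + c m"]) auto
qed

lemma tate_lift:
  assumes "x \<in> L"
  shows "\<exists>u\<in>tate. \<exists>n. u n - x \<in> G"
proof -
  obtain d where d: "\<And>x. x \<in> L \<Longrightarrow> d x \<in> L \<and> nmul p (d x) - x \<in> G"
    using divisible by metis
  obtain n where n: "nmul (p ^ n) x \<in> G" using torsion assms by blast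
  define z where "z k = (d ^^ k) x" for k
  have zL: "z k \<in> L" for k by (induction k) (auto simp: z_def d assms)
  have zG: "nmul p (z (Suc k)) - z k \<in> G" for k using d[OF zL[of k]] by (simp add: z_def)
  \<comment> \<open>Entry \<open>n\<close> is \<open>x\<close>; before it stand the multiples of
    \<open>x\<close>, down to \<open>nmul (p ^ n) x\<close> in \<open>G\<close> at index 0, and
    after it successive quotients of \<open>x\<close> by \<open>p\<close> modulo
    \<open>G\<close>.\<close>
  define y where "y k = nmul (p ^ (n - k)) (z (k - n))" for k
  have "\<exists>u\<in>tate. \<forall>k. u k - y k \<in> G"
  proof (rule correct_sequence)
    show "y k \<in> L" for k by (simp add: y_def L_rules zL)
    show "y 0 \<in> G" using n by (simp add: y_def z_def)
    show "nmul p (y (Suc k)) - y k \<in> G" for k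
    proof (cases "k < n")
      case True
      then have "p ^ (n - k) = p * p ^ (n - Suc k)" by (metis Suc_diff_Suc power_Suc)
      then show ?thesis using True by (simp add: y_def nmul_mult G_rules)
    next
      case False
      then show ?thesis using zG[of "k - n"] by (simp add: y_def Suc_diff_le)
    qed
  qed
  then obtain u where "u \<in> tate" "u n - y n \<in> G" by blast
  moreover have "y n = x" by (simp add: y_def z_def)
  ultimately show ?thesis by blast
qed

section \<open>The alternating form on the Tate module\<close>

definition form :: "(nat \<Rightarrow> 'g) \<Rightarrow> (nat \<Rightarrow> 'g) \<Rightarrow> nat \<Rightarrow> circ" where
  "form x y k = e (x k) (y 0)"

text \<open>Powers of \<open>p\<close> move across the pairing, so only the sum of the indices
  matters. Hence two sequences with vanishing form have pairwise orthogonal entries.\<close>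

lemma e_eq_form:
  assumes "x \<in> tate" "y \<in> tate"
  shows "e (x i) (y j) = form x y (i + j)"
proof -
  have "e (x i) (y j) = e (nmul (p ^ j) (x (j + i))) (y j)" using assms by (simp add: tate_shift)
  also have "\<dots> = e (x (j + i)) (nmul (p ^ j) (y (j + 0)))"
    using assms by (simp add: e_nmul_left e_nmul_right tate_L)
  also have "\<dots> = form x y (i + j)" using tate_shift[OF assms(2), of j 0] by (simp add: form_def add.commute)
  finally show ?thesis .
qed

lemma form_add_left: "\<lbrakk>x \<in> tate; y \<in> tate; z \<in> tate\<rbrakk> \<Longrightarrow> form (x + y) z = form x z + form y z"
  and form_diff_left: "\<lbrakk>x \<in> tate; y \<in> tate; z \<in> tate\<rbrakk> \<Longrightarrow> form (x - y) z = form x z - form y z"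
  and form_add_right: "\<lbrakk>x \<in> tate; y \<in> tate; z \<in> tate\<rbrakk> \<Longrightarrow> form z (x + y) = form z x + form z y"
  and form_nmul_left: "\<lbrakk>x \<in> tate; z \<in> tate\<rbrakk> \<Longrightarrow> form (nmul k x) z = nmul k (form x z)"
  by (auto simp: fun_eq_iff form_def tate_L e_add_left e_add_right e_diff_left e_diff_right
      e_nmul_left e_nmul_right nmul_fun)

lemma form_0: "x \<in> tate \<Longrightarrow> form 0 x = 0" "x \<in> tate \<Longrightarrow> form x 0 = 0"
  by (auto simp: form_def fun_eq_iff tate_L)

lemma form_anti: "x \<in> tate \<Longrightarrow> y \<in> tate \<Longrightarrow> form y x = - form x y"
  using e_eq_form[of x y 0] e_anti[of "x 0"] by (simp add: fun_eq_iff form_def tate_L)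

lemma form_alt: "x \<in> tate \<Longrightarrow> form x x = 0"
proof
  fix n assume x: "x \<in> tate"
  have "form x x n = e (x n) (nmul (p ^ n) (x n))"
    using tate_shift[OF x, of n 0] by (simp add: form_def)
  then show "form x x n = 0 n" using x by (simp add: e_nmul_right tate_L e_alt)
qed

text \<open>With \<open>form_at_0\<close> this makes the values a compatible system of
  \<open>p\<close>-power torsion. If \<open>v\<close> is the first index with a nonzero value, the
  value at \<open>v + j\<close> has order exactly \<open>p ^ (j + 1)\<close>; the later divisions
  rest on this.\<close>

lemma form_shift: "x \<in> tate \<Longrightarrow> y \<in> tate \<Longrightarrow> nmul (p ^ i) (form x y (i + j)) = form x y j"
  using tate_shift[of x i j] by (simp add: form_def tate_L flip: e_nmul_left)

lemma form_at_0: "x \<in> tate \<Longrightarrow> y \<in> tate \<Longrightarrow> form x y 0 = 0"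
  by (simp add: form_def e_GG tate_0)

lemma form_nmul_power: "x \<in> tate \<Longrightarrow> y \<in> tate \<Longrightarrow> n \<le> m \<Longrightarrow> nmul (p ^ m) (form x y n) = 0"
  using form_shift[of x y n 0] form_at_0[of x y] nmul_power_zero_mono by force

end

section \<open>Lagrangian splittings\<close>

context self_perp_pairing
begin

text \<open>The closure of the cyclic subgroup generated by \<open>x\<close>, that is, its span over the \<open>p\<close>-adic integers.\<close>

definition cspan :: "(nat \<Rightarrow> 'g) \<Rightarrow> (nat \<Rightarrow> 'g) set" where
  "cspan x = {u \<in> tate. \<forall>n. \<exists>k. \<exists>t\<in>tate. u = nmul k x + nmul (p ^ n) t}"

lemma cspan_T: "u \<in> cspan x \<Longrightarrow> u \<in> tate"
  by (simp add: cspan_def)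

lemma cspan_self: "x \<in> tate \<Longrightarrow> x \<in> cspan x"
  unfolding cspan_def
  by (auto intro!: exI[of _ 1] bexI[of _ 0] simp: tate_rules simp del: One_nat_def)

lemma sg_cspan:
  assumes "x \<in> tate" shows "subgrp (cspan x)"
proof (rule subgrpI)
  show "0 \<in> cspan x"
    unfolding cspan_def by (auto intro!: exI[of _ 0] bexI[of _ 0] simp: tate_rules)
  fix u w assume uw: "u \<in> cspan x" "w \<in> cspan x"
  have "\<exists>k. \<exists>t\<in>tate. u - w = nmul k x + nmul (p ^ n) t" for n
  proof -
    obtain i s j t where st: "s \<in> tate" "t \<in> tate"
      "u = nmul i x + nmul (p ^ n) s" "w = nmul j x + nmul (p ^ n) t"
      using uw unfolding cspan_def by blast
    \<comment> \<open>The coefficient \<open>- j\<close> is replaced by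
      \<open>j * (p ^ n - 1)\<close>, which is congruent to it modulo \<open>p ^ n\<close>; the
      difference is absorbed in the remainder term.\<close>
    have "p ^ n = Suc (p ^ n - 1)" using p_gt_0 by simp
    then have "nmul j (nmul (p ^ n) x) = nmul (j * (p ^ n - 1)) x + nmul j x"
      by (metis mult_Suc_right nmul_mult add.commute nmul_add)
    then have "u - w = nmul (i + j * (p ^ n - 1)) x + nmul (p ^ n) (s - t - nmul j x)"
      using st by (simp only: nmul_add nmul_minus nmul_commute[of "p ^ n" j]) simp
    moreover have "s - t - nmul j x \<in> tate" using st assms by (simp add: tate_rules)
    ultimately show ?thesis by blast
  qed
  then show "u - w \<in> cspan x" using uw by (auto simp: cspan_def tate_rules)
qed

text \<open>At index \<open>n\<close> the pairing only sees the integer approximation modulo \<open>p ^ n\<close>.\<close>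

lemma form_cspan_approx:
  assumes "u = nmul k x + nmul (p ^ n) t" "x \<in> tate" "t \<in> tate" "w \<in> tate" "m \<le> n"
  shows "form u w m = nmul k (form x w m)"
  using assms by (simp add: form_add_left form_nmul_left tate_rules nmul_apply form_nmul_power)

lemma cspan_orth_left:
  assumes "u \<in> cspan x" "x \<in> tate" "w \<in> tate" "form x w = 0"
  shows "form u w = 0"
proof
  fix n
  obtain k t where "t \<in> tate" "u = nmul k x + nmul (p ^ n) t"
    using assms(1) unfolding cspan_def by blast
  then show "form u w n = 0 n" using form_cspan_approx[of u k x n t w n] assms by simp
qed

lemma form_eq_0_sym: "x \<in> tate \<Longrightarrow> y \<in> tate \<Longrightarrow> form x y = 0 \<Longrightarrow> form y x = 0"
  using form_anti[of x y] by simp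

lemma cspan_orth_right:
  assumes "u \<in> cspan x" "x \<in> tate" "w \<in> tate" "form w x = 0"
  shows "form w u = 0"
  using assms cspan_orth_left[of u x w] form_eq_0_sym cspan_T by metis

lemma cspan_isotropic: "u \<in> cspan x \<Longrightarrow> w \<in> cspan x \<Longrightarrow> x \<in> tate \<Longrightarrow> form u w = 0"
  using cspan_orth_left[of u x w] cspan_orth_right[of w x x] form_alt cspan_T by metis

text \<open>The value of \<open>form x y\<close> at \<open>v + j\<close> has exact order
  \<open>p ^ Suc j\<close>. If \<open>u\<close> pairs to zero with \<open>y\<close>, the integer
  that approximates its coefficient modulo \<open>p ^ (v + j)\<close> is therefore divisible by
  \<open>p ^ j\<close>, and so is \<open>u\<close>, for every \<open>j\<close>.\<close>

lemma cspan_eq_0: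
  assumes x: "x \<in> tate" and y: "y \<in> tate" and u: "u \<in> cspan x"
    and v: "form x y v \<noteq> 0" "\<And>k. k < v \<Longrightarrow> form x y k = 0"
    and z: "form u y = 0"
  shows "u = 0"
proof (rule tate_separated)
  show uT: "u \<in> tate" using u by (rule cspan_T)
  fix j
  obtain k t where kt: "t \<in> tate" "u = nmul k x + nmul (p ^ (v + j)) t"
    using u unfolding cspan_def by blast
  have "v \<noteq> 0" using v(1) form_at_0 x y by metis
  then obtain v' where v': "v = Suc v'" using not0_implies_Suc by blast
  let ?z = "form x y (v + j)"
  have "nmul k ?z = 0" using form_cspan_approx[OF kt(2) x kt(1) y, of "v + j"] z by simp
  moreover have "nmul (p ^ j) ?z \<noteq> 0"
    using form_shift[OF x y, of j v] v(1) by (simp add: add.commute)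
  moreover have "nmul (p ^ Suc j) ?z = 0"
    using form_shift[OF x y, of "Suc j" v'] v(2)[of v'] v' by (simp add: add.commute)
  ultimately have "p ^ Suc j dvd k" using order_dvd[OF prime_p] by blast
  then obtain d where d: "k = p ^ j * d" by (metis dvd_mult_left dvdE power_Suc2)
  have "u = nmul (p ^ j) (nmul d x + nmul (p ^ v) t)"
    using kt(2) d by (simp add: nmul_plus nmul_mult nmul_power_add[of p j v] add.commute[of v j])
  moreover have "nmul d x + nmul (p ^ v) t \<in> tate" using x kt by (simp add: tate_rules)
  ultimately show "\<exists>y\<in>tate. u = nmul (p ^ j) y" by blast
qed

text \<open>Division with remainder by a pair of minimal valuation \<open>v - 1\<close>: at each index the values of
  \<open>form\<close> lie in a cyclic group generated by the value on the minimal pair.\<close>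

lemma cspan_solve:
  assumes x: "x \<in> tate" and y: "y \<in> tate" and t: "t \<in> tate"
    and v: "form x y v \<noteq> 0" "\<And>k. k < v \<Longrightarrow> form x y k = 0" "\<And>k. k < v \<Longrightarrow> form t y k = 0"
  shows "\<exists>u\<in>cspan x. form u y = form t y"
proof -
  have "v \<noteq> 0" using v(1) form_at_0 x y by metis
  then obtain v' where v': "v = Suc v'" using not0_implies_Suc by blast
  let ?z = "\<lambda>n. form x y (v + n)"
  \<comment> \<open>The value \<open>?z n\<close> has exact order \<open>p ^ Suc n\<close>, and the
    corresponding value for \<open>t\<close> is killed by that number, so it is a multiple of
    \<open>?z n\<close>.\<close>
  have z: "nmul (p ^ Suc n) (?z n) = 0" "nmul (p ^ n) (?z n) \<noteq> 0" for n
    using form_shift[OF x y, of n v] form_shift[OF x y, of "Suc n" v'] v(1) v(2)[of v'] v'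
    by (simp_all add: add.commute)
  have "nmul (p ^ Suc n) (form t y (v + n)) = 0" for n
    using form_shift[OF t y, of "Suc n" v'] v(3)[of v'] v' by (simp add: add.commute)
  then have "\<forall>n. \<exists>k. form t y (v + n) = nmul k (?z n)"
    using circ_cyclic[OF prime_p z] by blast
  then obtain k where k: "\<And>n. form t y (v + n) = nmul (k n) (?z n)" by metis
  \<comment> \<open>The coefficients \<open>k n\<close> are compatible only modulo
    \<open>p ^ Suc n\<close>. This suffices because \<open>p ^ n\<close> already carries
    \<open>x n\<close> into \<open>G\<close>, where \<open>correct_sequence\<close> tolerates
    errors.\<close>
  have step: "nmul (k (Suc n)) (x n) - nmul (k n) (x n) \<in> G" for n
  proof -
    have "nmul (k (Suc n)) (?z n) = nmul (k (Suc n)) (nmul p (?z (Suc n)))"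
      using form_shift[OF x y, of 1 "v + n"] by simp
    also have "\<dots> = nmul p (form t y (v + Suc n))" using k by (simp only: nmul_commute)
    also have "\<dots> = nmul (k n) (?z n)" using form_shift[OF t y, of 1 "v + n"] k by simp
    finally have eq: "nmul (k (Suc n)) (?z n) = nmul (k n) (?z n)" .
    have G: "nmul j (x n) - nmul i (x n) \<in> G \<and> nmul i (x n) - nmul j (x n) \<in> G"
      if ji: "nmul j (?z n) = nmul i (?z n)" "i \<le> j" for i j
    proof -
      obtain d where "j - i = p ^ Suc n * d"
        using order_cong[OF prime_p z ji] by (metis dvdE)
      then have "nmul (j - i) (x n) = nmul (d * p) (nmul (p ^ n) (x n))"
        by (metis mult.commute mult.left_commute nmul_mult power_Suc)
      then have "nmul (j - i) (x n) \<in> G" using tate_power_G[OF x] G_rules(5) by simp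
      moreover have "nmul j (x n) = nmul (j - i) (x n) + nmul i (x n)"
        using ji(2) by (metis le_add_diff_inverse2 nmul_add)
      ultimately show ?thesis using G_rules(3) by fastforce
    qed
    then show ?thesis using eq by (metis nat_le_linear)
  qed
  have "\<exists>u\<in>tate. \<forall>n. u n - nmul (k n) (x n) \<in> G"
  proof (rule correct_sequence)
    show "nmul (k n) (x n) \<in> L" for n using x by (simp add: tate_L L_rules)
    show "nmul (k 0) (x 0) \<in> G" using x by (simp add: tate_0 G_rules)
    show "nmul p (nmul (k (Suc n)) (x (Suc n))) - nmul (k n) (x n) \<in> G" for n
      using step[of n] tate_Suc[OF x, of n] nmul_commute[of p "k (Suc n)" "x (Suc n)"] by simp
  qed
  then obtain u where u: "u \<in> tate" "\<And>n. u n - nmul (k n) (x n) \<in> G" by blast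
  have approx: "\<exists>t\<in>tate. u = nmul (k n) x + nmul (p ^ n) t" for n
  proof -
    have "u - nmul (k n) x \<in> tate" using u x by (simp add: tate_rules)
    moreover have "(u - nmul (k n) x) n \<in> G" using u by (simp add: nmul_apply)
    ultimately obtain s where "s \<in> tate" "u - nmul (k n) x = nmul (p ^ n) s"
      using tate_divide by blast
    then show ?thesis by (metis add.commute diff_add_cancel)
  qed
  \<comment> \<open>The quotients were chosen at index \<open>v + n\<close>; multiplication by
    \<open>p ^ v\<close> brings the equality down to index \<open>n\<close>.\<close>
  have "form u y n = form t y n" for n
  proof -
    obtain s where "s \<in> tate" "u = nmul (k n) x + nmul (p ^ n) s" using approx by blast
    then have "form u y n = nmul (k n) (form x y n)" using form_cspan_approx x y by blast
    also have "\<dots> = nmul (k n) (nmul (p ^ v) (?z n))" using form_shift[OF x y, of v n] by simp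
    also have "\<dots> = nmul (p ^ v) (form t y (v + n))" using k by (simp only: nmul_commute)
    also have "\<dots> = form t y n" using form_shift[OF t y, of v n] by simp
    finally show ?thesis .
  qed
  moreover have "u \<in> cspan x" using u approx unfolding cspan_def by blast
  ultimately show ?thesis by blast
qed

definition orth :: "(nat \<Rightarrow> 'g) set \<Rightarrow> (nat \<Rightarrow> 'g) set" where
  "orth U = {t \<in> tate. \<forall>u\<in>U. form t u = 0}"

lemma sg_orth: "U \<subseteq> tate \<Longrightarrow> subgrp (orth U)"
  by (rule subgrpI) (auto simp: orth_def tate_rules form_0 form_diff_left subset_iff)

text \<open>The invariant of the splitting procedure: two isotropic subgroups in duality without
  kernel, whose sum has an orthogonal complement in \<open>tate\<close>. The next pair is sought in
  that complement.\<close>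

definition split_pair :: "(nat \<Rightarrow> 'g) set \<Rightarrow> (nat \<Rightarrow> 'g) set \<Rightarrow> bool" where
  "split_pair U V \<longleftrightarrow> subgrp U \<and> subgrp V \<and> U \<subseteq> tate \<and> V \<subseteq> tate \<and>
     (\<forall>x\<in>U. \<forall>y\<in>U. form x y = 0) \<and> (\<forall>x\<in>V. \<forall>y\<in>V. form x y = 0) \<and>
     (\<forall>x\<in>U. (\<forall>y\<in>V. form x y = 0) \<longrightarrow> x = 0) \<and> (\<forall>x\<in>V. (\<forall>y\<in>U. form x y = 0) \<longrightarrow> x = 0) \<and>
     (\<forall>t\<in>tate. \<exists>x\<in>U. \<exists>y\<in>V. t - x - y \<in> orth U \<inter> orth V)"

lemma split_pairD:
  assumes "split_pair U V"
  shows "subgrp U" "subgrp V" "U \<subseteq> tate" "V \<subseteq> tate"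
    "\<And>x y. x \<in> U \<Longrightarrow> y \<in> U \<Longrightarrow> form x y = 0"
    "\<And>x y. x \<in> V \<Longrightarrow> y \<in> V \<Longrightarrow> form x y = 0"
    "\<And>x. x \<in> U \<Longrightarrow> (\<And>y. y \<in> V \<Longrightarrow> form x y = 0) \<Longrightarrow> x = 0"
    "\<And>x. x \<in> V \<Longrightarrow> (\<And>y. y \<in> U \<Longrightarrow> form x y = 0) \<Longrightarrow> x = 0"
    "\<And>t. t \<in> tate \<Longrightarrow> \<exists>x\<in>U. \<exists>y\<in>V. t - x - y \<in> orth U \<inter> orth V"
proof -
  note c = assms[unfolded split_pair_def]
  show "subgrp U" "subgrp V" "U \<subseteq> tate" "V \<subseteq> tate" by (simp_all only: c)
  have c5: "\<forall>x\<in>U. \<forall>y\<in>U. form x y = 0" using c by (elim conjE)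
  have c6: "\<forall>x\<in>V. \<forall>y\<in>V. form x y = 0" using c by (elim conjE)
  have c7: "\<forall>x\<in>U. (\<forall>y\<in>V. form x y = 0) \<longrightarrow> x = 0" using c by (elim conjE)
  have c8: "\<forall>x\<in>V. (\<forall>y\<in>U. form x y = 0) \<longrightarrow> x = 0" using c by (elim conjE)
  have c9: "\<forall>t\<in>tate. \<exists>x\<in>U. \<exists>y\<in>V. t - x - y \<in> orth U \<inter> orth V" using c by (elim conjE)
  show "\<And>x y. x \<in> U \<Longrightarrow> y \<in> U \<Longrightarrow> form x y = 0" using c5 by blast
  show "\<And>x y. x \<in> V \<Longrightarrow> y \<in> V \<Longrightarrow> form x y = 0" using c6 by blast
  show "\<And>x. x \<in> U \<Longrightarrow> (\<And>y. y \<in> V \<Longrightarrow> form x y = 0) \<Longrightarrow> x = 0" using c7 by blast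
  show "\<And>x. x \<in> V \<Longrightarrow> (\<And>y. y \<in> U \<Longrightarrow> form x y = 0) \<Longrightarrow> x = 0" using c8 by blast
  show "\<And>t. t \<in> tate \<Longrightarrow> \<exists>x\<in>U. \<exists>y\<in>V. t - x - y \<in> orth U \<inter> orth V" using c9 by blast
qed

lemma split_pair_0: "split_pair {0} {0}"
  by (auto simp: split_pair_def subgrp_def tate_rules form_0 orth_def)

text \<open>A Gram-Schmidt step. Minimality of \<open>v\<close> on the complement makes every value
  \<open>form w x\<close> or \<open>form w y\<close> divisible by \<open>form x y\<close>, so the
  components along the new pair exist over the p-adic integers.\<close>

lemma split_pair_extend:
  assumes P: "split_pair U V"
    and x: "x \<in> orth U" "x \<in> orth V" and y: "y \<in> orth U" "y \<in> orth V" and nz: "form x y v \<noteq> 0"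
    and min: "\<And>s t k. s \<in> orth U \<inter> orth V \<Longrightarrow> t \<in> orth U \<inter> orth V \<Longrightarrow> k < v \<Longrightarrow> form s t k = 0"
  shows "split_pair (ssum U (cspan x)) (ssum V (cspan y))"
proof -
  note D = split_pairD[OF P]
  have xT: "x \<in> tate" and yT: "y \<in> tate" using x y by (auto simp: orth_def)
  have ox: "form w u = 0" "form u w = 0" if "w \<in> cspan x" "u \<in> U \<union> V" for u w
    using cspan_orth_left[of w x u] form_eq_0_sym[of w u] cspan_T[of w x] that x D(3,4)
    by (auto simp: orth_def)
  have oy: "form w u = 0" "form u w = 0" if "w \<in> cspan y" "u \<in> U \<union> V" for u w
    using cspan_orth_left[of w y u] form_eq_0_sym[of w u] cspan_T[of w y] that y D(3,4)
    by (auto simp: orth_def)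
  note sT = cspan_T subsetD[OF D(3)] subsetD[OF D(4)]
  have symnz: "form y x v \<noteq> 0" using nz form_anti[OF xT yT] by simp
  have ndx: "s = 0" if "s \<in> cspan x" "form s y = 0" for s
    using cspan_eq_0[OF xT yT that(1) nz _ that(2)] min x y by blast
  have ndy: "s = 0" if "s \<in> cspan y" "form s x = 0" for s
    using cspan_eq_0[OF yT xT that(1) symnz _ that(2)] min x y by blast
  show ?thesis unfolding split_pair_def
  proof (intro conjI ballI impI)
    show "subgrp (ssum U (cspan x))" "subgrp (ssum V (cspan y))"
      using D sg_cspan xT yT by (auto intro: subgrp_ssum)
    show "ssum U (cspan x) \<subseteq> tate" "ssum V (cspan y) \<subseteq> tate"
      using sT by (auto elim!: ssumE simp: tate_rules)
  next
    fix s t assume "s \<in> ssum U (cspan x)" "t \<in> ssum U (cspan x)"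
    then show "form s t = 0" using D(5) ox cspan_isotropic[OF _ _ xT] sT
      by (auto elim!: ssumE simp: form_add_left form_add_right tate_rules)
  next
    fix s t assume "s \<in> ssum V (cspan y)" "t \<in> ssum V (cspan y)"
    then show "form s t = 0" using D(6) oy cspan_isotropic[OF _ _ yT] sT
      by (auto elim!: ssumE simp: form_add_left form_add_right tate_rules)
  next
    fix s assume s: "s \<in> ssum U (cspan x)" and 0: "\<forall>t\<in>ssum V (cspan y). form s t = 0"
    obtain u a where ua: "u \<in> U" "a \<in> cspan x" "s = u + a" using s by (rule ssumE)
    have "form u t = 0" if "t \<in> V" for t
    proof -
      have "form s t = 0" using 0 ssum_left[OF sg_cspan[OF yT] that] by blast
      then show ?thesis using ua that sT ox by (simp add: form_add_left)
    qed
    then have "u = 0" using D(7) ua by blast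
    moreover have "form s y = 0" using 0 ssum_right[OF D(2) cspan_self[OF yT]] by blast
    ultimately show "s = 0" using ua ndx by simp
  next
    fix s assume s: "s \<in> ssum V (cspan y)" and 0: "\<forall>t\<in>ssum U (cspan x). form s t = 0"
    obtain u a where ua: "u \<in> V" "a \<in> cspan y" "s = u + a" using s by (rule ssumE)
    have "form u t = 0" if "t \<in> U" for t
    proof -
      have "form s t = 0" using 0 ssum_left[OF sg_cspan[OF xT] that] by blast
      then show ?thesis using ua that sT oy by (simp add: form_add_left)
    qed
    then have "u = 0" using D(8) ua by blast
    moreover have "form s x = 0" using 0 ssum_right[OF D(1) cspan_self[OF xT]] by blast
    ultimately show "s = 0" using ua ndy by simp
  next
    fix t assume "t \<in> tate"
    then obtain u u' where u: "u \<in> U" "u' \<in> V" "t - u - u' \<in> orth U \<inter> orth V" using D(9) by blast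
    define w where "w = t - u - u'"
    have w: "w \<in> orth U \<inter> orth V" "w \<in> tate" using u by (auto simp: w_def orth_def)
    \<comment> \<open>The component \<open>a\<close> corrects the pairing with \<open>y\<close>, and
      \<open>c\<close> the pairing with \<open>x\<close>. They do not interfere, because
      \<open>cspan x\<close> and \<open>cspan y\<close> are isotropic.\<close>
    obtain a where a: "a \<in> cspan x" "form a y = form w y"
      using cspan_solve[OF xT yT w(2) nz] min x y w(1) by blast
    obtain c where c: "c \<in> cspan y" "form c x = form w x"
      using cspan_solve[OF yT xT w(2) symnz] min x y w(1) by blast
    define r where "r = w - a - c"
    have rT: "r \<in> tate" using w a c by (simp add: r_def tate_rules cspan_T)
    have "form r s = 0" if "s \<in> U \<union> V" for s
      using ox[OF a(1) that] oy[OF c(1) that] w that sT a c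
      by (auto simp: r_def form_diff_left tate_rules orth_def)
    moreover have "form r x = 0"
      using cspan_isotropic[OF a(1) cspan_self[OF xT] xT] c w xT a
      by (simp add: r_def form_diff_left tate_rules cspan_T)
    then have "form r s = 0" if "s \<in> cspan x" for s using cspan_orth_right[OF that xT rT] by blast
    moreover have "form r y = 0"
      using cspan_isotropic[OF c(1) cspan_self[OF yT] yT] a w yT c
      by (simp add: r_def form_diff_left tate_rules cspan_T)
    then have "form r s = 0" if "s \<in> cspan y" for s using cspan_orth_right[OF that yT rT] by blast
    ultimately have "r \<in> orth (ssum U (cspan x)) \<inter> orth (ssum V (cspan y))"
      using rT sT by (auto simp: orth_def form_add_right elim!: ssumE)
    moreover have "t - (u + a) - (u' + c) = r" by (simp add: r_def w_def)
    ultimately show "\<exists>s\<in>ssum U (cspan x). \<exists>s'\<in>ssum V (cspan y).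
        t - s - s' \<in> orth (ssum U (cspan x)) \<inter> orth (ssum V (cspan y))"
      using ssumI[OF u(1) a(1)] ssumI[OF u(2) c(1)] by metis
  qed
qed

lemma exists_split_pair:
  obtains U V where "split_pair U V"
    "\<And>s t. s \<in> orth U \<inter> orth V \<Longrightarrow> t \<in> orth U \<inter> orth V \<Longrightarrow> form s t = 0"
proof -
  obtain F where F: "finite F" "F \<subseteq> G"
    "\<And>x. x \<in> L \<Longrightarrow> nmul p x \<in> G \<Longrightarrow> (\<And>f. f \<in> F \<Longrightarrow> e x f = 0) \<Longrightarrow> x \<in> G"
    using finite_test by metis
  \<comment> \<open>\<open>\<pi>\<close> detects classes modulo \<open>p\<close>; a pair whose sum has the largest image under \<open>\<pi>\<close> cannot be extended.\<close>
  define \<pi> where "\<pi> x = restrict (\<lambda>f. e (x 1) f) F" for x :: "nat \<Rightarrow> 'g"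
  define R where "R = {a::circ. nmul p a = 0}"
  have "Rep_circ ` R \<subseteq> {w. w ^ p = 1}"
    using Rep_circ_nmul[of p] Rep_circ_0 by (auto simp: R_def) metis
  moreover have "finite {w::complex. w ^ p = 1}"
    using p_gt_0 by (intro finite_roots_unity) simp
  ultimately have finR: "finite R"
    by (meson finite_imageD finite_subset inj_onI Rep_circ_inject)
  \<comment> \<open>The \<open>p\<close>-th multiple of an entry at index 1 lies in
    \<open>G\<close>, so its pairings with \<open>F\<close> are \<open>p\<close>-torsion. Hence
    \<open>\<pi>\<close> takes finitely many values and a pair with largest image exists.\<close>
  have piR: "\<pi> x \<in> PiE F (\<lambda>_. R)" if "x \<in> tate" for x
  proof -
    have "nmul p (e (x 1) f) = 0" if "f \<in> F" for f
      using tate_Suc[OF \<open>x \<in> tate\<close>, of 0] tate_0[OF \<open>x \<in> tate\<close>] tate_L[OF \<open>x \<in> tate\<close>] that F(2) GLD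
      by (simp add: e_GG subset_iff flip: e_nmul_left)
    then show ?thesis by (auto simp: \<pi>_def R_def)
  qed
  define \<Phi> where "\<Phi> U V = \<pi> ` ssum U V" for U V
  have Phi: "\<Phi> U V \<subseteq> PiE F (\<lambda>_. R)" if "split_pair U V" for U V
  proof -
    have "ssum U V \<subseteq> tate"
      using split_pairD(3,4)[OF that] tate_rules(4) unfolding ssum_def by blast
    then show ?thesis using piR unfolding \<Phi>_def by blast
  qed
  have finP: "finite (PiE F (\<lambda>_. R))" using F finR by (intro finite_PiE) auto
  define Q where "Q U V n \<longleftrightarrow> split_pair U V \<and> card (\<Phi> U V) = n" for U V n
  have "\<exists>n. (\<exists>U V. Q U V n) \<and> (\<forall>m. (\<exists>U V. Q U V m) \<longrightarrow> m \<le> n)"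
  proof (rule Nat.ex_has_greatest_nat)
    show "\<exists>U V. Q U V (card (\<Phi> {0} {0}))" using split_pair_0 by (auto simp: Q_def)
    show "\<forall>m. (\<exists>U V. Q U V m) \<longrightarrow> m \<le> card (PiE F (\<lambda>_. R))"
      using Phi finP by (auto simp: Q_def intro!: card_mono)
  qed
  then obtain n U V where Q: "Q U V n" and n: "\<And>m U V. Q U V m \<Longrightarrow> m \<le> n" by blast
  have P: "split_pair U V"
    and max: "\<And>U' V'. split_pair U' V' \<Longrightarrow> card (\<Phi> U' V') \<le> card (\<Phi> U V)"
    using Q n by (auto simp: Q_def)
  note D = split_pairD[OF P]
  let ?W = "orth U \<inter> orth V"
  have "form s t = 0" if "s \<in> ?W" "t \<in> ?W" for s t
  proof (rule ccontr)
    assume "form s t \<noteq> 0"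
    then obtain n where "form s t n \<noteq> 0" by (auto simp: fun_eq_iff)
    then have ex: "\<exists>n. \<exists>x\<in>?W. \<exists>y\<in>?W. form x y n \<noteq> 0" using that by blast
    \<comment> \<open>A pair of minimal valuation in the complement; the minimum is over both
      arguments, as \<open>split_pair_extend\<close> demands.\<close>
    define v where "v = (LEAST n. \<exists>x\<in>?W. \<exists>y\<in>?W. form x y n \<noteq> 0)"
    obtain x y where xy: "x \<in> ?W" "y \<in> ?W" "form x y v \<noteq> 0"
      using LeastI_ex[OF ex] unfolding v_def by blast
    have min: "form s t k = 0" if "s \<in> ?W" "t \<in> ?W" "k < v" for s t k
      using not_less_Least[of k] that unfolding v_def by blast
    let ?U = "ssum U (cspan x)" and ?V = "ssum V (cspan y)"
    have P': "split_pair ?U ?V"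
      using split_pair_extend[OF P _ _ _ _ xy(3)] xy min by blast
    have xT: "x \<in> tate" and yT: "y \<in> tate" using xy by (auto simp: orth_def)
    have sub: "ssum U V \<subseteq> ssum ?U ?V"
    proof
      fix s assume "s \<in> ssum U V"
      then obtain u u' where "u \<in> U" "u' \<in> V" "s = u + u'" by (rule ssumE)
      then show "s \<in> ssum ?U ?V"
        using ssum_left[OF sg_cspan[OF xT]] ssum_left[OF sg_cspan[OF yT]] by (auto intro: ssumI)
    qed
    have "x \<in> ssum ?U ?V"
      using ssum_left[OF split_pairD(2)[OF P']] ssum_right[OF D(1) cspan_self[OF xT]] by blast
    then have "\<pi> x \<in> \<Phi> ?U ?V" by (simp add: \<Phi>_def)
    \<comment> \<open>Otherwise \<open>x\<close> equals an element of \<open>ssum U V\<close> plus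
      \<open>nmul p r\<close>. Only the component \<open>w\<close> of \<open>r\<close> in
      \<open>?W\<close> pairs with \<open>y\<close>, so \<open>form x y v\<close> is
      \<open>p\<close> times \<open>form w y v\<close>, that is \<open>form w y (v - 1)\<close>,
      which vanishes by minimality.\<close>
    moreover have "\<pi> x \<notin> \<Phi> U V"
    proof
      assume "\<pi> x \<in> \<Phi> U V"
      then obtain u u' where u: "u \<in> U" "u' \<in> V" "\<pi> x = \<pi> (u + u')"
        by (auto simp: \<Phi>_def elim!: ssumE)
      define d where "d = x - (u + u')"
      have uT: "u \<in> tate" "u' \<in> tate" using u D(3,4) by blast+
      then have uuT: "u + u' \<in> tate" by (rule tate_rules(4))
      have dT: "d \<in> tate" using uuT xT by (simp add: d_def tate_rules)
      have "d 1 \<in> G"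
      proof (rule F(3))
        show "d 1 \<in> L" using dT by (rule tate_L)
        show "nmul p (d 1) \<in> G" using tate_Suc[OF dT, of 0] tate_0[OF dT] by simp
        fix f assume f: "f \<in> F"
        have "e (x 1) f = e ((u + u') 1) f"
          using fun_cong[OF u(3), of f] f by (simp add: \<pi>_def)
        then show "e (d 1) f = 0"
          using f F(2) GLD tate_L[OF xT] tate_L[OF uuT, of 1] by (auto simp: d_def e_diff_left)
      qed
      then obtain r where r: "r \<in> tate" "d = nmul p r" using tate_divide[OF dT, of 1] by auto
      obtain c c' where c: "c \<in> U" "c' \<in> V" "r - c - c' \<in> ?W" using D(9)[OF r(1)] by blast
      define w where "w = r - c - c'"
      have wT: "w \<in> tate" using c by (auto simp: w_def orth_def)
      have cT: "c \<in> tate" "c' \<in> tate" using c D by auto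
      have x_eq: "x = (u + u') + nmul p (c + c' + w)"
        using r by (simp add: w_def d_def algebra_simps)
      have oy: "form s y = 0" if "s \<in> U \<union> V" for s
        using that xy(2) form_eq_0_sym[of y s] yT D(3,4) by (auto simp: orth_def)
      have "form x y = nmul p (form w y)"
        unfolding x_eq using u c oy uT cT wT yT by (simp add: form_add_left form_nmul_left tate_rules)
      then have "form x y v = nmul p (form w y v)" by (simp add: nmul_apply)
      moreover have "v \<noteq> 0" using xy(3) form_at_0 xT yT by metis
      then obtain v' where "v = Suc v'" using not0_implies_Suc by blast
      moreover have "nmul p (form w y (Suc v')) = form w y v'" using form_shift[OF wT yT, of 1 v'] by simp
      ultimately have "form x y v = 0" using min[of w y v'] c xy by (simp add: w_def)
      then show False using xy by simp
    qed
    moreover have "\<Phi> U V \<subseteq> \<Phi> ?U ?V" using sub by (auto simp: \<Phi>_def)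
    moreover have "finite (\<Phi> ?U ?V)" using finP Phi[OF P'] finite_subset by blast
    ultimately have "card (\<Phi> U V) < card (\<Phi> ?U ?V)" by (intro psubset_card_mono) auto
    then show False using max[OF P'] by simp
  qed
  with P show ?thesis by (rule that)
qed

text \<open>The remaining complement is isotropic and orthogonal to both sides, so it can join
  \<open>U\<close>. An element common to the enlarged side and \<open>V\<close> has no
  \<open>U\<close>-component, because \<open>U\<close> pairs with \<open>V\<close> without kernel;
  then it is orthogonal to \<open>U\<close> and vanishes by the same property of
  \<open>V\<close>.\<close>

lemma tate_lagrangian_splitting:
  obtains U V where "subgrp U" "subgrp V" "U \<subseteq> tate" "V \<subseteq> tate"
    "\<forall>x\<in>U. \<forall>y\<in>U. form x y = 0" "\<forall>x\<in>V. \<forall>y\<in>V. form x y = 0"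
    "U \<inter> V = {0}" "\<forall>t\<in>tate. t \<in> ssum U V"
proof -
  obtain U V where P: "split_pair U V"
    and iso: "\<And>s t. s \<in> orth U \<inter> orth V \<Longrightarrow> t \<in> orth U \<inter> orth V \<Longrightarrow> form s t = 0"
    using exists_split_pair by blast
  note D = split_pairD[OF P]
  let ?W = "orth U \<inter> orth V"
  have sgW: "subgrp ?W"
    using sg_orth[OF D(3)] sg_orth[OF D(4)] by (auto simp: subgrp_def)
  have WT: "?W \<subseteq> tate" by (auto simp: orth_def)
  have W: "form w u = 0" "form u w = 0" if "w \<in> ?W" "u \<in> U \<union> V" for w u
    using that form_eq_0_sym[of w u] D(3,4) by (auto simp: orth_def)
  show ?thesis
  proof (rule that[of "ssum U ?W" V])
    show "subgrp (ssum U ?W)" "subgrp V" "V \<subseteq> tate" using D sgW subgrp_ssum by auto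
    show "ssum U ?W \<subseteq> tate" using D(3) WT by (auto elim!: ssumE intro!: tate_rules(4))
    show "\<forall>x\<in>ssum U ?W. \<forall>y\<in>ssum U ?W. form x y = 0"
    proof (intro ballI)
      fix x y assume xy: "x \<in> ssum U ?W" "y \<in> ssum U ?W"
      obtain u w where 1: "u \<in> U" "w \<in> ?W" "x = u + w" using xy(1) by (rule ssumE)
      obtain u' w' where 2: "u' \<in> U" "w' \<in> ?W" "y = u' + w'" using xy(2) by (rule ssumE)
      have "u \<in> tate" "w \<in> tate" "u' \<in> tate" "w' \<in> tate" using 1 2 D(3) WT by auto
      then show "form x y = 0" using 1 2 D(5) iso W by (simp add: form_add_left form_add_right tate_rules)
    qed
    show "\<forall>x\<in>V. \<forall>y\<in>V. form x y = 0" using D(6) by simp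
    show "ssum U ?W \<inter> V = {0}"
    proof
      show "{0} \<subseteq> ssum U ?W \<inter> V" using subgrp_0[OF subgrp_ssum[OF D(1) sgW]] subgrp_0[OF D(2)] by simp
      show "ssum U ?W \<inter> V \<subseteq> {0}"
      proof
        fix s assume s: "s \<in> ssum U ?W \<inter> V"
        then obtain u w where uw: "u \<in> U" "w \<in> ?W" "s = u + w" by (auto elim!: ssumE)
        have tate: "u \<in> tate" "w \<in> tate" using uw D(3) WT by auto
        have "form u y = 0" if "y \<in> V" for y
        proof -
          have "form s y = 0" using D(6) s that by blast
          then show ?thesis using uw tate W that D(4) by (auto simp: form_add_left)
        qed
        then have "u = 0" using D(7) uw by blast
        then have "form s y = 0" if "y \<in> U" for y using W uw that by auto
        then show "s \<in> {0}" using D(8) s by blast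
      qed
    qed
    show "\<forall>t\<in>tate. t \<in> ssum (ssum U ?W) V"
    proof
      fix t assume t: "t \<in> tate"
      obtain u u' where u: "u \<in> U" "u' \<in> V" "t - u - u' \<in> ?W" using D(9)[OF t] by blast
      have "(u + (t - u - u')) + u' \<in> ssum (ssum U ?W) V" using u by (intro ssumI)
      then show "t \<in> ssum (ssum U ?W) V" by simp
    qed
  qed
qed

section \<open>From a splitting of the Tate module to a splitting of the group\<close>

definition entries :: "(nat \<Rightarrow> 'g) set \<Rightarrow> 'g set" where
  "entries U = {u n + g | u n g. u \<in> U \<and> g \<in> G}"

lemma entries_E:
  assumes "x \<in> entries U" obtains u n g where "u \<in> U" "g \<in> G" "x = u n + g"
  using assms by (auto simp: entries_def)

lemma entries_L: "U \<subseteq> tate \<Longrightarrow> x \<in> entries U \<Longrightarrow> x \<in> L"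
  unfolding entries_def using tate_L GLD L_rules(4) by blast

text \<open>Multiplying a sequence by \<open>p ^ m\<close> delays its entries by \<open>m\<close>
  places, so entries at indices \<open>n\<close> and \<open>m\<close> both reappear at
  \<open>m + n\<close>.\<close>

lemma entries_common:
  assumes "u \<in> U" "w \<in> V" "U \<subseteq> tate" "V \<subseteq> tate" "subgrp U" "subgrp V"
  obtains u' w' N where "u' \<in> U" "w' \<in> V" "u n = u' N" "w m = w' N"
proof (rule that[of "nmul (p ^ m) u" "nmul (p ^ n) w" "m + n"])
  show "u n = nmul (p ^ m) u (m + n)" using tate_nmul_at[of u m n] assms by auto
  show "w m = nmul (p ^ n) w (m + n)" using tate_nmul_at[of w n m] assms by (auto simp: add.commute)
qed (simp_all add: subgrp_nmul assms)

lemma sg_entries: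
  assumes "U \<subseteq> tate" "subgrp U" shows "subgrp (entries U)"
proof (rule subgrpI)
  show "0 \<in> entries U" using subgrp_0[OF assms(2)] G_rules(1) by (force simp: entries_def)
  fix x y assume "x \<in> entries U" "y \<in> entries U"
  then obtain u n g w m h where *: "u \<in> U" "g \<in> G" "x = u n + g" "w \<in> U" "h \<in> G" "y = w m + h"
    by (auto simp: entries_def)
  obtain u' w' N where N: "u' \<in> U" "w' \<in> U" "u n = u' N" "w m = w' N"
    using entries_common[of u U w U n m] * assms by blast
  have "x - y = (u' - w') N + (g - h)" using * N by simp
  moreover have "u' - w' \<in> U" "g - h \<in> G" using N * assms by (simp_all add: subgrp_diff G_rules)
  ultimately show "x - y \<in> entries U" unfolding entries_def by blast
qed

lemma G_sub_entries: "subgrp U \<Longrightarrow> g \<in> G \<Longrightarrow> g \<in> entries U"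
proof -
  assume "subgrp U" "g \<in> G"
  then have "(0 :: nat \<Rightarrow> 'g) 0 + g \<in> entries U" unfolding entries_def using subgrp_0 by blast
  then show ?thesis by simp
qed

lemma sub_entries: "u \<in> U \<Longrightarrow> u n \<in> entries U"
  unfolding entries_def using G_rules(1) by force

text \<open>The given element \<open>g\<close>, viewed as a character of \<open>entries U\<close> and extended by zero to \<open>entries V\<close>, is
  represented by the component of \<open>g\<close> orthogonal to \<open>entries V\<close>.\<close>

lemma G_decompose:
  assumes U: "U \<subseteq> tate" "subgrp U" and V: "V \<subseteq> tate" "subgrp V"
    and inter: "entries U \<inter> entries V \<subseteq> G" and total: "\<And>x. x \<in> L \<Longrightarrow> x \<in> ssum (entries U) (entries V)"
    and g: "g \<in> G"
  obtains h k where "h \<in> G" "k \<in> G" "g = h + k"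
    "\<forall>d\<in>entries U. e h d = 0" "\<forall>d\<in>entries V. e k d = 0"
proof -
  note sgD = sg_entries[OF U] sg_entries[OF V]
  define \<psi> where "\<psi> x = e g (SOME d. d \<in> entries U \<and> x - d \<in> entries V)" for x
  have \<psi>I: "\<psi> x = e g d" if dd: "d \<in> entries U" "x - d \<in> entries V" for x d
  proof -
    obtain c where c: "\<psi> x = e g c" "c \<in> entries U" "x - c \<in> entries V"
      using someI[of "\<lambda>d. d \<in> entries U \<and> x - d \<in> entries V" d] dd by (auto simp: \<psi>_def)
    \<comment> \<open>Two admissible choices differ by an element of both \<open>entries U\<close>
      and \<open>entries V\<close>, hence of \<open>G\<close>, where \<open>g\<close> pairs to zero.
      So \<open>\<psi>\<close> does not depend on the choice.\<close>
    have "(x - c) - (x - d) \<in> entries V" using c(3) dd(2) by (rule subgrp_diff[OF sgD(2)])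
    then have "d - c \<in> entries V" by simp
    moreover have "d - c \<in> entries U" using dd(1) c(2) by (rule subgrp_diff[OF sgD(1)])
    ultimately have "e g (d - c) = 0" using inter e_GG g by blast
    then show ?thesis using entries_L[OF U(1)] c dd GLD[OF g] by (simp add: e_diff_right)
  qed
  have ex: "\<exists>d. d \<in> entries U \<and> x - d \<in> entries V" if "x \<in> L" for x
    using total[OF that] by (force elim!: ssumE)
  have "\<exists>z\<in>L. \<forall>y\<in>L. e z y = \<psi> y"
  proof (rule characters_represented)
    fix x y assume "x \<in> L" "y \<in> L"
    then obtain c d where cd: "c \<in> entries U" "x - c \<in> entries V" "d \<in> entries U" "y - d \<in> entries V" using ex by blast
    have "(x + y) - (c + d) = (x - c) + (y - d)" by simp
    then have "(x + y) - (c + d) \<in> entries V" using subgrp_add[OF sgD(2) cd(2,4)] by (simp add: algebra_simps)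
    then have "\<psi> (x + y) = e g (c + d)" using subgrp_add[OF sgD(1) cd(1,3)] by (intro \<psi>I)
    then show "\<psi> (x + y) = \<psi> x + \<psi> y"
      using \<psi>I cd entries_L[OF U(1)] GLD[OF g] by (simp add: e_add_right)
  next
    fix h assume "h \<in> G"
    then show "\<psi> h = 0" using \<psi>I[of h h] G_sub_entries[OF U(2)] sgD e_GG g by (simp add: subgrp_0)
  qed
  then obtain k where k: "k \<in> L" "\<And>y. y \<in> L \<Longrightarrow> e k y = \<psi> y" by blast
  have kU: "e k d = e g d" if "d \<in> entries U" for d
    using k \<psi>I[of d d] that sgD entries_L[OF U(1)] by (simp add: subgrp_0)
  have kV: "e k d = 0" if "d \<in> entries V" for d
    using k \<psi>I[of 0 d] that sgD entries_L[OF V(1)] GLD[OF g] by (simp add: subgrp_0)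
  \<comment> \<open>\<open>entries V\<close> contains \<open>G\<close>, and \<open>G\<close> is its
    own orthogonal.\<close>
  have kG: "k \<in> G" using G_perp[OF k(1)] kV G_sub_entries[OF V(2)] by blast
  show ?thesis
  proof (rule that[of "g - k" k])
    show "\<forall>d\<in>entries U. e (g - k) d = 0"
      using kU entries_L[OF U(1)] GLD[OF g] k by (simp add: e_diff_left)
  qed (use kG g kV G_rules in auto)
qed

text \<open>One Lagrangian summand of \<open>L\<close>. All of \<open>G\<close> would be too much,
  since entries of \<open>U\<close> may pair non-trivially with it; the condition on
  \<open>h\<close> removes exactly these cross terms.\<close>

definition perp_sum :: "(nat \<Rightarrow> 'g) set \<Rightarrow> 'g set" where
  "perp_sum U = {h + u n | h u n. h \<in> G \<and> (\<forall>d\<in>entries U. e h d = 0) \<and> u \<in> U}"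

lemma perp_sumI:
  "h \<in> G \<Longrightarrow> (\<And>d. d \<in> entries U \<Longrightarrow> e h d = 0) \<Longrightarrow> u \<in> U \<Longrightarrow> h + u n \<in> perp_sum U"
  by (auto simp: perp_sum_def)

lemma perp_sumE:
  assumes "x \<in> perp_sum U"
  obtains h u n where "x = h + u n" "h \<in> G" "\<forall>d\<in>entries U. e h d = 0" "u \<in> U"
proof -
  obtain h u n where "x = h + u n \<and> h \<in> G \<and> (\<forall>d\<in>entries U. e h d = 0) \<and> u \<in> U"
    using assms unfolding perp_sum_def by (elim CollectE exE)
  then show ?thesis using that[of h u n] by simp
qed

lemma perp_sum_G:
  assumes "subgrp U" "h \<in> G" "\<And>d. d \<in> entries U \<Longrightarrow> e h d = 0"
  shows "h \<in> perp_sum U"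
  using perp_sumI[OF assms(2,3) subgrp_0[OF assms(1)], of 0] by simp

lemma perp_sum_L:
  assumes "U \<subseteq> tate" shows "perp_sum U \<subseteq> L"
proof
  fix x assume "x \<in> perp_sum U"
  then obtain h u n where x: "x = h + u n" "h \<in> G" "u \<in> U" by (rule perp_sumE)
  have "u \<in> tate" using x(3) assms by (rule_tac subsetD)
  then show "x \<in> L" unfolding x(1) by (intro L_rules(4) GLD[OF x(2)] tate_L)
qed

lemma sg_perp_sum:
  assumes U: "U \<subseteq> tate" "subgrp U" shows "subgrp (perp_sum U)"
proof (rule subgrpI)
  show "0 \<in> perp_sum U" using perp_sum_G[OF U(2) G_rules(1)] entries_L[OF U(1)] by simp
  fix x y assume x: "x \<in> perp_sum U" and y: "y \<in> perp_sum U"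
  obtain g u n where 1: "x = g + u n" "g \<in> G" "\<forall>d\<in>entries U. e g d = 0" "u \<in> U"
    using x by (rule perp_sumE)
  obtain h w m where 2: "y = h + w m" "h \<in> G" "\<forall>d\<in>entries U. e h d = 0" "w \<in> U"
    using y by (rule perp_sumE)
  obtain u' w' N where N: "u' \<in> U" "w' \<in> U" "u n = u' N" "w m = w' N"
    using entries_common[OF 1(4) 2(4) U(1) U(1) U(2) U(2), of n m] by blast
  have "x - y = (g - h) + (u' - w') N" using 1(1) 2(1) N by simp
  moreover have "g - h \<in> G" "u' - w' \<in> U" using N 1 2 U by (simp_all add: subgrp_diff G_rules)
  moreover have "e (g - h) d = 0" if "d \<in> entries U" for d
    using bspec[OF 1(3) that] bspec[OF 2(3) that] GLD[OF 1(2)] GLD[OF 2(2)] entries_L[OF U(1) that]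
    by (simp add: e_diff_left)
  ultimately show "x - y \<in> perp_sum U" using perp_sumI by metis
qed

lemma perp_sum_isotropic:
  assumes U: "U \<subseteq> tate" "\<And>x y. x \<in> U \<Longrightarrow> y \<in> U \<Longrightarrow> form x y = 0"
    and x: "x \<in> perp_sum U" and y: "y \<in> perp_sum U"
  shows "e x y = 0"
proof -
  obtain g u n where 1: "x = g + u n" "g \<in> G" "\<forall>d\<in>entries U. e g d = 0" "u \<in> U"
    using x by (rule perp_sumE)
  obtain h w m where 2: "y = h + w m" "h \<in> G" "\<forall>d\<in>entries U. e h d = 0" "w \<in> U"
    using y by (rule perp_sumE)
  have tate: "u \<in> tate" "w \<in> tate" using subsetD[OF U(1)] 1(4) 2(4) by simp_all
  have inL: "g \<in> L" "h \<in> L" "u n \<in> L" "w m \<in> L" using GLD[OF 1(2)] GLD[OF 2(2)] tate_L[OF tate(1)] tate_L[OF tate(2)] by simp_all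
  have "e (u n) (w m) = 0" using e_eq_form[OF tate] U(2)[OF 1(4) 2(4)] by simp
  moreover have "e (u n) h = 0" using e_anti[OF inL(2,3)] 2(3) sub_entries[OF 1(4)] by simp
  moreover have "e g (w m) = 0" using 1(3) sub_entries[OF 2(4)] by simp
  ultimately show "e x y = 0"
    using 1(1) 2(1) inL e_GG[OF 1(2) 2(2)] by (simp add: e_add_left e_add_right L_rules)
qed

text \<open>Modulo \<open>G\<close> the entries of \<open>U\<close> and \<open>V\<close> split
  \<open>L / G\<close>. Then \<open>G\<close>, the group of characters of \<open>L / G\<close>,
  splits dually by \<open>G_decompose\<close>, and each part of \<open>G\<close> is added to the
  side whose entries it annihilates.\<close>

theorem lagrangian_splitting:
  obtains A B where "subgrp A" "subgrp B" "A \<subseteq> L" "B \<subseteq> L"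
    "\<And>x y. x \<in> A \<Longrightarrow> y \<in> A \<Longrightarrow> e x y = 0" "\<And>x y. x \<in> B \<Longrightarrow> y \<in> B \<Longrightarrow> e x y = 0"
    "\<And>x. x \<in> L \<Longrightarrow> x \<in> ssum A B" "\<And>g. g \<in> G \<Longrightarrow> g \<in> ssum (G \<inter> A) (G \<inter> B)"
proof -
  obtain U V where sg: "subgrp U" "subgrp V" and sub: "U \<subseteq> tate" "V \<subseteq> tate"
    and iso: "\<forall>x\<in>U. \<forall>y\<in>U. form x y = 0" "\<forall>x\<in>V. \<forall>y\<in>V. form x y = 0"
    and UV: "U \<inter> V = {0}" "\<forall>t\<in>tate. t \<in> ssum U V"
    by (rule tate_lagrangian_splitting)
  note U = sg(1) sub(1) and V = sg(2) sub(2)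
  have total: "x \<in> ssum (entries U) (entries V)" if x: "x \<in> L" for x
  proof -
    obtain t n where t: "t \<in> tate" "t n - x \<in> G" using tate_lift[OF x] by blast
    obtain u w where uw: "u \<in> U" "w \<in> V" "t = u + w" using bspec[OF UV(2) t(1)] by (rule ssumE)
    have "x = u n + (w n + - (t n - x))" using uw by simp
    moreover have "w n + - (t n - x) \<in> entries V"
      using uw t G_rules(3)[OF t(2)] unfolding entries_def by blast
    ultimately show ?thesis using sub_entries[OF uw(1), of n] ssumI by metis
  qed
  \<comment> \<open>The difference \<open>u - w\<close> is divisible by \<open>p ^ n\<close>.
    Splitting the quotient into \<open>c\<close> and \<open>d\<close> and comparing components gives
    \<open>u = nmul (p ^ n) c\<close>, whose entry \<open>n\<close> is \<open>c 0\<close>, an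
    element of \<open>G\<close>.\<close>
  have key: "u n \<in> G" if uw: "u \<in> U" "w \<in> V" "u n - w n \<in> G" for u w n
  proof -
    have "u - w \<in> tate" using uw U V by (intro tate_rules) auto
    then obtain t where t: "t \<in> tate" "u - w = nmul (p ^ n) t" using tate_divide[of "u - w" n] uw(3) by auto
    obtain c d where cd: "c \<in> U" "d \<in> V" "t = c + d" using bspec[OF UV(2) t(1)] by (rule ssumE)
    have "u - nmul (p ^ n) c = w + nmul (p ^ n) d"
      using t cd by (simp add: nmul_plus algebra_simps)
    moreover have "u - nmul (p ^ n) c \<in> U" using U cd uw by (simp add: subgrp_rules)
    moreover have "w + nmul (p ^ n) d \<in> V" using V cd uw by (simp add: subgrp_rules)
    ultimately have "u - nmul (p ^ n) c = 0" using UV(1) by auto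
    then have "u = nmul (p ^ n) c" by simp
    then show ?thesis using tate_nmul_G[of c n] cd U by auto
  qed
  have inter: "entries U \<inter> entries V \<subseteq> G"
  proof
    fix x assume x: "x \<in> entries U \<inter> entries V"
    obtain u n g where 1: "u \<in> U" "g \<in> G" "x = u n + g" using IntD1[OF x] by (rule entries_E)
    obtain w m h where 2: "w \<in> V" "h \<in> G" "x = w m + h" using IntD2[OF x] by (rule entries_E)
    note * = 1 2
    obtain u' w' N where N: "u' \<in> U" "w' \<in> V" "u n = u' N" "w m = w' N"
      using entries_common[OF 1(1) 2(1) U(2) V(2) U(1) V(1), of n m] by blast
    have "u' N - w' N = h - g" using * N by (simp add: algebra_simps)
    then have "u' N \<in> G" using key[OF N(1,2)] * G_rules by simp
    then show "x \<in> G" using * N G_rules by simp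
  qed
  show ?thesis
  proof (rule that[of "perp_sum U" "perp_sum V"])
    show "subgrp (perp_sum U)" "subgrp (perp_sum V)" "perp_sum U \<subseteq> L" "perp_sum V \<subseteq> L"
      using U V by (simp_all add: sg_perp_sum perp_sum_L)
    show "e x y = 0" if "x \<in> perp_sum U" "y \<in> perp_sum U" for x y
      using perp_sum_isotropic[OF U(2) _ that] iso by simp
    show "e x y = 0" if "x \<in> perp_sum V" "y \<in> perp_sum V" for x y
      using perp_sum_isotropic[OF V(2) _ that] iso by simp
    show "g \<in> ssum (G \<inter> perp_sum U) (G \<inter> perp_sum V)" if g: "g \<in> G" for g
    proof -
      obtain h k where hk: "h \<in> G" "k \<in> G" "g = h + k"
        "\<forall>d\<in>entries U. e h d = 0" "\<forall>d\<in>entries V. e k d = 0"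
        by (rule G_decompose[OF U(2,1) V(2,1) inter total g])
      have "h \<in> perp_sum U" "k \<in> perp_sum V"
        using perp_sum_G[OF U(1) hk(1)] perp_sum_G[OF V(1) hk(2)] hk by simp_all
      then show ?thesis using hk by (auto intro!: ssumI)
    qed
    show "x \<in> ssum (perp_sum U) (perp_sum V)" if x: "x \<in> L" for x
    proof -
      obtain y z where yz: "y \<in> entries U" "z \<in> entries V" "x = y + z" using total[OF x] by (rule ssumE)
      obtain u n f where 1: "u \<in> U" "f \<in> G" "y = u n + f" using yz(1) by (rule entries_E)
      obtain w m f' where 2: "w \<in> V" "f' \<in> G" "z = w m + f'" using yz(2) by (rule entries_E)
      note * = 1 2
      have ff: "f + f' \<in> G" using * by (simp add: G_rules)
      obtain h k where hk: "h \<in> G" "k \<in> G" "f + f' = h + k"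
        "\<forall>d\<in>entries U. e h d = 0" "\<forall>d\<in>entries V. e k d = 0"
        by (rule G_decompose[OF U(2,1) V(2,1) inter total ff])
      \<comment> \<open>The remainders in \<open>G\<close> from the two sides need not annihilate
        the right entries, so they are pooled and redistributed by
        \<open>G_decompose\<close>.\<close>
      have "x = u n + w m + (f + f')" using yz * by (simp add: algebra_simps)
      also have "\<dots> = (h + u n) + (k + w m)" unfolding hk(3) by (simp add: algebra_simps)
      finally have "x = (h + u n) + (k + w m)" .
      moreover have "h + u n \<in> perp_sum U" "k + w m \<in> perp_sum V"
        using perp_sumI[OF hk(1) _ *(1)] perp_sumI[OF hk(2) _ *(4)] hk(4,5) by simp_all
      ultimately show ?thesis using ssumI by simp
    qed
  qed
qed

end

section \<open>Coordinates in the p-adic integers\<close>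

text \<open>\<open>c g i n\<close> is the residue modulo \<open>p ^ n\<close> of the
  \<open>i\<close>-th coordinate of \<open>g\<close>. The locale separates the arithmetic of
  residues from the isomorphism that supplies them.\<close>

locale padic_coordinates =
  fixes G :: "'g :: ab_group_add set" and c :: "'g \<Rightarrow> nat \<Rightarrow> nat \<Rightarrow> int" and p l :: nat
  assumes prime_p: "prime p" and sgG: "subgrp G"
    and c_add: "\<lbrakk>g \<in> G; h \<in> G; i < l\<rbrakk> \<Longrightarrow> c (g + h) i n = (c g i n + c h i n) mod int p ^ n"
    and c_range: "\<lbrakk>g \<in> G; i < l\<rbrakk> \<Longrightarrow> 0 \<le> c g i n \<and> c g i n < int p ^ n"
    and c_compatible: "\<lbrakk>g \<in> G; i < l\<rbrakk> \<Longrightarrow> c g i n = c g i (Suc n) mod int p ^ n"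
    and c_inj: "\<lbrakk>g \<in> G; h \<in> G; \<And>i n. i < l \<Longrightarrow> c g i n = c h i n\<rbrakk> \<Longrightarrow> g = h"
    and c_surj: "(\<And>i n. i < l \<Longrightarrow> 0 \<le> z i n \<and> z i n < int p ^ n \<and> z i n = z i (Suc n) mod int p ^ n)
        \<Longrightarrow> \<exists>g\<in>G. \<forall>i<l. \<forall>n. c g i n = z i n"
begin

lemmas G_rules = subgrp_rules[OF sgG]

lemma p_pos: "0 < int p ^ n"
  using prime_p prime_gt_0_nat by simp

lemma c_mod: "g \<in> G \<Longrightarrow> i < l \<Longrightarrow> c g i n mod int p ^ n = c g i n"
  using c_range by simp

lemma c_eqI: "g \<in> G \<Longrightarrow> i < l \<Longrightarrow> 0 \<le> a \<Longrightarrow> a < int p ^ n \<Longrightarrow> [c g i n = a] (mod int p ^ n) \<Longrightarrow> c g i n = a"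
  using c_mod by (simp add: cong_def)

lemma c_add_cong: "\<lbrakk>g \<in> G; h \<in> G; i < l\<rbrakk> \<Longrightarrow> [c (g + h) i n = c g i n + c h i n] (mod int p ^ n)"
  by (simp add: c_add cong_def)

lemma c_Suc_cong: "\<lbrakk>g \<in> G; i < l\<rbrakk> \<Longrightarrow> [c g i (Suc n) = c g i n] (mod int p ^ n)"
  using c_compatible[of g i n] c_mod[of g i n] by (simp add: cong_def)

lemma c_zero: assumes "i < l" shows "c 0 i n = 0"
proof (rule c_eqI)
  have "[c 0 i n + 0 = c 0 i n + c 0 i n] (mod int p ^ n)"
    using c_add_cong[of 0 0 i n] assms G_rules by simp
  then show "[c 0 i n = 0] (mod int p ^ n)"
    using cong_add_lcancel[of "c 0 i n" 0 "c 0 i n"] by (simp add: cong_sym_eq)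
qed (use assms G_rules p_pos in auto)

lemma c_nmul_cong: "g \<in> G \<Longrightarrow> i < l \<Longrightarrow> [c (nmul k g) i n = int k * c g i n] (mod int p ^ n)"
proof (induction k)
  case (Suc k)
  have "[c (nmul (Suc k) g) i n = c g i n + c (nmul k g) i n] (mod int p ^ n)"
    using c_add_cong[of g "nmul k g" i n] Suc.prems G_rules by simp
  also have "[c g i n + c (nmul k g) i n = c g i n + int k * c g i n] (mod int p ^ n)"
    using Suc by (intro cong_add) auto
  finally show ?case by (simp add: algebra_simps)
qed (simp add: c_zero)

lemma c_cong_le:
  assumes "g \<in> G" "i < l" "m \<le> n"
  shows "[c g i n = c g i m] (mod int p ^ m)"
  using assms(3)
proof (induction n rule: dec_induct)
  case (step n)
  then have "[c g i (Suc n) = c g i n] (mod int p ^ m)"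
    using c_Suc_cong assms by (meson cong_dvd_modulus le_imp_power_dvd)
  then show ?case using step cong_trans by blast
qed simp

lemma torsion_free:
  assumes "g \<in> G" "nmul p g = 0" shows "g = 0"
proof (rule c_inj)
  fix i n assume i: "i < l"
  \<comment> \<open>Cancelling \<open>p\<close> costs one level: level \<open>Suc n\<close> of
    \<open>nmul p g\<close> controls level \<open>n\<close> of \<open>g\<close>.\<close>
  have "[c (nmul p g) i (Suc n) = int p * c g i (Suc n)] (mod int p ^ Suc n)"
    using c_nmul_cong assms i by blast
  then have "[int p * c g i (Suc n) = 0] (mod int p ^ Suc n)"
    using assms i c_zero by (simp add: cong_sym_eq)
  then have "int p * int p ^ n dvd int p * c g i (Suc n)" by (simp add: cong_0_iff)
  then have "int p ^ n dvd c g i (Suc n)" using p_pos[of 1] by simp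
  then have "c g i n = 0" using c_compatible[OF assms(1) i, of n] by simp
  then show "c g i n = c 0 i n" using c_zero i by simp
qed (use assms G_rules in auto)

lemma separated:
  assumes "\<And>n. \<exists>h\<in>G. g = nmul (p ^ n) h" shows "g = 0"
proof (rule c_inj)
  show g: "g \<in> G" using assms[of 0] by auto
  fix i n assume i: "i < l"
  obtain h where h: "h \<in> G" "g = nmul (p ^ n) h" using assms by blast
  have "[c g i n = int (p ^ n) * c h i n] (mod int p ^ n)" using c_nmul_cong h i by blast
  also have "[int (p ^ n) * c h i n = 0] (mod int p ^ n)" by (simp add: cong_0_iff)
  finally have "c g i n = 0" using c_eqI g i p_pos by simp
  then show "c g i n = c 0 i n" using c_zero i by simp
qed (use G_rules in auto)

text \<open>If all residues are divisible by \<open>p\<close>, the quotients form compatible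
  residues one level lower, and these are the coordinates of \<open>h\<close>.\<close>

lemma divisible_if_level_1:
  assumes g: "g \<in> G" and 0: "\<And>i. i < l \<Longrightarrow> c g i 1 = 0"
  shows "\<exists>h\<in>G. g = nmul p h"
proof -
  have dvd: "int p dvd c g i (Suc n)" if "i < l" for i n
    using c_cong_le[OF g that, of 1 "Suc n"] 0[OF that] by (simp add: cong_0_iff)
  have pp: "0 < int p" using prime_p prime_gt_0_nat by simp
  have "\<exists>h\<in>G. \<forall>i<l. \<forall>n. c h i n = c g i (Suc n) div int p"
  proof (rule c_surj, intro conjI)
    fix i n assume i: "i < l"
    show "0 \<le> c g i (Suc n) div int p"
      using c_range[OF g i, of "Suc n"] pp by (simp add: pos_imp_zdiv_nonneg_iff)
    show "c g i (Suc n) div int p < int p ^ n"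
    proof -
      have "int p * (c g i (Suc n) div int p) < int p * int p ^ n"
        using c_range[OF g i, of "Suc n"] dvd[OF i] by simp
      then show ?thesis using pp by (simp only: mult_less_cancel_left_pos)
    qed
    have "c g i (Suc n) = c g i (Suc (Suc n)) mod (int p * int p ^ n)"
      using c_compatible[OF g i, of "Suc n"] by simp
    also have "\<dots> = int p * (c g i (Suc (Suc n)) div int p mod int p ^ n) + c g i (Suc (Suc n)) mod int p"
      using pp by (intro zmod_zmult2_eq) simp
    also have "c g i (Suc (Suc n)) mod int p = 0" using dvd[OF i] by simp
    finally show "c g i (Suc n) div int p = c g i (Suc (Suc n)) div int p mod int p ^ n"
      using pp by simp
  qed
  then obtain h where h: "h \<in> G" "\<And>i n. i < l \<Longrightarrow> c h i n = c g i (Suc n) div int p" by blast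
  have "g = nmul p h"
  proof (rule c_inj)
    fix i n assume i: "i < l"
    have "[c (nmul p h) i n = int p * (c g i (Suc n) div int p)] (mod int p ^ n)"
      using c_nmul_cong[OF h(1) i, of p n] h(2)[OF i] by simp
    also have "int p * (c g i (Suc n) div int p) = c g i (Suc n)" using dvd[OF i] by simp
    also have "[c g i (Suc n) = c g i n] (mod int p ^ n)" using c_Suc_cong g i by blast
    finally show "c g i n = c (nmul p h) i n"
      using c_eqI[of "nmul p h" i "c g i n" n] c_range[OF g i] h i G_rules by simp
  qed (use g h G_rules in auto)
  then show ?thesis using h by blast
qed

text \<open>One element is chosen for each vector of residues modulo \<open>p\<close>. Two elements
  with the same vector differ by an element of \<open>pG\<close>.\<close>

lemma finite_representatives:
  "\<exists>F. finite F \<and> F \<subseteq> G \<and> (\<forall>g\<in>G. \<exists>f\<in>F. \<exists>h\<in>G. g = f + nmul p h)"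
proof -
  define r where "r g = restrict (\<lambda>i. c g i 1) {..<l}" for g
  have "r ` G \<subseteq> PiE {..<l} (\<lambda>_. {0..<int p})"
  proof
    fix f assume "f \<in> r ` G"
    then obtain g where g: "g \<in> G" "f = restrict (\<lambda>i. c g i 1) {..<l}" by (auto simp: r_def)
    show "f \<in> PiE {..<l} (\<lambda>_. {0..<int p})"
      unfolding g(2) restrict_PiE_iff using c_range[OF g(1), where n = 1] by simp
  qed
  then have fin: "finite (r ` G)" by (rule finite_subset) (auto intro: finite_PiE)
  define F where "F = inv_into G r ` r ` G"
  have "\<exists>f\<in>F. \<exists>h\<in>G. g = f + nmul p h" if g: "g \<in> G" for g
  proof -
    define f where "f = inv_into G r (r g)"
    have f: "f \<in> F" "f \<in> G" "r f = r g"
      using g by (auto simp: F_def f_def inv_into_into f_inv_into_f)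
    have "c (g - f) i 1 = 0" if i: "i < l" for i
    proof -
      have "[c (g - f) i 1 + c f i 1 = c g i 1] (mod int p ^ 1)"
        using c_add_cong[of "g - f" f i 1] g f i G_rules by (simp add: cong_sym_eq)
      moreover have "c f i 1 = c g i 1" using fun_cong[OF f(3), of i] i by (simp add: r_def)
      ultimately have "[c (g - f) i 1 + c g i 1 = 0 + c g i 1] (mod int p ^ 1)" by simp
      then have "[c (g - f) i 1 = 0] (mod int p ^ 1)" using cong_add_rcancel by blast
      then show ?thesis using c_eqI[of "g - f" i 0 1] g f i G_rules p_pos[of 1] by simp
    qed
    then obtain h where "h \<in> G" "g - f = nmul p h"
      using divisible_if_level_1[of "g - f"] g f by (auto simp: G_rules)
    then show ?thesis using f(1) by (metis add.commute diff_add_cancel)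
  qed
  moreover have "F \<subseteq> G" by (auto simp: F_def inv_into_into)
  moreover have "finite F" using fin by (simp add: F_def)
  ultimately show ?thesis by blast
qed

lemma power_series:
  "\<exists>S. \<forall>h. (\<forall>n. h n \<in> G) \<longrightarrow> S h \<in> G \<and> S h = h 0 + nmul p (S (\<lambda>n. h (Suc n)))"
proof -
  \<comment> \<open>These are the residues of the infinite sum of \<open>p ^ k\<close> times
    \<open>h k\<close>: at level \<open>n\<close> all terms with \<open>k\<close> at least
    \<open>n\<close> vanish.\<close>
  define z where "z h i n = (\<Sum>k<n. int p ^ k * c (h k) i n) mod int p ^ n" for h i n
  have "\<exists>g\<in>G. \<forall>i<l. \<forall>n. c g i n = z h i n" if h: "\<And>n. h n \<in> G" for h
  proof (rule c_surj, intro conjI)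
    fix i n assume i: "i < l"
    show "0 \<le> z h i n" "z h i n < int p ^ n" using p_pos by (simp_all add: z_def)
    have "[z h i (Suc n) = (\<Sum>k<Suc n. int p ^ k * c (h k) i (Suc n))] (mod int p ^ n)"
      by (rule cong_dvd_modulus[of _ _ "int p ^ Suc n"]) (simp_all add: z_def cong_def)
    also have "(\<Sum>k<Suc n. int p ^ k * c (h k) i (Suc n))
        = (\<Sum>k<n. int p ^ k * c (h k) i (Suc n)) + int p ^ n * c (h n) i (Suc n)" by simp
    also have "[\<dots> = (\<Sum>k<n. int p ^ k * c (h k) i n) + 0] (mod int p ^ n)"
      using c_Suc_cong h i by (intro cong_add cong_sum cong_mult) (auto simp: cong_0_iff)
    finally show "z h i n = z h i (Suc n) mod int p ^ n" by (simp add: z_def cong_def)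
  qed
  then have "\<forall>h. \<exists>g. (\<forall>n. h n \<in> G) \<longrightarrow> g \<in> G \<and> (\<forall>i<l. \<forall>n. c g i n = z h i n)" by meson
  then obtain S where S: "\<And>h. (\<forall>n. h n \<in> G) \<Longrightarrow> S h \<in> G \<and> (\<forall>i<l. \<forall>n. c (S h) i n = z h i n)"
    by metis
  have "S h = h 0 + nmul p (S (\<lambda>n. h (Suc n)))" if h: "\<forall>n. h n \<in> G" for h
  proof (rule c_inj)
    let ?h = "\<lambda>n. h (Suc n)"
    have h': "\<forall>n. ?h n \<in> G" using h by blast
    show "S h \<in> G" using S h by blast
    show R: "h 0 + nmul p (S ?h) \<in> G" using S[OF h'] h by (simp add: G_rules)
    fix i n assume i: "i < l"
    have "[c (h 0 + nmul p (S ?h)) i n = c (h 0) i n + c (nmul p (S ?h)) i n] (mod int p ^ n)"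
      using S[OF h'] h i by (intro c_add_cong) (simp_all add: G_rules)
    also have "[c (h 0) i n + c (nmul p (S ?h)) i n = c (h 0) i n + int p * z ?h i n] (mod int p ^ n)"
      using c_nmul_cong[of "S ?h" i p n] S[OF h'] i by (intro cong_add) auto
    also have "[c (h 0) i n + int p * z ?h i n
        = c (h 0) i n + int p * (\<Sum>k<n. int p ^ k * c (?h k) i n)] (mod int p ^ n)"
      by (intro cong_add cong_mult) (auto simp: z_def cong_def)
    also have "c (h 0) i n + int p * (\<Sum>k<n. int p ^ k * c (?h k) i n)
        = (\<Sum>k<Suc n. int p ^ k * c (h k) i n)"
      by (subst sum.lessThan_Suc_shift) (simp add: sum_distrib_left mult.assoc)
    also have "\<dots> = (\<Sum>k<n. int p ^ k * c (h k) i n) + int p ^ n * c (h n) i n" by simp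
    also have "[\<dots> = (\<Sum>k<n. int p ^ k * c (h k) i n) + 0] (mod int p ^ n)"
      by (intro cong_add) (auto simp: cong_0_iff)
    also have "[(\<Sum>k<n. int p ^ k * c (h k) i n) + 0 = z h i n] (mod int p ^ n)"
      by (simp add: z_def cong_def)
    finally show "c (S h) i n = c (h 0 + nmul p (S ?h)) i n"
      using S[OF h] i c_eqI[OF R i, of "z h i n" n] p_pos by (simp add: z_def)
  qed
  then show ?thesis using S by blast
qed

end

section \<open>Standard triples from Lagrangian splittings\<close>

lemma openin_dual_basic:
  assumes "compactin (tg_top H) K" "open U"
  shows "openin (tg_top (dual H)) {c \<in> characters H. c ` K \<subseteq> U}"
  unfolding dual_def using assms by (auto intro!: topology_generated_by_Basis)

lemma topspace_dual: "topspace (tg_top (dual H)) = characters H"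
proof -
  \<comment> \<open>The empty compact set makes the set of all characters subbasic, so the generated
    topology covers it.\<close>
  have "compactin (tg_top H) {} \<and> open (UNIV :: complex set)" by simp
  then have "characters H \<in> {{c \<in> characters H. c ` K \<subseteq> U} | K U. compactin (tg_top H) K \<and> open U}"
    by (intro CollectI exI[of _ "{}"] exI[of _ UNIV]) auto
  then show ?thesis unfolding dual_def by auto
qed

lemma continuous_map_dual:
  assumes "\<And>y. y \<in> topspace Y \<Longrightarrow> F y \<in> characters H"
    and "\<And>K U. compactin (tg_top H) K \<Longrightarrow> open U \<Longrightarrow> openin Y {y \<in> topspace Y. F y ` K \<subseteq> U}"
  shows "continuous_map Y (tg_top (dual H)) F"
proof -
  let ?S = "{{c \<in> characters H. c ` K \<subseteq> U} | K U. compactin (tg_top H) K \<and> open U}"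
  have "continuous_map Y (topology_generated_by ?S) F"
  proof (rule continuous_on_generated_topo)
    fix V assume "V \<in> ?S"
    then obtain K U where KU: "compactin (tg_top H) K" "open U" "V = {c \<in> characters H. c ` K \<subseteq> U}"
      by blast
    have "F -` V \<inter> topspace Y = {y \<in> topspace Y. F y ` K \<subseteq> U}" using KU(3) assms(1) by auto
    then show "openin Y (F -` V \<inter> topspace Y)" using assms(2) KU by simp
  next
    have "topspace (tg_top (dual H)) = characters H" by (rule topspace_dual)
    then show "F ` topspace Y \<subseteq> \<Union> ?S" using assms(1) unfolding dual_def by auto
  qed
  then show ?thesis by (simp add: dual_def)
qed

locale self_dual_group =
  fixes L :: "'a tgroup" and nabla :: "'a \<Rightarrow> 'a \<Rightarrow> complex"
  assumes LCA_L: "LCA L" and duality: "symplectic_self_duality L nabla"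
begin

abbreviation "C \<equiv> tg_carrier L"
abbreviation "X \<equiv> tg_top L"
abbreviation plus (infixl "\<oplus>" 65) where "x \<oplus> y \<equiv> tg_add L x y"
abbreviation zero ("\<zero>") where "\<zero> \<equiv> tg_zero L"
abbreviation neg ("\<ominus> _" [81] 80) where "\<ominus> x \<equiv> tg_neg L x"

lemma tgroup: "abelian_tgroup L"
  and Hausdorff: "Hausdorff_space X" and loc_compact: "locally_compact_space X"
  using LCA_L by (auto simp: LCA_def)

lemma carrier_closed [simp]: "\<zero> \<in> C" "x \<in> C \<Longrightarrow> y \<in> C \<Longrightarrow> x \<oplus> y \<in> C" "x \<in> C \<Longrightarrow> \<ominus> x \<in> C"
  using tgroup by (auto simp: abelian_tgroup_def Let_def)

lemma assoc: "x \<in> C \<Longrightarrow> y \<in> C \<Longrightarrow> z \<in> C \<Longrightarrow> x \<oplus> y \<oplus> z = x \<oplus> (y \<oplus> z)"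
  and commute: "x \<in> C \<Longrightarrow> y \<in> C \<Longrightarrow> x \<oplus> y = y \<oplus> x"
  and zero_left: "x \<in> C \<Longrightarrow> \<zero> \<oplus> x = x" and neg_left: "x \<in> C \<Longrightarrow> \<ominus> x \<oplus> x = \<zero>"
  and topspace_X: "topspace X = C"
  and continuous_add: "continuous_map (prod_topology X X) X (\<lambda>(x, y). x \<oplus> y)"
  and continuous_neg: "continuous_map X X (tg_neg L)"
  using tgroup by (auto simp: abelian_tgroup_def Let_def)

lemma zero_right: "x \<in> C \<Longrightarrow> x \<oplus> \<zero> = x"
  using commute[of x \<zero>] zero_left by simp

lemma continuous_add_maps:
  "continuous_map Y X f \<Longrightarrow> continuous_map Y X g \<Longrightarrow> continuous_map Y X (\<lambda>y. f y \<oplus> g y)"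
  using continuous_map_compose[OF continuous_map_pairedI continuous_add] by (auto simp: o_def)

lemma continuous_neg_map: "continuous_map Y X f \<Longrightarrow> continuous_map Y X (\<lambda>y. \<ominus> (f y))"
  using continuous_map_compose[OF _ continuous_neg] by (auto simp: o_def)

lemma nabla_character: "x \<in> C \<Longrightarrow> nabla x \<in> characters L"
  and nabla_add: "x \<in> C \<Longrightarrow> y \<in> C \<Longrightarrow> nabla (x \<oplus> y) = (\<lambda>w. nabla x w * nabla y w)"
  and nabla_inj: "inj_on nabla C" and nabla_surj: "nabla ` C = characters L"
  and nabla_homeo: "homeomorphic_map X (tg_top (dual L)) nabla"
  and nabla_alt: "x \<in> C \<Longrightarrow> nabla x x = 1"
  using duality by (auto simp: symplectic_self_duality_def tg_iso_def tg_hom_def dual_def bij_betw_def)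

lemma character_norm:
  assumes "c \<in> characters L" shows "norm (c x) = 1"
proof (cases "x \<in> C")
  case True
  have "c x \<in> topspace circle_top"
    using assms True topspace_X by (auto simp: characters_def continuous_map_def)
  then show ?thesis by (simp add: circle_top_def)
qed (use assms in \<open>simp add: characters_def\<close>)

lemma nabla_norm: "x \<in> C \<Longrightarrow> norm (nabla x y) = 1"
  using character_norm nabla_character by blast

lemma nabla_outside: "x \<in> C \<Longrightarrow> y \<notin> C \<Longrightarrow> nabla x y = 1"
  using nabla_character by (auto simp: characters_def)

lemma nabla_add_right: "x \<in> C \<Longrightarrow> y \<in> C \<Longrightarrow> z \<in> C \<Longrightarrow> nabla x (y \<oplus> z) = nabla x y * nabla x z"
  using nabla_character[of x] by (auto simp: characters_def)

lemma nabla_continuous: "x \<in> C \<Longrightarrow> continuous_map X circle_top (nabla x)"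
  using nabla_character[of x] by (auto simp: characters_def)

text \<open>Evaluation of \<open>nabla\<close> embeds \<open>L\<close> into a group that is a type, so that identities in \<open>L\<close> can be
  checked by the arithmetic of the class \<^class>\<open>ab_group_add\<close>.\<close>

definition emb :: "'a \<Rightarrow> 'a \<Rightarrow> circ" where
  "emb x y = Abs_circ (nabla x y)"

lemma Rep_emb: "x \<in> C \<Longrightarrow> Rep_circ (emb x y) = nabla x y"
  by (simp add: emb_def Abs_circ_inverse nabla_norm)

lemma emb_eqI:
  "x \<in> C \<Longrightarrow> (\<And>y. y \<in> C \<Longrightarrow> Rep_circ (f y) = nabla x y) \<Longrightarrow> (\<And>y. y \<notin> C \<Longrightarrow> f y = 0) \<Longrightarrow> emb x = f"
  by (metis Rep_circ_0 Rep_circ_inject Rep_emb ext nabla_outside)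

lemma emb_add [simp]: "x \<in> C \<Longrightarrow> y \<in> C \<Longrightarrow> emb (x \<oplus> y) = emb x + emb y"
  by (rule ext) (simp add: Rep_emb nabla_add Rep_circ_add flip: Rep_circ_inject)

lemma emb_zero [simp]: "emb \<zero> = 0"
  using emb_add[of \<zero> \<zero>] zero_left[of \<zero>] by simp

lemma emb_neg [simp]: "x \<in> C \<Longrightarrow> emb (\<ominus> x) = - emb x"
  using emb_add[of "\<ominus> x" x] neg_left[of x] by (simp add: eq_neg_iff_add_eq_0)

lemma emb_inj: "x \<in> C \<Longrightarrow> y \<in> C \<Longrightarrow> emb x = emb y \<longleftrightarrow> x = y"
  using inj_onD[OF nabla_inj, of x y] Rep_emb by (metis ext)

lemma emb_eqD: "emb x = emb y \<Longrightarrow> x \<in> C \<Longrightarrow> y \<in> C \<Longrightarrow> x = y"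
  using emb_inj by blast

lemma emb_right_add [simp]: "x \<in> C \<Longrightarrow> y \<in> C \<Longrightarrow> z \<in> C \<Longrightarrow> emb x (y \<oplus> z) = emb x y + emb x z"
  by (simp add: Rep_emb nabla_add_right Rep_circ_add flip: Rep_circ_inject)

lemma emb_right_zero [simp]: "x \<in> C \<Longrightarrow> emb x \<zero> = 0"
  using emb_right_add[of x \<zero> \<zero>] zero_left[of \<zero>] by simp

lemma emb_right_neg [simp]: "x \<in> C \<Longrightarrow> y \<in> C \<Longrightarrow> emb x (\<ominus> y) = - emb x y"
  using emb_right_add[of x "\<ominus> y" y] neg_left[of y] by (simp add: eq_neg_iff_add_eq_0)

lemma emb_alt [simp]: "x \<in> C \<Longrightarrow> emb x x = 0"
  by (simp add: Rep_emb nabla_alt Rep_circ_0 flip: Rep_circ_inject)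

lemma emb_anti: "x \<in> C \<Longrightarrow> y \<in> C \<Longrightarrow> emb y x = - emb x y"
  using emb_alt[of "x \<oplus> y"] by (simp add: eq_neg_iff_add_eq_0 add.commute)

lemma emb_eq_0_sym: "x \<in> C \<Longrightarrow> y \<in> C \<Longrightarrow> emb x y = 0 \<Longrightarrow> emb y x = 0"
  using emb_anti[of x y] by simp

lemma nabla_eq_1_iff: "x \<in> C \<Longrightarrow> nabla x y = 1 \<longleftrightarrow> emb x y = 0"
  by (simp add: Rep_emb Rep_circ_0 flip: Rep_circ_inject)

lemma emb_nondeg: "x \<in> C \<Longrightarrow> (\<And>y. y \<in> C \<Longrightarrow> emb x y = 0) \<Longrightarrow> x = \<zero>"
  using emb_inj[of x \<zero>] emb_eqI[of x 0] nabla_eq_1_iff by (auto simp: Rep_circ_0)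

lemma subgroupD:
  assumes "is_subgroup H L"
  shows "H \<subseteq> C" "\<zero> \<in> H" "x \<in> H \<Longrightarrow> y \<in> H \<Longrightarrow> x \<oplus> y \<in> H" "x \<in> H \<Longrightarrow> \<ominus> x \<in> H"
  using assms by (auto simp: is_subgroup_def)

text \<open>Because the form is alternating, adjoining to \<open>G\<close> an element orthogonal to
  it generates an isotropic subgroup, which equals \<open>G\<close> by maximality. Hence
  \<open>G\<close> is its own orthogonal.\<close>

lemma maximal_isotropic_perp:
  assumes "maximal_isotropic L nabla G" "x \<in> C" "\<And>g. g \<in> G \<Longrightarrow> nabla x g = 1"
  shows "x \<in> G"
proof -
  have iso: "is_subgroup G L" "\<And>x y. x \<in> G \<Longrightarrow> y \<in> G \<Longrightarrow> nabla x y = 1"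
    and max: "\<And>N. isotropic L nabla N \<Longrightarrow> G \<subseteq> N \<Longrightarrow> N = G"
    using assms(1) by (auto simp: maximal_isotropic_def isotropic_def)
  define N where "N = \<Inter> {H. is_subgroup H L \<and> insert x G \<subseteq> H}"
  have sgC: "is_subgroup C L" by (simp add: is_subgroup_def)
  have NC: "N \<subseteq> C" and gen: "insert x G \<subseteq> N"
    using sgC subgroupD(1)[OF iso(1)] assms(2) by (auto simp: N_def)
  have GC: "insert x G \<subseteq> C" using subgroupD(1)[OF iso(1)] assms(2) by auto
  have iso': "emb y z = 0" if yz: "y \<in> insert x G" "z \<in> insert x G" for y z
  proof -
    have "emb x g = 0" "emb g x = 0" if "g \<in> G" for g
      using assms(3)[OF that] nabla_eq_1_iff emb_anti[of x g] assms(2) that GC by auto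
    moreover have "emb y z = 0" if "y \<in> G" "z \<in> G" for y z
      using iso(2)[OF that] nabla_eq_1_iff[of y z] that GC by auto
    ultimately show ?thesis using yz assms(2) by auto
  qed
  \<comment> \<open>Orthogonality extends from the generators to \<open>N\<close> in one argument at
    a time, since orthogonals are subgroups; no description of the elements of \<open>N\<close> is
    needed.\<close>
  have "is_subgroup {y \<in> C. \<forall>z\<in>insert x G. emb y z = 0} L"
    using GC by (auto simp: is_subgroup_def)
  then have 1: "emb y z = 0" if "y \<in> N" "z \<in> insert x G" for y z
    using that iso' GC unfolding N_def by blast
  have 2: "emb y z = 0" if y: "y \<in> N" and z: "z \<in> N" for y z
  proof -
    have "is_subgroup {z \<in> C. emb y z = 0} L" using y NC by (auto simp: is_subgroup_def)
    moreover have "insert x G \<subseteq> {z \<in> C. emb y z = 0}" using 1[OF y] GC by blast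
    ultimately show ?thesis using z unfolding N_def by blast
  qed
  have "is_subgroup N L"
    using NC by (auto simp: is_subgroup_def N_def)
  then have "isotropic L nabla N" using 2 NC nabla_eq_1_iff by (auto simp: isotropic_def)
  then have "N = G" using max gen by blast
  then show ?thesis using gen by blast
qed

text \<open>Such a \<open>c\<close> is constant on the cosets of the open subgroup \<open>G\<close>,
  hence locally constant.\<close>

lemma trivial_on_open_continuous:
  assumes G: "openin X G" "is_subgroup G L"
    and c: "\<And>x. x \<in> C \<Longrightarrow> norm (c x) = 1" "\<And>x y. x \<in> C \<Longrightarrow> y \<in> C \<Longrightarrow> c (x \<oplus> y) = c x * c y"
    and triv: "\<And>g. g \<in> G \<Longrightarrow> c g = (1 :: complex)"
  shows "continuous_map X circle_top c"
  unfolding continuous_map_def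
proof (intro conjI allI impI)
  show "c \<in> topspace X \<rightarrow> topspace circle_top"
    using c(1) by (auto simp: topspace_X circle_top_def)
  fix U
  show "openin X {x \<in> topspace X. c x \<in> U}"
  proof (subst openin_subopen, intro ballI)
    fix x assume x: "x \<in> {x \<in> topspace X. c x \<in> U}"
    then have xC: "x \<in> C" by (simp add: topspace_X)
    let ?V = "{y \<in> topspace X. \<ominus> x \<oplus> y \<in> G}"
    have "continuous_map X X (\<lambda>y. \<ominus> x \<oplus> y)"
      using xC by (intro continuous_add_maps) (auto simp: topspace_X)
    then have "openin X ?V" using G(1) by (rule openin_continuous_map_preimage)
    moreover have "x \<in> ?V" using xC subgroupD(2)[OF G(2)] by (simp add: topspace_X neg_left)
    moreover have "?V \<subseteq> {x \<in> topspace X. c x \<in> U}"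
    proof
      fix y assume "y \<in> ?V"
      then have y: "y \<in> C" "\<ominus> x \<oplus> y \<in> G" by (auto simp: topspace_X)
      have "x \<oplus> (\<ominus> x \<oplus> y) = y" using xC y(1) by (simp flip: emb_inj)
      then have "c y = c x * c (\<ominus> x \<oplus> y)" using c(2)[OF xC, of "\<ominus> x \<oplus> y"] y(1) xC by simp
      then have "c y = c x" using triv[OF y(2)] by simp
      then show "y \<in> {x \<in> topspace X. c x \<in> U}" using x y(1) by (simp add: topspace_X)
    qed
    ultimately show "\<exists>T. openin X T \<and> x \<in> T \<and> T \<subseteq> {x \<in> topspace X. c x \<in> U}" by blast
  qed
qed

end

text \<open>The compatible splitting of \<open>G\<close> is a separate hypothesis: it makes the
  projections preserve a compact open subgroup, from which their continuity follows.\<close>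

locale split_self_dual_group = self_dual_group +
  fixes G A A' :: "'a set"
  assumes compact_G: "compactin X G" and open_G: "openin X G"
    and G_max: "maximal_isotropic L nabla G"
    and sgA: "is_subgroup A L" and sgA': "is_subgroup A' L"
    and isoA: "x \<in> A \<Longrightarrow> y \<in> A \<Longrightarrow> nabla x y = 1"
    and isoA': "x \<in> A' \<Longrightarrow> y \<in> A' \<Longrightarrow> nabla x y = 1"
    and C_sum: "x \<in> C \<Longrightarrow> \<exists>a\<in>A. \<exists>b\<in>A'. x = a \<oplus> b"
    and G_sum: "g \<in> G \<Longrightarrow> \<exists>a\<in>G \<inter> A. \<exists>b\<in>G \<inter> A'. g = a \<oplus> b"
begin

lemma sgG: "is_subgroup G L" and isoG: "x \<in> G \<Longrightarrow> y \<in> G \<Longrightarrow> nabla x y = 1"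
  using G_max by (auto simp: maximal_isotropic_def isotropic_def)

lemmas subA = subgroupD[OF sgA] and subA' = subgroupD[OF sgA'] and subG = subgroupD[OF sgG]

lemma AC: "a \<in> A \<Longrightarrow> a \<in> C" and A'C: "a \<in> A' \<Longrightarrow> a \<in> C" and GC: "a \<in> G \<Longrightarrow> a \<in> C"
  using subA(1) subA'(1) subG(1) by auto

lemma emb_A: "x \<in> A \<Longrightarrow> y \<in> A \<Longrightarrow> emb x y = 0" and emb_A': "x \<in> A' \<Longrightarrow> y \<in> A' \<Longrightarrow> emb x y = 0"
  using isoA isoA' nabla_eq_1_iff AC A'C by auto

lemma perp_both: "x \<in> C \<Longrightarrow> (\<And>a. a \<in> A \<Longrightarrow> emb x a = 0) \<Longrightarrow> (\<And>a. a \<in> A' \<Longrightarrow> emb x a = 0) \<Longrightarrow> x = \<zero>"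
proof (rule emb_nondeg)
  fix y assume *: "x \<in> C" "\<And>a. a \<in> A \<Longrightarrow> emb x a = 0" "\<And>a. a \<in> A' \<Longrightarrow> emb x a = 0" "y \<in> C"
  obtain a b where "a \<in> A" "b \<in> A'" "y = a \<oplus> b" using C_sum *(4) by blast
  then show "emb x y = 0" using * AC A'C by simp
qed

text \<open>The component of \<open>x\<close> in \<open>A'\<close> is orthogonal to both summands,
  hence zero. So \<open>A\<close> is its own orthogonal and thereby closed.\<close>

lemma A_perp:
  assumes "x \<in> C" "\<And>a. a \<in> A \<Longrightarrow> emb x a = 0" shows "x \<in> A"
proof -
  obtain a b where ab: "a \<in> A" "b \<in> A'" "x = a \<oplus> b" using C_sum assms(1) by blast
  have "b = \<zero>"
  proof (rule perp_both)
    show "emb b c = 0" if "c \<in> A" for c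
      using assms(2)[OF that] ab emb_A[OF ab(1) that] AC A'C by simp
  qed (use ab A'C emb_A' in auto)
  then show ?thesis using ab AC by (simp add: zero_right)
qed

lemma A'_perp:
  assumes "x \<in> C" "\<And>a. a \<in> A' \<Longrightarrow> emb x a = 0" shows "x \<in> A'"
proof -
  obtain a b where ab: "a \<in> A" "b \<in> A'" "x = a \<oplus> b" using C_sum assms(1) by blast
  have "a = \<zero>"
  proof (rule perp_both)
    show "emb a c = 0" if "c \<in> A'" for c
      using assms(2)[OF that] ab emb_A'[OF ab(2) that] AC A'C by simp
  qed (use ab AC emb_A in auto)
  then show ?thesis using ab A'C by (simp add: zero_left)
qed

lemma A_Int_A': "x \<in> A \<Longrightarrow> x \<in> A' \<Longrightarrow> x = \<zero>"
  using perp_both[of x] AC emb_A emb_A' by blast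

lemma closed_G: "closedin X G"
  using compactin_imp_closedin[OF Hausdorff compact_G] .

lemma closed_perp:
  assumes H: "\<zero> \<in> H" "H \<subseteq> C" and eq: "H = {x \<in> C. \<forall>a\<in>H. emb a x = 0}"
  shows "closedin X H"
proof -
  have "closedin X {x \<in> topspace X. nabla a x \<in> {1}}" if "a \<in> H" for a
    using nabla_continuous that H
    by (intro closedin_continuous_map_preimage[of X circle_top])
      (auto simp: circle_top_def closedin_subtopology)
  then have "closedin X (\<Inter>a\<in>H. {x \<in> topspace X. nabla a x \<in> {1}})"
    using H by (intro closedin_INT) auto
  also have "(\<Inter>a\<in>H. {x \<in> topspace X. nabla a x \<in> {1}}) = {x \<in> C. \<forall>a\<in>H. emb a x = 0}"
    using H nabla_eq_1_iff by (auto simp: topspace_X)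
  finally show ?thesis using eq by simp
qed

lemma closed_A: "closedin X A"
proof (rule closed_perp)
  show "A = {x \<in> C. \<forall>a\<in>A. emb a x = 0}"
    using AC emb_A A_perp emb_eq_0_sym[OF AC] by blast
qed (use subA in auto)

lemma closed_A': "closedin X A'"
proof (rule closed_perp)
  show "A' = {x \<in> C. \<forall>a\<in>A'. emb a x = 0}"
    using A'C emb_A' A'_perp emb_eq_0_sym[OF A'C] by blast
qed (use subA' in auto)

section \<open>Continuity of the projections\<close>

definition proj :: "'a \<Rightarrow> 'a" where
  "proj x = (SOME a. a \<in> A \<and> (\<exists>b\<in>A'. x = a \<oplus> b))"

lemma proj_eqI:
  assumes "a \<in> A" "b \<in> A'" shows "proj (a \<oplus> b) = a"
proof -
  have "proj (a \<oplus> b) \<in> A \<and> (\<exists>d\<in>A'. a \<oplus> b = proj (a \<oplus> b) \<oplus> d)"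
    unfolding proj_def using assms by (intro someI_ex[where P = "\<lambda>c. c \<in> A \<and> (\<exists>d\<in>A'. a \<oplus> b = c \<oplus> d)"]) blast
  then obtain c d where c: "proj (a \<oplus> b) = c" "c \<in> A" "d \<in> A'" "a \<oplus> b = c \<oplus> d" by blast
  have "emb (a \<oplus> b) = emb (c \<oplus> d)" using c(4) by simp
  then have "emb a + emb b = emb c + emb d" using assms c(2,3) AC A'C by simp
  then have "emb (a \<oplus> \<ominus> c) = emb (d \<oplus> \<ominus> b)"
    using assms c(2,3) AC A'C by (simp add: algebra_simps)
  then have "a \<oplus> \<ominus> c = d \<oplus> \<ominus> b" using assms c(2,3) AC A'C by (simp only: emb_inj carrier_closed)
  then have "a \<oplus> \<ominus> c = \<zero>"
    using A_Int_A' subA(3)[OF assms(1) subA(4)[OF c(2)]] subA'(3)[OF c(3) subA'(4)[OF assms(2)]] by simp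
  then have "emb (a \<oplus> \<ominus> c) = 0" by simp
  then have "emb a = emb c" using assms(1) c(2) AC by simp
  then show ?thesis using c assms AC emb_inj by simp
qed

definition coproj :: "'a \<Rightarrow> 'a" where "coproj x = x \<oplus> \<ominus> (proj x)"

lemma proj_coproj:
  assumes "x \<in> C"
  shows "proj x \<in> A" "coproj x \<in> A'" "x = proj x \<oplus> coproj x"
proof -
  obtain a b where ab: "a \<in> A" "b \<in> A'" "x = a \<oplus> b" using C_sum assms by blast
  then have p: "proj x = a" using proj_eqI by simp
  have "emb (a \<oplus> b \<oplus> \<ominus> a) = emb b" using ab(1,2) AC A'C by simp
  then have "a \<oplus> b \<oplus> \<ominus> a = b" using emb_inj[of "a \<oplus> b \<oplus> \<ominus> a" b] ab(1,2) AC A'C by simp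
  moreover have "coproj x = x \<oplus> \<ominus> a" by (simp add: coproj_def p)
  ultimately have c: "coproj x = b" using ab(3) by simp
  show "proj x \<in> A" "coproj x \<in> A'" "x = proj x \<oplus> coproj x" using ab p c by auto
qed

lemma proj_in_A: "x \<in> C \<Longrightarrow> proj x \<in> A" and coproj_in_A': "x \<in> C \<Longrightarrow> coproj x \<in> A'"
  using proj_coproj by auto

lemma proj_A: "a \<in> A \<Longrightarrow> proj a = a"
  using proj_eqI[of a \<zero>] subA'(2) AC by (simp add: zero_right)

lemma proj_A': "a \<in> A' \<Longrightarrow> proj a = \<zero>"
  using proj_eqI[of \<zero> a] subA(2) A'C by (simp add: zero_left)

lemma proj_add:
  assumes "x \<in> C" "y \<in> C" shows "proj (x \<oplus> y) = proj x \<oplus> proj y"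
proof -
  note px = proj_coproj[OF assms(1)] and py = proj_coproj[OF assms(2)]
  have in_C: "proj x \<in> C" "coproj x \<in> C" "proj y \<in> C" "coproj y \<in> C"
    using px(1,2) py(1,2) AC A'C by auto
  have "emb x = emb (proj x) + emb (coproj x)" "emb y = emb (proj y) + emb (coproj y)"
    using px(3) py(3) in_C by (metis emb_add)+
  then have "emb (x \<oplus> y) = emb ((proj x \<oplus> proj y) \<oplus> (coproj x \<oplus> coproj y))"
    using in_C assms by (simp add: algebra_simps)
  then have "x \<oplus> y = (proj x \<oplus> proj y) \<oplus> (coproj x \<oplus> coproj y)"
    using in_C assms by (simp only: emb_inj carrier_closed)
  then show ?thesis using proj_eqI subA(3)[OF px(1) py(1)] subA'(3)[OF px(2) py(2)] by simp
qed

lemma proj_G: "g \<in> G \<Longrightarrow> proj g \<in> G"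
  using G_sum proj_eqI by fastforce

text \<open>Within \<open>G\<close> the preimage is the image under addition of the compact set
  \<open>(G \<inter> A \<inter> K) \<times> (G \<inter> A')\<close>.\<close>

lemma closed_proj_preimage:
  assumes "closedin X K" shows "closedin X {g \<in> G. proj g \<in> K}"
proof -
  have "compactin X (G \<inter> A \<inter> K)" "compactin X (G \<inter> A')"
    using closed_G closed_A closed_A' assms by (auto intro!: closedin_Int closed_compactin[OF compact_G])
  then have "compactin (prod_topology X X) ((G \<inter> A \<inter> K) \<times> (G \<inter> A'))"
    by (simp add: compactin_Times)
  then have "compactin X ((\<lambda>(x, y). x \<oplus> y) ` ((G \<inter> A \<inter> K) \<times> (G \<inter> A')))"
    using continuous_add by (rule image_compactin)
  moreover have "(\<lambda>(x, y). x \<oplus> y) ` ((G \<inter> A \<inter> K) \<times> (G \<inter> A')) = {g \<in> G. proj g \<in> K}"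
  proof (intro set_eqI iffI)
    fix g assume "g \<in> {g \<in> G. proj g \<in> K}"
    then obtain a b where "a \<in> G \<inter> A" "b \<in> G \<inter> A'" "g = a \<oplus> b" "proj g \<in> K" using G_sum by blast
    moreover from this have "a \<in> K" using proj_eqI[of a b] by auto
    ultimately show "g \<in> (\<lambda>(x, y). x \<oplus> y) ` ((G \<inter> A \<inter> K) \<times> (G \<inter> A'))" by force
  qed (use proj_eqI subG in auto)
  ultimately show ?thesis using compactin_imp_closedin[OF Hausdorff] by simp
qed

lemma open_proj_preimage:
  assumes "openin X U" shows "openin X {g \<in> G. proj g \<in> U}"
proof -
  have "closedin X {g \<in> G. proj g \<in> topspace X - U}"
    using assms by (intro closed_proj_preimage) blast
  then have "openin X (G - {g \<in> G. proj g \<in> topspace X - U})"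
    using open_G by (rule_tac openin_diff)
  moreover have "G - {g \<in> G. proj g \<in> topspace X - U} = {g \<in> G. proj g \<in> U}"
    using GC proj_in_A AC by (auto simp: topspace_X)
  ultimately show ?thesis by simp
qed

text \<open>On the open subgroup \<open>G\<close> preimages of open sets are open by
  \<open>open_proj_preimage\<close>; additivity carries this to every point by translation.\<close>

lemma continuous_proj: "continuous_map X X proj"
  unfolding continuous_map_def
proof (intro conjI allI impI)
  show "proj \<in> topspace X \<rightarrow> topspace X" using proj_in_A AC by (auto simp: topspace_X)
  fix U assume U: "openin X U"
  show "openin X {x \<in> topspace X. proj x \<in> U}"
  proof (subst openin_subopen, intro ballI)
    fix x assume x: "x \<in> {x \<in> topspace X. proj x \<in> U}"
    then have xC: "x \<in> C" "proj x \<in> C" using proj_in_A AC by (auto simp: topspace_X)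
    define W where "W = {w \<in> topspace X. proj x \<oplus> w \<in> U}"
    have translate: "continuous_map X X (\<lambda>w. y \<oplus> w)" if "y \<in> C" for y
      using that by (intro continuous_add_maps) (auto simp: topspace_X)
    have "openin X W" unfolding W_def
      using openin_continuous_map_preimage[OF translate[OF xC(2)] U] .
    define V where "V = {y \<in> topspace X. \<ominus> x \<oplus> y \<in> {g \<in> G. proj g \<in> W}}"
    have "openin X V" unfolding V_def
      using openin_continuous_map_preimage[OF translate open_proj_preimage[OF \<open>openin X W\<close>]] xC by simp
    moreover have "x \<in> V"
      using xC x subG(2) subA(2) proj_A[of \<zero>] by (auto simp: V_def W_def topspace_X neg_left commute[of _ \<zero>] zero_left)
    moreover have "V \<subseteq> {x \<in> topspace X. proj x \<in> U}"
    proof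
      fix y assume "y \<in> V"
      then have y: "y \<in> C" "proj x \<oplus> proj (\<ominus> x \<oplus> y) \<in> U"
        by (auto simp: V_def W_def topspace_X)
      have "x \<oplus> (\<ominus> x \<oplus> y) = y" using xC y(1) by (simp flip: emb_inj)
      then have "proj y = proj x \<oplus> proj (\<ominus> x \<oplus> y)"
        using proj_add[of x "\<ominus> x \<oplus> y"] xC(1) y(1) by simp
      then show "y \<in> {x \<in> topspace X. proj x \<in> U}" using y by (simp add: topspace_X)
    qed
    ultimately show "\<exists>T. openin X T \<and> x \<in> T \<and> T \<subseteq> {x \<in> topspace X. proj x \<in> U}" by blast
  qed
qed

lemma continuous_coproj: "continuous_map X X coproj"
  unfolding coproj_def by (intro continuous_add_maps continuous_neg_map continuous_proj continuous_map_id[unfolded id_def])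

abbreviation "SA \<equiv> sub_tgroup L A"

lemma SA_simps [simp]:
  "tg_carrier SA = A" "tg_add SA = tg_add L" "tg_zero SA = \<zero>" "tg_neg SA = tg_neg L"
  "tg_top SA = subtopology X A"
  by (simp_all add: sub_tgroup_def)

lemma topspace_SA: "topspace (subtopology X A) = A"
  using AC by (auto simp: topspace_X)

lemma LCA_SA: "LCA SA"
proof -
  have "continuous_map (prod_topology (subtopology X A) (subtopology X A)) (subtopology X A) (\<lambda>(x, y). x \<oplus> y)"
    using continuous_add subA(3)
    by (auto simp: continuous_map_in_subtopology continuous_map_from_subtopology topspace_X
        simp flip: subtopology_Times)
  moreover have "continuous_map (subtopology X A) (subtopology X A) (tg_neg L)"
    using continuous_neg subA(4)
    by (auto simp: continuous_map_in_subtopology continuous_map_from_subtopology topspace_X)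
  ultimately have "abelian_tgroup SA"
    using subA AC topspace_SA by (auto simp: abelian_tgroup_def Let_def assoc zero_left neg_left intro: commute)
  then show ?thesis
    using Hausdorff_space_subtopology[OF Hausdorff] locally_compact_space_closed_subset[OF loc_compact closed_A]
    by (simp add: LCA_def)
qed

section \<open>The second summand as the dual of the first\<close>

definition ext_char :: "('a \<Rightarrow> complex) \<Rightarrow> 'a \<Rightarrow> complex" where
  "ext_char c x = (if x \<in> C then c (proj x) else 1)"

lemma continuous_proj_SA: "continuous_map X (subtopology X A) proj"
  using continuous_proj proj_in_A by (auto simp: continuous_map_in_subtopology topspace_X)

lemma ext_char_character:
  assumes "c \<in> characters SA" shows "ext_char c \<in> characters L"
proof -
  have "continuous_map X circle_top (c \<circ> proj)"
    using assms continuous_proj_SA by (auto simp: characters_def intro: continuous_map_compose)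
  then have "continuous_map X circle_top (ext_char c)"
    by (rule continuous_map_eq) (simp add: ext_char_def topspace_X)
  then show ?thesis
    using assms proj_add proj_in_A by (auto simp: characters_def ext_char_def)
qed

definition elt :: "('a \<Rightarrow> complex) \<Rightarrow> 'a" where "elt c = inv_into C nabla (ext_char c)"

text \<open>The extended character is trivial on \<open>A'\<close>, so the element that represents
  it is orthogonal to \<open>A'\<close> and therefore belongs to it.\<close>

lemma elt:
  assumes "c \<in> characters SA"
  shows "elt c \<in> A'" "nabla (elt c) = ext_char c"
proof -
  have "ext_char c \<in> nabla ` C" using ext_char_character[OF assms] nabla_surj by simp
  then have e: "elt c \<in> C" "nabla (elt c) = ext_char c"
    unfolding elt_def by (auto intro: inv_into_into f_inv_into_f)
  have "c (\<zero> \<oplus> \<zero>) = c \<zero> * c \<zero>" "norm (c \<zero>) = 1"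
    using assms subA ext_char_character[OF assms] character_norm[of "ext_char c" \<zero>] proj_A[of \<zero>]
    by (auto simp: characters_def ext_char_def)
  then have "c \<zero> = 1" using zero_left[of \<zero>] by auto
  then have "emb (elt c) a = 0" if "a \<in> A'" for a
    using nabla_eq_1_iff[OF e(1), of a] e(2) that A'C proj_A' by (simp add: ext_char_def)
  then show "elt c \<in> A'" using A'_perp e by blast
  show "nabla (elt c) = ext_char c" by fact
qed

text \<open>The map \<open>elt\<close> is \<open>ext_char\<close> followed by the inverse of
  \<open>nabla\<close>. The former is continuous for the compact-open topologies because
  \<open>proj\<close> sends compact sets to compact sets.\<close>

lemma continuous_elt: "continuous_map (tg_top (dual SA)) X elt"
proof -
  have "continuous_map (tg_top (dual SA)) (tg_top (dual L)) ext_char"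
  proof (rule continuous_map_dual)
    show "ext_char c \<in> characters L" if "c \<in> topspace (tg_top (dual SA))" for c
      using that ext_char_character by (simp add: topspace_dual)
    fix K and U :: "complex set" assume K: "compactin X K" and U: "open U"
    have "compactin (tg_top SA) (proj ` K)" using image_compactin[OF K continuous_proj_SA] by simp
    then have "openin (tg_top (dual SA)) {c \<in> characters SA. c ` proj ` K \<subseteq> U}"
      using U by (rule openin_dual_basic)
    moreover have "{c \<in> topspace (tg_top (dual SA)). ext_char c ` K \<subseteq> U} = {c \<in> characters SA. c ` proj ` K \<subseteq> U}"
      using compactin_subset_topspace[OF K] by (auto simp: topspace_dual topspace_X ext_char_def)
    ultimately show "openin (tg_top (dual SA)) {c \<in> topspace (tg_top (dual SA)). ext_char c ` K \<subseteq> U}" by simp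
  qed
  moreover obtain g where g: "homeomorphic_maps X (tg_top (dual L)) nabla g"
    using nabla_homeo homeomorphic_map_maps by blast
  then have "continuous_map (tg_top (dual L)) X g" by (simp add: homeomorphic_maps_def)
  ultimately have "continuous_map (tg_top (dual SA)) X (g \<circ> ext_char)" by (rule continuous_map_compose)
  then show ?thesis
  proof (rule continuous_map_eq)
    fix c assume "c \<in> topspace (tg_top (dual SA))"
    then have c: "c \<in> characters SA" by (simp add: topspace_dual)
    have "g (nabla (elt c)) = elt c"
      using g elt(1)[OF c] A'C by (simp add: homeomorphic_maps_def topspace_X)
    then show "(g \<circ> ext_char) c = elt c" using elt(2)[OF c] by simp
  qed
qed

definition res_char :: "('a \<Rightarrow> complex) \<Rightarrow> 'a \<Rightarrow> complex" where
  "res_char c x = (if x \<in> A then c x else 1)"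

lemma res_char_character:
  assumes "c \<in> characters L" shows "res_char c \<in> characters SA"
proof -
  have "continuous_map (subtopology X A) circle_top c"
    using assms by (auto simp: characters_def intro: continuous_map_from_subtopology)
  then have "continuous_map (subtopology X A) circle_top (res_char c)"
    by (rule continuous_map_eq) (simp add: res_char_def)
  then show ?thesis using assms subA AC by (auto simp: characters_def res_char_def)
qed

lemma continuous_res_char: "continuous_map (tg_top (dual L)) (tg_top (dual SA)) res_char"
proof (rule continuous_map_dual)
  show "res_char c \<in> characters SA" if "c \<in> topspace (tg_top (dual L))" for c
    using that res_char_character by (simp add: topspace_dual)
  fix K and U :: "complex set" assume K: "compactin (tg_top SA) K" and U: "open U"
  then have "compactin X K" "K \<subseteq> A" by (auto simp: compactin_subtopology)
  moreover from this have "{c \<in> topspace (tg_top (dual L)). res_char c ` K \<subseteq> U} = {c \<in> characters L. c ` K \<subseteq> U}"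
    by (auto simp: topspace_dual res_char_def)
  ultimately show "openin (tg_top (dual L)) {c \<in> topspace (tg_top (dual L)). res_char c ` K \<subseteq> U}"
    using U by (simp add: openin_dual_basic)
qed

text \<open>For \<open>b\<close> in \<open>A'\<close> the character \<open>nabla b\<close> is
  trivial on \<open>A'\<close>, so its restriction to \<open>A\<close> determines it.\<close>

lemma elt_res: assumes "b \<in> A'" shows "elt (res_char (nabla b)) = b"
proof -
  have bC: "b \<in> C" using assms by (rule A'C)
  have c: "res_char (nabla b) \<in> characters SA" using res_char_character nabla_character bC by blast
  have "nabla (elt (res_char (nabla b))) y = nabla b y" for y
  proof (cases "y \<in> C")
    case True
    note p = proj_coproj[OF True]
    have "nabla b y = nabla b (proj y) * nabla b (coproj y)"
      using p bC AC A'C nabla_add_right[of b "proj y" "coproj y"] by simp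
    then show ?thesis using elt(2)[OF c] True p isoA'[OF assms] by (simp add: ext_char_def res_char_def)
  qed (use elt(2)[OF c] bC nabla_outside in \<open>auto simp: ext_char_def\<close>)
  then show ?thesis using inj_onD[OF nabla_inj] elt(1)[OF c] bC A'C by blast
qed

lemma res_elt: assumes "c \<in> characters SA" shows "res_char (nabla (elt c)) = c"
  using assms elt(2)[OF assms] AC proj_A by (auto simp: res_char_def ext_char_def characters_def)

lemma elt_mult:
  assumes "c \<in> characters SA" "d \<in> characters SA"
  shows "elt (\<lambda>x. c x * d x) = elt c \<oplus> elt d"
proof -
  have m: "res_char (nabla (elt c \<oplus> elt d)) = (\<lambda>x. c x * d x)"
  proof
    fix x
    show "res_char (nabla (elt c \<oplus> elt d)) x = c x * d x"
      using fun_cong[OF res_elt[OF assms(1)], of x] fun_cong[OF res_elt[OF assms(2)], of x]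
        elt(1)[OF assms(1)] elt(1)[OF assms(2)] A'C
      by (auto simp: res_char_def nabla_add split: if_splits)
  qed
  show ?thesis
    using elt_res[of "elt c \<oplus> elt d"] subA'(3) elt(1)[OF assms(1)] elt(1)[OF assms(2)] unfolding m by simp
qed

lemma standard: "standard_triple L nabla G"
proof -
  define \<phi> where "\<phi> u = fst u \<oplus> elt (snd u)" for u
  define \<psi> where "\<psi> x = (proj x, res_char (nabla (coproj x)))" for x
  let ?P = "prod_tgroup SA (dual SA)"
  have P: "tg_carrier ?P = A \<times> characters SA" "tg_top ?P = prod_topology (subtopology X A) (tg_top (dual SA))"
    by (simp_all add: prod_tgroup_def dual_def)
  have \<phi>\<psi>: "\<phi> (\<psi> x) = x" if "x \<in> C" for x
    using proj_coproj[OF that] elt_res by (simp add: \<phi>_def \<psi>_def)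
  have \<psi>\<phi>: "\<psi> (\<phi> (a, c)) = (a, c)" if a: "a \<in> A" and c: "c \<in> characters SA" for a c
  proof -
    have p: "proj (a \<oplus> elt c) = a" using proj_eqI a elt(1)[OF c] by blast
    have in_C: "a \<in> C" "elt c \<in> C" using a elt(1)[OF c] AC A'C by auto
    have "coproj (a \<oplus> elt c) = elt c" unfolding coproj_def p using in_C by (simp flip: emb_inj)
    then show ?thesis using p res_elt[OF c] by (simp add: \<phi>_def \<psi>_def)
  qed
  have "homeomorphic_maps (tg_top ?P) X \<phi> \<psi>"
    unfolding homeomorphic_maps_def P
  proof (intro conjI ballI)
    show "continuous_map (prod_topology (subtopology X A) (tg_top (dual SA))) X \<phi>"
      unfolding \<phi>_def
    proof (rule continuous_add_maps)
      show "continuous_map (prod_topology (subtopology X A) (tg_top (dual SA))) X fst"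
        using continuous_map_fst continuous_map_in_subtopology by blast
      show "continuous_map (prod_topology (subtopology X A) (tg_top (dual SA))) X (\<lambda>u. elt (snd u))"
        using continuous_map_compose[OF continuous_map_snd continuous_elt] by (simp add: o_def)
    qed
    have "continuous_map X (tg_top (dual SA)) (res_char \<circ> (nabla \<circ> coproj))"
      using continuous_coproj homeomorphic_imp_continuous_map[OF nabla_homeo] continuous_res_char
      by (intro continuous_map_compose)
    then show "continuous_map X (prod_topology (subtopology X A) (tg_top (dual SA))) \<psi>"
      unfolding \<psi>_def using continuous_proj_SA by (simp add: continuous_map_paired o_def)
  qed (use \<phi>\<psi> \<psi>\<phi> in \<open>auto simp: topspace_X topspace_dual AC\<close>)
  then have homeo: "homeomorphic_map (tg_top ?P) X \<phi>" using homeomorphic_map_maps by blast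
  moreover have topP: "topspace (tg_top ?P) = tg_carrier ?P"
    using AC by (auto simp: P topspace_dual topspace_X)
  ultimately have bij: "bij_betw \<phi> (tg_carrier ?P) C"
    by (auto simp: bij_betw_def homeomorphic_eq_everything_map topspace_X)
  have hom: "tg_hom ?P L \<phi>"
    unfolding tg_hom_def
  proof (intro conjI ballI)
    show "\<phi> ` tg_carrier ?P \<subseteq> C" using bij by (auto simp: bij_betw_def)
    fix u v assume "u \<in> tg_carrier ?P" "v \<in> tg_carrier ?P"
    then obtain a c a' c' where uv: "u = (a, c)" "v = (a', c')" "a \<in> A" "a' \<in> A"
      "c \<in> characters SA" "c' \<in> characters SA" by (auto simp: P)
    have in_C: "a \<in> C" "a' \<in> C" "elt c \<in> C" "elt c' \<in> C" 
      using AC[OF uv(3)] AC[OF uv(4)] A'C[OF elt(1)[OF uv(5)]] A'C[OF elt(1)[OF uv(6)]] by simp_all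
    have "(a \<oplus> a') \<oplus> (elt c \<oplus> elt c') = (a \<oplus> elt c) \<oplus> (a' \<oplus> elt c')"
      using in_C by (intro iffD1[OF emb_inj]) (simp_all add: algebra_simps)
    then show "\<phi> (tg_add ?P u v) = \<phi> u \<oplus> \<phi> v"
      using uv elt_mult by (simp add: \<phi>_def prod_tgroup_def dual_def)
  qed
  have form: "nabla (\<phi> u) (\<phi> v) = nabla0 u v" if uv0: "u \<in> tg_carrier ?P" "v \<in> tg_carrier ?P" for u v
  proof -
    obtain a c a' c' where uv: "u = (a, c)" "v = (a', c')" "a \<in> A" "a' \<in> A"
      "c \<in> characters SA" "c' \<in> characters SA" using uv0 by (auto simp: P)
    have in_C: "a \<in> C" "a' \<in> C" "elt c \<in> C" "elt c' \<in> C" 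
      using AC[OF uv(3)] AC[OF uv(4)] A'C[OF elt(1)[OF uv(5)]] A'C[OF elt(1)[OF uv(6)]] by simp_all
    \<comment> \<open>Antisymmetry produces the conjugate, that is the minus sign, in the second
      factor of \<open>nabla0\<close>.\<close>
    have "emb a (elt c') = - emb (elt c') a" using in_C by (intro emb_anti)
    then have "nabla a (elt c') = cnj (nabla (elt c') a)"
      using Rep_emb[OF in_C(1), of "elt c'"] Rep_emb[OF in_C(4), of a] by (simp add: Rep_circ_uminus)
    moreover have "nabla (elt c') a = c' a" "nabla (elt c) a' = c a'"
      using elt(2) uv AC proj_A by (auto simp: ext_char_def)
    moreover have "nabla a a' = 1" "nabla (elt c) (elt c') = 1" using isoA isoA' uv elt(1) by auto
    ultimately show ?thesis
      using in_C uv by (simp add: \<phi>_def nabla0_def nabla_add nabla_add_right)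
  qed
  \<comment> \<open>The subgroup of \<open>A\<close> is \<open>G \<inter> A\<close>. Since
    \<open>proj\<close> maps \<open>G\<close> into \<open>G \<inter> A\<close>, a character trivial
    there extends to one trivial on \<open>G\<close>, and its representative lies in
    \<open>G\<close>, the orthogonal of \<open>G\<close>.\<close>
  have image: "\<phi> ` ((G \<inter> A) \<times> annihilator SA (G \<inter> A)) = G"
  proof (intro set_eqI iffI)
    fix g assume "g \<in> \<phi> ` ((G \<inter> A) \<times> annihilator SA (G \<inter> A))"
    then obtain a c where ac: "a \<in> G" "a \<in> A" "c \<in> characters SA" "\<forall>b\<in>G \<inter> A. c b = 1" "g = a \<oplus> elt c"
      by (auto simp: annihilator_def \<phi>_def)
    have "nabla (elt c) h = 1" if "h \<in> G" for h
    proof -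
      have "proj h \<in> G \<inter> A" using proj_G proj_in_A that GC by auto
      then show ?thesis using elt(2)[OF ac(3)] ac(4) that GC by (simp add: ext_char_def)
    qed
    then have "elt c \<in> G"
      using maximal_isotropic_perp[OF G_max] elt(1)[OF ac(3)] A'C by blast
    then show "g \<in> G" using ac subG by simp
  next
    fix g assume "g \<in> G"
    then obtain a b where ab: "a \<in> G \<inter> A" "b \<in> G \<inter> A'" "g = a \<oplus> b" using G_sum by blast
    have "res_char (nabla b) \<in> annihilator SA (G \<inter> A)"
      using ab res_char_character nabla_character A'C isoG by (auto simp: annihilator_def res_char_def)
    moreover have "\<phi> (a, res_char (nabla b)) = g" using ab elt_res by (simp add: \<phi>_def)
    ultimately show "g \<in> \<phi> ` ((G \<inter> A) \<times> annihilator SA (G \<inter> A))" using ab by force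
  qed
  have "is_subgroup (G \<inter> A) SA" using subG subA by (auto simp: is_subgroup_def)
  moreover have "closedin (tg_top SA) (G \<inter> A)" using closed_G by (auto simp: closedin_subtopology)
  ultimately show ?thesis
    unfolding standard_triple_def tg_iso_def using LCA_SA hom bij homeo form image by blast
qed

end

section \<open>The theorem\<close>

text \<open>No small subgroups: \<open>1 - Re (w\<^sup>2) \<ge> 2 (1 - Re w)\<close> whenever \<open>Re w > 0\<close>, so the distance to \<open>1\<close> keeps doubling.\<close>

lemma unit_circle_Re_power:
  fixes w :: complex
  assumes "norm w = 1" "w \<noteq> 1"
  shows "\<exists>k. Re (w ^ k) \<le> 0"
proof (rule ccontr)
  assume "\<not> ?thesis"
  then have pos: "Re (w ^ k) > 0" for k by (simp add: not_le)
  have grow: "1 - Re (w ^ (2 ^ j)) \<ge> 2 ^ j * (1 - Re w)" for j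
  proof (induction j)
    case (Suc j)
    let ?v = "w ^ (2 ^ j)"
    have sq: "(Re ?v)\<^sup>2 + (Im ?v)\<^sup>2 = 1"
      using assms(1) by (metis cmod_power2 norm_power power_one)
    have v: "Re ?v \<le> 1" using complex_Re_le_cmod[of ?v] assms(1) by (simp add: norm_power)
    have "w ^ (2 ^ Suc j) = ?v * ?v" by (simp add: mult_2 power_add)
    then have "1 - Re (w ^ (2 ^ Suc j)) = 2 * (1 - Re ?v) * (1 + Re ?v)"
      using sq by (simp add: power2_eq_square algebra_simps)
    also have "\<dots> \<ge> 2 * (1 - Re ?v)"
      using mult_left_mono[of 1 "1 + Re ?v" "2 * (1 - Re ?v)"] pos[of "2 ^ j"] v by simp
    finally show ?case using Suc by simp
  qed simp
  have "Re w \<noteq> 1"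
  proof
    assume "Re w = 1"
    then have "Im w = 0" using assms(1) by (metis cmod_eq_Re norm_one cmod_power2 add_cancel_right_right one_power2 power_eq_0_iff)
    then show False using \<open>Re w = 1\<close> assms(2) by (simp add: complex_eq_iff)
  qed
  then have "Re w < 1" using complex_Re_le_cmod[of w] assms(1) by simp
  then obtain j where "1 / (1 - Re w) < 2 ^ j"
    using real_arch_pow[of 2 "1 / (1 - Re w)"] by auto
  then have "1 < 2 ^ j * (1 - Re w)" using \<open>Re w < 1\<close> by (simp add: field_simps)
  then show False using grow[of j] pos[of "2 ^ j"] by simp
qed

section \<open>Torsion of \<open>L\<close> modulo \<open>G\<close>\<close>

context self_dual_group
begin

definition mult :: "nat \<Rightarrow> 'a \<Rightarrow> 'a" where
  "mult k x = ((\<oplus>) x ^^ k) \<zero>"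

lemma mult_simps [simp]: "mult 0 x = \<zero>" "mult (Suc k) x = x \<oplus> mult k x"
  by (simp_all add: mult_def)

lemma mult_in: "is_subgroup H L \<Longrightarrow> x \<in> H \<Longrightarrow> mult k x \<in> H"
  by (induction k) (auto simp: subgroupD)

lemma mult_closed [simp]: "x \<in> C \<Longrightarrow> mult k x \<in> C"
  by (induction k) auto

lemma emb_mult [simp]: "x \<in> C \<Longrightarrow> emb (mult k x) = nmul k (emb x)"
  by (induction k) auto

lemma continuous_mult: "continuous_map X X (mult k)"
proof (induction k)
  case 0
  then show ?case by (simp add: topspace_X)
next
  case (Suc k)
  then show ?case using continuous_add_maps[OF continuous_map_id Suc] by (simp add: id_def)
qed

lemma nabla_mult: "x \<in> C \<Longrightarrow> g \<in> C \<Longrightarrow> nabla x (mult k g) = nabla x g ^ k"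
  using nabla_eq_1_iff[of x \<zero>] by (induction k) (auto simp: nabla_add_right)

text \<open>If the character stayed non-trivial on every \<open>p ^ n G\<close>, the closed sets
  \<open>K n\<close>, where its real part is at most 0, would be non-empty and nested in the compact
  \<open>G\<close>. A common point is infinitely divisible by \<open>p\<close>, hence zero, where
  the value is 1.\<close>

lemma character_kills_power:
  assumes G: "compactin X G" "is_subgroup G L" and x: "x \<in> C"
    and sep: "\<And>g. g \<in> G \<Longrightarrow> (\<And>n. \<exists>h\<in>G. g = mult (p ^ n) h) \<Longrightarrow> g = \<zero>"
  shows "\<exists>n. \<forall>g\<in>G. nabla x (mult (p ^ n) g) = 1"
proof (rule ccontr)
  assume neg: "\<not> ?thesis"
  note sub = subgroupD[OF G(2)]
  define K where "K n = mult (p ^ n) ` G \<inter> {y \<in> topspace X. nabla x y \<in> {w \<in> sphere 0 1. Re w \<le> 0}}" for n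
  have KG: "K n \<subseteq> G" for n using mult_in[OF G(2)] by (auto simp: K_def)
  have "closedin circle_top {w \<in> sphere 0 1. Re w \<le> 0}"
  proof -
    have "closed {w. Re w \<le> 0}" by (simp add: closed_halfspace_Re_le)
    moreover have "{w \<in> sphere 0 1. Re w \<le> 0} = sphere 0 1 \<inter> {w. Re w \<le> 0}" by auto
    ultimately show ?thesis unfolding circle_top_def by (simp add: closedin_closed_Int)
  qed
  then have "closedin X {y \<in> topspace X. nabla x y \<in> {w \<in> sphere 0 1. Re w \<le> 0}}"
    by (rule closedin_continuous_map_preimage[OF nabla_continuous[OF x]])
  moreover have "closedin X (mult (p ^ n) ` G)" for n
    using compactin_imp_closedin[OF Hausdorff image_compactin[OF G(1) continuous_mult]] .
  ultimately have "closedin X (K n)" for n unfolding K_def by (rule_tac closedin_Int)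
  then have closed: "closedin (subtopology X G) (K n)" for n
    using KG by (metis closedin_closed_subtopology closedin_subtopology inf.absorb1)
  \<comment> \<open>A value different from 1 has a power with non-positive real part, and powers of
    the value come from multiples, which stay in the image of \<open>mult (p ^ n)\<close>.\<close>
  have nonempty: "K n \<noteq> {}" for n
  proof -
    obtain g where g: "g \<in> G" "nabla x (mult (p ^ n) g) \<noteq> 1" using neg by blast
    have gC: "g \<in> C" using g sub(1) by blast
    obtain k where k: "Re (nabla x (mult (p ^ n) g) ^ k) \<le> 0"
      using unit_circle_Re_power[OF nabla_norm[OF x] g(2)] by blast
    have "nabla x (mult (p ^ n) g) ^ k = nabla x (mult (p ^ n) (mult k g))"
      using x gC by (simp add: nabla_mult power_mult[symmetric] mult.commute)
    then have "Re (nabla x (mult (p ^ n) (mult k g))) \<le> 0" using k by simp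
    then have "mult (p ^ n) (mult k g) \<in> K n"
      using mult_in[OF G(2) g(1)] gC nabla_norm[OF x] by (auto simp: K_def topspace_X)
    then show ?thesis by blast
  qed
  have "mult (p ^ Suc n) ` G \<subseteq> mult (p ^ n) ` G" for n
  proof
    fix y assume "y \<in> mult (p ^ Suc n) ` G"
    then obtain g where g: "g \<in> G" "y = mult (p ^ Suc n) g" by blast
    have gC: "g \<in> C" using g sub(1) by blast
    have "mult (p ^ Suc n) g = mult (p ^ n) (mult p g)"
    proof (rule iffD1[OF emb_inj])
      show "emb (mult (p ^ Suc n) g) = emb (mult (p ^ n) (mult p g))"
        using gC nmul_power_Suc[of p n "emb g"] by simp
    qed (use gC in simp_all)
    then have "y = mult (p ^ n) (mult p g)" using g(2) by simp
    then show "y \<in> mult (p ^ n) ` G" using mult_in[OF G(2) g(1)] by blast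
  qed
  then have "decseq K" by (intro decseq_SucI) (auto simp: K_def)
  then have "(\<Inter>n. K n) \<noteq> {}"
    using compact_space_imp_nest[of "subtopology X G" K] closed nonempty G(1)
    by (simp add: compact_space_subtopology)
  then obtain g where g: "\<And>n. g \<in> K n" by blast
  have "\<exists>h\<in>G. g = mult (p ^ n) h" for n using g[of n] by (auto simp: K_def)
  then have "g = \<zero>" using sep KG g by blast
  moreover have "Re (nabla x g) \<le> 0" using g by (auto simp: K_def)
  ultimately show False using nabla_eq_1_iff[of x \<zero>] x by simp
qed

lemma emb_pullback:
  assumes "subgrp H" "H \<subseteq> emb ` C"
  shows "is_subgroup {x \<in> C. emb x \<in> H} L"
  using assms subgrp_rules[OF assms(1)] by (auto simp: is_subgroup_def)

end

theorem theorem10p9: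
  fixes L :: "'a tgroup" and nabla :: "'a \<Rightarrow> 'a \<Rightarrow> complex" and G :: "'a set"
    and p :: nat and l :: nat
  assumes "LCA L"
    and "symplectic_self_duality L nabla"
    and "compactin (tg_top L) G" and "openin (tg_top L) G"
    and "maximal_isotropic L nabla G"
    and "prime p" and "odd p" and "0 < l"
    and "tg_isomorphic (sub_tgroup L G) (Zp_pow p l)"
  shows "standard_triple L nabla G"
proof -
  interpret self_dual_group L nabla using assms(1,2) by unfold_locales
  have sgG: "is_subgroup G L" and isoG: "\<And>x y. x \<in> G \<Longrightarrow> y \<in> G \<Longrightarrow> nabla x y = 1"
    using assms(5) by (auto simp: maximal_isotropic_def isotropic_def)
  note sub = subgroupD[OF sgG]
  have GC: "x \<in> C" if "x \<in> G" for x using sub(1) that by blast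
  define iv where "iv = inv_into C emb"
  have iv: "iv (emb x) = x" if "x \<in> C" for x
    unfolding iv_def using that emb_inj by (intro inv_into_f_f) (auto simp: inj_on_def)
  obtain f where f: "tg_iso (sub_tgroup L G) (Zp_pow p l) f" using assms(9) by (auto simp: tg_isomorphic_def)
  define Z where "Z = {x :: nat \<Rightarrow> int. \<forall>n. 0 \<le> x n \<and> x n < int p ^ n \<and> x n = x (Suc n) mod int p ^ n}"
  have carrier_Z: "tg_carrier (Zp p) = Z" by (simp add: Zp_def Z_def Let_def)
  have f_bij: "bij_betw f G (PiE {..<l} (\<lambda>_. Z))"
    using f by (simp add: tg_iso_def sub_tgroup_def Zp_pow_def carrier_Z)
  have f_add: "f (x \<oplus> y) i n = (f x i n + f y i n) mod int p ^ n" if "x \<in> G" "y \<in> G" "i < l" for x y i n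
    using f that by (simp add: tg_iso_def tg_hom_def sub_tgroup_def Zp_pow_def Zp_def Let_def)
  have f_Z: "0 \<le> f x i n \<and> f x i n < int p ^ n" "f x i n = f x i (Suc n) mod int p ^ n"
    if "x \<in> G" "i < l" for x i n
  proof -
    have "f x i \<in> Z" using f_bij that by (auto simp: bij_betw_def)
    then show "0 \<le> f x i n \<and> f x i n < int p ^ n" "f x i n = f x i (Suc n) mod int p ^ n"
      unfolding Z_def by blast+
  qed
  have f_inj: "x = y" if "x \<in> G" "y \<in> G" "\<And>i n. i < l \<Longrightarrow> f x i n = f y i n" for x y
  proof -
    have "f x \<in> PiE {..<l} (\<lambda>_. Z)" "f y \<in> PiE {..<l} (\<lambda>_. Z)"
      using f_bij that by (auto simp: bij_betw_def)
    then have "f x = f y" using that(3) by (intro PiE_ext[of "f x" _ _ "f y"]) auto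
    then show ?thesis using f_bij that by (auto simp: bij_betw_def inj_on_def)
  qed
  define G' where "G' = emb ` G"
  define L' where "L' = emb ` C"
  have sgL': "subgrp L'"
    unfolding L'_def
  proof (rule subgrpI)
    show "0 \<in> emb ` C" using emb_zero carrier_closed(1) by (metis image_eqI)
    show "a - b \<in> emb ` C" if ab: "a \<in> emb ` C" "b \<in> emb ` C" for a b
    proof -
      obtain x y where "x \<in> C" "y \<in> C" "a = emb x" "b = emb y" using ab by blast
      then have "a - b = emb (x \<oplus> \<ominus> y)" "x \<oplus> \<ominus> y \<in> C" by simp_all
      then show ?thesis by blast
    qed
  qed
  have sgG': "subgrp G'"
    unfolding G'_def
  proof (rule subgrpI)
    show "0 \<in> emb ` G" using emb_zero sub(2) by (metis image_eqI)
    show "a - b \<in> emb ` G" if ab: "a \<in> emb ` G" "b \<in> emb ` G" for a b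
    proof -
      obtain x y where "x \<in> G" "y \<in> G" "a = emb x" "b = emb y" using ab by blast
      then have "a - b = emb (x \<oplus> \<ominus> y)" "x \<oplus> \<ominus> y \<in> G" using sub GC by simp_all
      then show ?thesis by blast
    qed
  qed
  interpret Z: padic_coordinates G' "\<lambda>a. f (iv a)" p l
  proof
    show "prime p" "subgrp G'" by fact+
    show "f (iv (a + b)) i n = (f (iv a) i n + f (iv b) i n) mod int p ^ n"
      if ab: "a \<in> G'" "b \<in> G'" and "i < l" for a b i n
    proof -
      obtain x y where xy: "x \<in> G" "y \<in> G" "a = emb x" "b = emb y" using ab by (auto simp: G'_def)
      then have "iv (a + b) = x \<oplus> y" using iv[of "x \<oplus> y"] GC by simp
      then show ?thesis using xy GC iv f_add[OF xy(1,2) \<open>i < l\<close>] by simp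
    qed
    show "0 \<le> f (iv a) i n \<and> f (iv a) i n < int p ^ n" "f (iv a) i n = f (iv a) i (Suc n) mod int p ^ n"
      if a: "a \<in> G'" and "i < l" for a i n
    proof -
      obtain x where x: "x \<in> G" "a = emb x" using a by (auto simp: G'_def)
      then have "iv a = x" using iv GC by simp
      then show "0 \<le> f (iv a) i n \<and> f (iv a) i n < int p ^ n"
        "f (iv a) i n = f (iv a) i (Suc n) mod int p ^ n"
        using f_Z[OF x(1) \<open>i < l\<close>] by blast+
    qed
    show "a = b" if ab: "a \<in> G'" "b \<in> G'" and eq: "\<And>i n. i < l \<Longrightarrow> f (iv a) i n = f (iv b) i n" for a b
    proof -
      obtain x y where xy: "x \<in> G" "y \<in> G" "a = emb x" "b = emb y" using ab by (auto simp: G'_def)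
      then have "iv a = x" "iv b = y" using iv GC by simp_all
      then have "x = y" using eq by (intro f_inj[OF xy(1,2)]) simp
      then show ?thesis using xy by simp
    qed
    show "\<exists>g\<in>G'. \<forall>i<l. \<forall>n. f (iv g) i n = z i n"
      if z: "\<And>i n. i < l \<Longrightarrow> 0 \<le> z i n \<and> z i n < int p ^ n \<and> z i n = z i (Suc n) mod int p ^ n" for z
    proof -
      have "z i \<in> Z" if "i < l" for i unfolding Z_def using z[OF that] by blast
      then have "restrict z {..<l} \<in> PiE {..<l} (\<lambda>_. Z)" unfolding restrict_PiE_iff by simp
      then have "restrict z {..<l} \<in> f ` G" by (simp only: bij_betw_imp_surj_on[OF f_bij])
      then obtain x where x: "x \<in> G" "f x = restrict z {..<l}" by (metis imageE)
      have "iv (emb x) = x" using iv GC x(1) by blast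
      then have "\<forall>i<l. \<forall>n. f (iv (emb x)) i n = z i n" using x(2) by simp
      moreover have "emb x \<in> G'" unfolding G'_def using x(1) by (rule imageI)
      ultimately show ?thesis by blast
    qed
  qed
  \<comment> \<open>Elements of \<open>L'\<close> are themselves functions on \<open>L\<close>, so
    the pairing is evaluation at the element that \<open>b\<close> comes from.\<close>
  define e where "e a b = a (iv b)" for a b :: "'a \<Rightarrow> circ"
  have e: "e (emb x) (emb y) = emb x y" if "y \<in> C" for x y using that iv by (simp add: e_def)
  \<comment> \<open>The character \<open>nabla x\<close> kills \<open>p ^ n G\<close> for some
    \<open>n\<close>. Moving \<open>p ^ n\<close> to the other argument shows that
    \<open>mult (p ^ n) x\<close> is orthogonal to \<open>G\<close>, hence in
    \<open>G\<close>.\<close>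
  have torsion: "\<exists>n. nmul (p ^ n) (emb x) \<in> G'" if x: "x \<in> C" for x
  proof -
    have "\<exists>n. \<forall>g\<in>G. nabla x (mult (p ^ n) g) = 1"
    proof (rule character_kills_power[OF assms(3) sgG x])
      fix g assume g: "g \<in> G" "\<And>n. \<exists>h\<in>G. g = mult (p ^ n) h"
      have "\<exists>h\<in>G'. emb g = nmul (p ^ n) h" for n
        using g(2)[of n] GC by (auto simp: G'_def)
      then have "emb g = 0" by (rule Z.separated)
      then show "g = \<zero>" using emb_inj[of g \<zero>] GC[OF g(1)] by simp
    qed
    then obtain n where n: "\<And>g. g \<in> G \<Longrightarrow> nabla x (mult (p ^ n) g) = 1" by blast
    have "nabla (mult (p ^ n) x) g = 1" if g: "g \<in> G" for g
    proof -
      have "emb x (mult (p ^ n) g) = 0" using n[OF g] nabla_eq_1_iff[OF x] by simp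
      then have "emb (mult (p ^ n) g) x = 0" by (rule emb_eq_0_sym[OF x mult_closed[OF GC[OF g]]])
      then have "nmul (p ^ n) (emb g x) = 0" using GC[OF g] by (simp add: nmul_apply)
      then have "nmul (p ^ n) (emb x g) = 0"
        using emb_anti[OF x GC[OF g]] by (simp add: nmul_uminus)
      then show ?thesis using nabla_eq_1_iff[of "mult (p ^ n) x" g] x by (simp add: nmul_apply)
    qed
    then have "mult (p ^ n) x \<in> G" using maximal_isotropic_perp[OF assms(5)] x by simp
    then have "emb (mult (p ^ n) x) \<in> G'" unfolding G'_def by (rule imageI)
    then show ?thesis using x by auto
  qed
  interpret P: self_perp_pairing L' G' e p
  proof
    show "prime p" "subgrp L'" "subgrp G'" by fact+
    show "G' \<subseteq> L'" using GC by (auto simp: G'_def L'_def)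
    show "e (a + b) c = e a c + e b c" for a b c by (simp add: e_def)
    show "e a (b + c) = e a b + e a c" if "a \<in> L'" "b \<in> L'" "c \<in> L'" for a b c
    proof -
      obtain x y z where xyz: "x \<in> C" "y \<in> C" "z \<in> C" "a = emb x" "b = emb y" "c = emb z"
        using \<open>a \<in> L'\<close> \<open>b \<in> L'\<close> \<open>c \<in> L'\<close> by (auto simp: L'_def)
      have "b + c = emb (y \<oplus> z)" using xyz by simp
      then show ?thesis using xyz e[of "y \<oplus> z" x] e[of y x] e[of z x] by simp
    qed
    show "e a a = 0" if "a \<in> L'" for a using that e by (auto simp: L'_def)
    show "a = 0" if a: "a \<in> L'" "\<forall>b\<in>L'. e a b = 0" for a
    proof -
      obtain x where x: "x \<in> C" "a = emb x" using a by (auto simp: L'_def)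
      have "emb x y = 0" if "y \<in> C" for y using a(2) e[OF that] x that by (auto simp: L'_def)
      then have "x = \<zero>" using emb_nondeg x by blast
      then show ?thesis using x by simp
    qed
    show "a \<in> G' \<longleftrightarrow> (\<forall>g\<in>G'. e a g = 0)" if a: "a \<in> L'" for a
    proof -
      obtain x where x: "x \<in> C" "a = emb x" using a by (auto simp: L'_def)
      have "a \<in> G' \<longleftrightarrow> x \<in> G" using x emb_inj GC by (auto simp: G'_def)
      also have "\<dots> \<longleftrightarrow> (\<forall>g\<in>G. nabla x g = 1)"
        using isoG maximal_isotropic_perp[OF assms(5)] x by blast
      also have "\<dots> \<longleftrightarrow> (\<forall>g\<in>G. e a (emb g) = 0)"
        using nabla_eq_1_iff[OF x(1)] e GC x(2) by simp
      finally show ?thesis by (simp add: G'_def)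
    qed
    show "\<exists>z\<in>L'. \<forall>b\<in>L'. e z b = \<psi> b"
      if add: "\<And>a b. a \<in> L' \<Longrightarrow> b \<in> L' \<Longrightarrow> \<psi> (a + b) = \<psi> a + \<psi> b" and triv: "\<And>g. g \<in> G' \<Longrightarrow> \<psi> g = 0"
      for \<psi>
    proof -
      \<comment> \<open>The additive character becomes a circle-valued one, with value 1 off the
        carrier as \<open>characters\<close> requires. Its triviality on the open \<open>G\<close>
        supplies continuity, and then \<open>nabla\<close> is surjective onto such
        characters.\<close>
      define c where "c x = (if x \<in> C then Rep_circ (\<psi> (emb x)) else 1)" for x
      have mult: "c (x \<oplus> y) = c x * c y" if "x \<in> C" "y \<in> C" for x y
        using that add[of "emb x" "emb y"] by (simp add: c_def L'_def Rep_circ_add)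
      have "continuous_map X circle_top c"
      proof (rule trivial_on_open_continuous[OF assms(4) sgG _ mult])
        show "norm (c x) = 1" for x using Rep_circ[of "\<psi> (emb x)"] by (simp add: c_def)
        show "c g = 1" if "g \<in> G" for g
          using that triv[of "emb g"] GC by (simp add: c_def G'_def Rep_circ_0)
      qed
      moreover have "c x = 1" if "x \<notin> C" for x using that by (simp add: c_def)
      ultimately have "c \<in> characters L" using mult by (simp add: characters_def)
      then have "c \<in> nabla ` C" by (simp only: nabla_surj)
      then obtain z where z: "z \<in> C" "nabla z = c" by (metis imageE)
      have "e (emb z) (emb y) = \<psi> (emb y)" if "y \<in> C" for y
        using e[OF that, of z] Rep_emb[OF z(1), of y] z(2) that
        by (simp add: c_def Rep_circ_inject)
      then show ?thesis using z(1) by (auto simp: L'_def)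
    qed
    show "\<exists>n. nmul (p ^ n) a \<in> G'" if "a \<in> L'" for a using that torsion by (auto simp: L'_def)
    show "g = 0" if "g \<in> G'" "nmul p g = 0" for g using Z.torsion_free that .
    show "g = 0" if "\<And>n. \<exists>h\<in>G'. g = nmul (p ^ n) h" for g using Z.separated that .
    show "\<exists>S. \<forall>h. (\<forall>n. h n \<in> G') \<longrightarrow> S h \<in> G' \<and> S h = h 0 + nmul p (S (\<lambda>n. h (Suc n)))"
      by (rule Z.power_series)
    obtain F where F: "finite F" "F \<subseteq> G'" "\<And>g. g \<in> G' \<Longrightarrow> \<exists>f\<in>F. \<exists>h\<in>G'. g = f + nmul p h"
      using Z.finite_representatives by blast
    \<comment> \<open>When \<open>p\<close> times \<open>a\<close> lies in \<open>G'\<close>,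
      pairing with \<open>a\<close> is trivial on \<open>p\<close> times \<open>G'\<close>. So it is
      enough to test \<open>a\<close> on the representatives \<open>F\<close> of the classes modulo
      \<open>p\<close>.\<close>
    have "a \<in> G'" if a: "a \<in> L'" "nmul p a \<in> G'" "\<forall>f\<in>F. e a f = 0" for a
    proof -
      obtain x where x: "x \<in> C" "a = emb x" using a by (auto simp: L'_def)
      have "nabla x y = 1" if y: "y \<in> G" for y
      proof -
        obtain f h where fh: "f \<in> F" "h \<in> G'" "emb y = f + nmul p h"
          using F(3)[of "emb y"] y by (auto simp: G'_def)
        obtain u w where uw: "u \<in> G" "f = emb u" "w \<in> G" "h = emb w"
          using F(2) fh by (auto simp: G'_def)
        have "emb y = emb (u \<oplus> mult p w)" using fh(3) uw GC by simp
        then have y_eq: "y = u \<oplus> mult p w" using y uw(1,3) GC by (intro emb_eqD) simp_all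
        obtain v where v: "v \<in> G" "emb v = nmul p a" using a(2) by (auto simp: G'_def)
        have "v = mult p x" using v x GC by (intro emb_eqD) simp_all
        then have "nabla (mult p x) w = 1" using isoG v(1) uw by simp
        then have "nmul p (emb x w) = 0"
          using nabla_eq_1_iff[of "mult p x" w] x by (simp add: nmul_apply)
        then have "nabla x w ^ p = 1"
          using Rep_circ_nmul[of p "emb x w"] Rep_emb[OF x(1), of w] by (simp add: Rep_circ_0)
        moreover have "nabla x u = 1"
          using a(3) fh(1) uw(2) e[OF GC[OF uw(1)], of x] x nabla_eq_1_iff[OF x(1)] by simp
        ultimately show ?thesis
          unfolding y_eq using x uw GC by (simp add: nabla_add_right nabla_mult)
      qed
      then have "x \<in> G" using maximal_isotropic_perp[OF assms(5) x(1)] by blast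
      then show ?thesis using x by (simp add: G'_def)
    qed
    then show "\<exists>F. finite F \<and> F \<subseteq> G' \<and> (\<forall>x\<in>L'. nmul p x \<in> G' \<longrightarrow> (\<forall>f\<in>F. e x f = 0) \<longrightarrow> x \<in> G')"
      using F(1,2) by blast
  qed
  obtain A B where AB: "subgrp A" "subgrp B" "A \<subseteq> L'" "B \<subseteq> L'"
    and iso: "\<And>x y. x \<in> A \<Longrightarrow> y \<in> A \<Longrightarrow> e x y = 0" "\<And>x y. x \<in> B \<Longrightarrow> y \<in> B \<Longrightarrow> e x y = 0"
    and sums: "\<And>x. x \<in> L' \<Longrightarrow> x \<in> ssum A B" "\<And>g. g \<in> G' \<Longrightarrow> g \<in> ssum (G' \<inter> A) (G' \<inter> B)"
    using P.lagrangian_splitting by blast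
  define A0 where "A0 = {x \<in> C. emb x \<in> A}"
  define B0 where "B0 = {x \<in> C. emb x \<in> B}"
  interpret split_self_dual_group L nabla G A0 B0
  proof
    show "compactin X G" "openin X G" "maximal_isotropic L nabla G" by fact+
    show "is_subgroup A0 L" "is_subgroup B0 L"
      unfolding A0_def B0_def using AB emb_pullback by (auto simp: L'_def)
    show "nabla x y = 1" if "x \<in> A0" "y \<in> A0" for x y
      using that iso(1)[of "emb x" "emb y"] e[of y x] nabla_eq_1_iff[of x y] by (simp add: A0_def)
    show "nabla x y = 1" if "x \<in> B0" "y \<in> B0" for x y
      using that iso(2)[of "emb x" "emb y"] e[of y x] nabla_eq_1_iff[of x y] by (simp add: B0_def)
    show "\<exists>a\<in>A0. \<exists>b\<in>B0. x = a \<oplus> b" if x: "x \<in> C" for x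
    proof -
      have "emb x \<in> L'" using x by (simp add: L'_def)
      then obtain a b where ab: "a \<in> A" "b \<in> B" "emb x = a + b" using sums(1) by (blast elim: ssumE)
      obtain y z where yz: "y \<in> C" "a = emb y" "z \<in> C" "b = emb z"
        using subsetD[OF AB(3) ab(1)] subsetD[OF AB(4) ab(2)] by (auto simp: L'_def)
      have "x = y \<oplus> z" using x yz ab by (intro emb_eqD) simp_all
      then show ?thesis using yz ab by (auto simp: A0_def B0_def)
    qed
    show "\<exists>a\<in>G \<inter> A0. \<exists>b\<in>G \<inter> B0. x = a \<oplus> b" if x: "x \<in> G" for x
    proof -
      have "emb x \<in> G'" using x by (simp add: G'_def)
      then obtain a b where ab: "a \<in> G' \<inter> A" "b \<in> G' \<inter> B" "emb x = a + b"
        using sums(2) by (blast elim: ssumE)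
      obtain y z where yz: "y \<in> G" "a = emb y" "z \<in> G" "b = emb z"
        using ab by (auto simp: G'_def)
      have "x = y \<oplus> z" using x yz GC ab by (intro emb_eqD) simp_all
      then show ?thesis using yz ab GC by (auto simp: A0_def B0_def)
    qed
  qed
  show ?thesis by (rule standard)
qed

end
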